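(* Let $T$ be a complete first-order theory with monster model $\mathfrak{C}$ and let $A$ be a set. Let $p$ be a global stable type which is $A$-invariant. Then $p\restriction A$ is stable.
   Context: $T$ is a complete first-order theory and $\mathfrak{C}$ is its monster model; $A$ is a small subset of $\mathfrak{C}$. A global type is a type over $\mathfrak{C}$. A global type is $A$-invariant if it is invariant under automorphisms of $\mathfrak{C}$ fixing $A$ pointwise. A partial type $\pi(x)$ over $A$ is stable if every extension $q\in S(C)$ of $\pi$, over every $C\supseteq A$, is definable. *)

theory Defs
  imports Main
begin

section \<open>First-order languages, formulas with parameters, structures\<close>

text \<open>Symbols are given together with their arities; either set may be empty.\<close>

record ('f, 'r) lang =
  funs :: "('f \<times> nat) set"
  rels :: "('r \<times> nat) set"

text \<open>\<open>Par c\<close> is the constant symbol naming the element \<open>c\<close>; formulas over a parameter set \<open>C\<close>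
  are those in which all such constants come from \<open>C\<close>.\<close>

datatype ('f, 'c) tm =
  Var nat
| Par 'c
| Fn 'f "('f, 'c) tm list"

datatype ('f, 'r, 'c) fm =
  Fls
| Equ "('f, 'c) tm" "('f, 'c) tm"
| Rel 'r "('f, 'c) tm list"
| Imp "('f, 'r, 'c) fm" "('f, 'r, 'c) fm"
| Forall nat "('f, 'r, 'c) fm"

abbreviation Neg :: "('f, 'r, 'c) fm \<Rightarrow> ('f, 'r, 'c) fm" where
  "Neg \<phi> \<equiv> Imp \<phi> Fls"

fun wf_tm :: "('f, 'r) lang \<Rightarrow> ('f, 'c) tm \<Rightarrow> bool" where
  "wf_tm L (Var i) \<longleftrightarrow> True"
| "wf_tm L (Par c) \<longleftrightarrow> True"
| "wf_tm L (Fn f ts) \<longleftrightarrow> (f, length ts) \<in> funs L \<and> (\<forall>t\<in>set ts. wf_tm L t)"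

fun wf_fm :: "('f, 'r) lang \<Rightarrow> ('f, 'r, 'c) fm \<Rightarrow> bool" where
  "wf_fm L Fls \<longleftrightarrow> True"
| "wf_fm L (Equ t u) \<longleftrightarrow> wf_tm L t \<and> wf_tm L u"
| "wf_fm L (Rel r ts) \<longleftrightarrow> (r, length ts) \<in> rels L \<and> (\<forall>t\<in>set ts. wf_tm L t)"
| "wf_fm L (Imp \<phi> \<psi>) \<longleftrightarrow> wf_fm L \<phi> \<and> wf_fm L \<psi>"
| "wf_fm L (Forall k \<phi>) \<longleftrightarrow> wf_fm L \<phi>"

fun vars_tm :: "('f, 'c) tm \<Rightarrow> nat set" where
  "vars_tm (Var i) = {i}"
| "vars_tm (Par c) = {}"
| "vars_tm (Fn f ts) = (\<Union>t\<in>set ts. vars_tm t)"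

fun fv :: "('f, 'r, 'c) fm \<Rightarrow> nat set" where
  "fv Fls = {}"
| "fv (Equ t u) = vars_tm t \<union> vars_tm u"
| "fv (Rel r ts) = (\<Union>t\<in>set ts. vars_tm t)"
| "fv (Imp \<phi> \<psi>) = fv \<phi> \<union> fv \<psi>"
| "fv (Forall k \<phi>) = fv \<phi> - {k}"

abbreviation params :: "('f, 'r, 'c) fm \<Rightarrow> 'c set" where
  "params \<equiv> set3_fm"

abbreviation map_params :: "('c \<Rightarrow> 'd) \<Rightarrow> ('f, 'r, 'c) fm \<Rightarrow> ('f, 'r, 'd) fm" where
  "map_params h \<equiv> map_fm (\<lambda>f. f) (\<lambda>r. r) h"

text \<open>\<open>formulas L C n\<close>: the \<open>L(C)\<close>-formulas whose free variables are among the first \<open>n\<close> variables.\<close>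

definition formulas :: "('f, 'r) lang \<Rightarrow> 'c set \<Rightarrow> nat \<Rightarrow> ('f, 'r, 'c) fm set" where
  "formulas L C n = {\<phi>. wf_fm L \<phi> \<and> params \<phi> \<subseteq> C \<and> fv \<phi> \<subseteq> {..<n}}"

abbreviation sentences :: "('f, 'r) lang \<Rightarrow> 'c set \<Rightarrow> ('f, 'r, 'c) fm set" where
  "sentences L C \<equiv> formulas L C 0"

fun subst_tm :: "(nat \<Rightarrow> ('f, 'c) tm) \<Rightarrow> ('f, 'c) tm \<Rightarrow> ('f, 'c) tm" where
  "subst_tm \<theta> (Var i) = \<theta> i"
| "subst_tm \<theta> (Par c) = Par c"
| "subst_tm \<theta> (Fn f ts) = Fn f (map (subst_tm \<theta>) ts)"

text \<open>This does not rename bound variables, so it is only meant for substituting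
  closed terms, as in \<open>inst\<close> below.\<close>

fun subst :: "(nat \<Rightarrow> ('f, 'c) tm) \<Rightarrow> ('f, 'r, 'c) fm \<Rightarrow> ('f, 'r, 'c) fm" where
  "subst \<theta> Fls = Fls"
| "subst \<theta> (Equ t u) = Equ (subst_tm \<theta> t) (subst_tm \<theta> u)"
| "subst \<theta> (Rel r ts) = Rel r (map (subst_tm \<theta>) ts)"
| "subst \<theta> (Imp \<phi> \<psi>) = Imp (subst \<theta> \<phi>) (subst \<theta> \<psi>)"
| "subst \<theta> (Forall k \<phi>) = Forall k (subst (\<theta>(k := Var k)) \<phi>)"

text \<open>For \<open>\<phi>(x, y)\<close> with \<open>x\<close> the variables below \<open>n\<close> and \<open>y\<close> the following ones,
  \<open>inst n cs \<phi>\<close> is \<open>\<phi>(x, cs)\<close>.\<close>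

definition inst :: "nat \<Rightarrow> 'c list \<Rightarrow> ('f, 'r, 'c) fm \<Rightarrow> ('f, 'r, 'c) fm" where
  "inst n cs = subst (\<lambda>i. if n \<le> i \<and> i < n + length cs then Par (cs ! (i - n)) else Var i)"

record ('a, 'f, 'r) struct =
  univ :: "'a set"
  intf :: "'f \<Rightarrow> 'a list \<Rightarrow> 'a"
  intr :: "'r \<Rightarrow> 'a list \<Rightarrow> bool"

definition is_struct :: "('f, 'r) lang \<Rightarrow> ('a, 'f, 'r) struct \<Rightarrow> bool" where
  "is_struct L M \<longleftrightarrow> univ M \<noteq> {} \<and>
     (\<forall>(f, k)\<in>funs L. \<forall>as. length as = k \<and> set as \<subseteq> univ M \<longrightarrow> intf M f as \<in> univ M)"

fun val :: "('a, 'f, 'r) struct \<Rightarrow> (nat \<Rightarrow> 'a) \<Rightarrow> ('f, 'a) tm \<Rightarrow> 'a" where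
  "val M s (Var i) = s i"
| "val M s (Par c) = c"
| "val M s (Fn f ts) = intf M f (map (val M s) ts)"

fun sat :: "('a, 'f, 'r) struct \<Rightarrow> (nat \<Rightarrow> 'a) \<Rightarrow> ('f, 'r, 'a) fm \<Rightarrow> bool" where
  "sat M s Fls \<longleftrightarrow> False"
| "sat M s (Equ t u) \<longleftrightarrow> val M s t = val M s u"
| "sat M s (Rel r ts) \<longleftrightarrow> intr M r (map (val M s) ts)"
| "sat M s (Imp \<phi> \<psi>) \<longleftrightarrow> (sat M s \<phi> \<longrightarrow> sat M s \<psi>)"
| "sat M s (Forall k \<phi>) \<longleftrightarrow> (\<forall>a\<in>univ M. sat M (s(k := a)) \<phi>)"

definition valuations :: "('a, 'f, 'r) struct \<Rightarrow> (nat \<Rightarrow> 'a) set" where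
  "valuations M = {s. \<forall>i. s i \<in> univ M}"

definition models :: "('a, 'f, 'r) struct \<Rightarrow> ('f, 'r, 'a) fm \<Rightarrow> bool" where
  "models M \<phi> \<longleftrightarrow> (\<forall>s\<in>valuations M. sat M s \<phi>)"

text \<open>Consequence is tested in structures whose elements have type \<open>'a\<close>. Hence
  \<open>complete_theory L T\<close> is implied by completeness in the usual sense, where models of
  arbitrary size are considered.\<close>

definition entails ::
  "('f, 'r) lang \<Rightarrow> ('f, 'r, 'a) fm set \<Rightarrow> ('f, 'r, 'a) fm \<Rightarrow> bool" where
  "entails L T \<sigma> \<longleftrightarrow>
     (\<forall>M :: ('a, 'f, 'r) struct. is_struct L M \<and> (\<forall>\<tau>\<in>T. models M \<tau>) \<longrightarrow> models M \<sigma>)"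

definition complete_theory :: "('f, 'r) lang \<Rightarrow> ('f, 'r, 'a) fm set \<Rightarrow> bool" where
  "complete_theory L T \<longleftrightarrow> T \<subseteq> sentences L {} \<and>
     (\<forall>\<sigma>\<in>sentences L {}. entails L T \<sigma> \<or> entails L T (Neg \<sigma>))"


section \<open>Types\<close>

text \<open>Types are in the first \<open>n\<close> variables. Being consistent with the elementary diagram
  is expressed as finite satisfiability in the structure.\<close>

definition partial_type ::
  "('f, 'r) lang \<Rightarrow> ('a, 'f, 'r) struct \<Rightarrow> nat \<Rightarrow> 'a set \<Rightarrow> ('f, 'r, 'a) fm set \<Rightarrow> bool" where
  "partial_type L M n A \<pi> \<longleftrightarrow> A \<subseteq> univ M \<and> \<pi> \<subseteq> formulas L A n \<and>
     (\<forall>\<Phi>. finite \<Phi> \<and> \<Phi> \<subseteq> \<pi> \<longrightarrow> (\<exists>s\<in>valuations M. \<forall>\<phi>\<in>\<Phi>. sat M s \<phi>))"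

definition complete_types ::
  "('f, 'r) lang \<Rightarrow> ('a, 'f, 'r) struct \<Rightarrow> nat \<Rightarrow> 'a set \<Rightarrow> ('f, 'r, 'a) fm set set" where
  "complete_types L M n C =
     {q. partial_type L M n C q \<and> (\<forall>\<phi>\<in>formulas L C n. \<phi> \<in> q \<or> Neg \<phi> \<in> q)}"

definition restrict_type :: "('f, 'r, 'a) fm set \<Rightarrow> 'a set \<Rightarrow> ('f, 'r, 'a) fm set" where
  "restrict_type p A = {\<phi>\<in>p. params \<phi> \<subseteq> A}"

text \<open>Definability of \<open>q \<in> S\<^sub>n(C)\<close> is over its own domain \<open>C\<close>.\<close>

definition definable_type ::
  "('f, 'r) lang \<Rightarrow> ('a, 'f, 'r) struct \<Rightarrow> nat \<Rightarrow> 'a set \<Rightarrow> ('f, 'r, 'a) fm set \<Rightarrow> bool" where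
  "definable_type L M n C q \<longleftrightarrow>
     (\<forall>m. \<forall>\<phi>\<in>formulas L {} (n + m). \<exists>\<psi>\<in>formulas L C m.
        \<forall>cs. length cs = m \<and> set cs \<subseteq> C \<longrightarrow> (inst n cs \<phi> \<in> q \<longleftrightarrow> models M (inst 0 cs \<psi>)))"


section \<open>Elementary maps and monster models\<close>

definition elementary_map ::
  "('f, 'r) lang \<Rightarrow> ('a, 'f, 'r) struct \<Rightarrow> ('b, 'f, 'r) struct \<Rightarrow> 'a set \<Rightarrow> ('a \<Rightarrow> 'b) \<Rightarrow> bool" where
  "elementary_map L M N B h \<longleftrightarrow> B \<subseteq> univ M \<and> h ` B \<subseteq> univ N \<and>
     (\<forall>\<sigma>\<in>sentences L B. models M \<sigma> \<longleftrightarrow> models N (map_params h \<sigma>))"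

definition automorphism ::
  "('f, 'r) lang \<Rightarrow> ('a, 'f, 'r) struct \<Rightarrow> ('a \<Rightarrow> 'a) \<Rightarrow> bool" where
  "automorphism L M g \<longleftrightarrow> bij_betw g (univ M) (univ M) \<and>
     (\<forall>(f, k)\<in>funs L. \<forall>as. length as = k \<and> set as \<subseteq> univ M \<longrightarrow>
        g (intf M f as) = intf M f (map g as)) \<and>
     (\<forall>(r, k)\<in>rels L. \<forall>as. length as = k \<and> set as \<subseteq> univ M \<longrightarrow>
        (intr M r as \<longleftrightarrow> intr M r (map g as)))"

definition small :: "'k rel \<Rightarrow> 'b set \<Rightarrow> bool" where
  "small \<kappa> B \<longleftrightarrow> (card_of B, \<kappa>) \<in> ordLess"

text \<open>\<open>monster L \<kappa> M\<close>: \<open>M\<close> is \<open>\<kappa>\<close>-saturated and strongly \<open>\<kappa>\<close>-homogeneous for a cardinal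
  \<open>\<kappa> > |L| + \<aleph>\<^sub>0\<close>.\<close>

definition monster :: "('f, 'r) lang \<Rightarrow> 'k rel \<Rightarrow> ('a, 'f, 'r) struct \<Rightarrow> bool" where
  "monster L \<kappa> M \<longleftrightarrow> is_struct L M \<and>
     Card_order \<kappa> \<and> (natLeq, \<kappa>) \<in> ordLess \<and> small \<kappa> (funs L) \<and> small \<kappa> (rels L) \<and>
     (\<forall>B n. B \<subseteq> univ M \<and> small \<kappa> B \<longrightarrow>
        (\<forall>q\<in>complete_types L M n B. \<exists>s\<in>valuations M. \<forall>\<phi>\<in>q. sat M s \<phi>)) \<and>
     (\<forall>B h. small \<kappa> B \<and> elementary_map L M M B h \<longrightarrow>
        (\<exists>g. automorphism L M g \<and> (\<forall>b\<in>B. g b = h b)))"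

definition invariant_type ::
  "('f, 'r) lang \<Rightarrow> ('a, 'f, 'r) struct \<Rightarrow> 'a set \<Rightarrow> ('f, 'r, 'a) fm set \<Rightarrow> bool" where
  "invariant_type L M A p \<longleftrightarrow>
     (\<forall>g. automorphism L M g \<and> (\<forall>a\<in>A. g a = a) \<longrightarrow> map_params g ` p = p)"


section \<open>Stable types\<close>

text \<open>The sets \<open>C \<supseteq> A\<close> over which extensions of \<open>\<pi>\<close> are taken range over subsets of arbitrary
  elementary extensions \<open>N\<close> of \<open>M\<close> (not just of \<open>M\<close>): otherwise a type over all of \<open>M\<close> would
  have no proper extension. An elementary extension is given by an elementary embedding \<open>h\<close> into
  a structure \<open>N\<close> with elements of type \<open>'u\<close>, along which \<open>A\<close> and \<open>\<pi>\<close> are transported. HOL cannot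
  quantify over types inside a formula, so \<open>'u\<close> is an argument of the predicate. If \<open>M\<close> is a
  monster model and \<open>'u\<close> has at least as many elements as \<open>M\<close>, then for a complete type over all
  of \<open>M\<close> the choice of \<open>'u\<close> is immaterial by compactness and Loewenheim-Skolem.\<close>

definition stable_type ::
  "'u itself \<Rightarrow> ('f, 'r) lang \<Rightarrow> ('a, 'f, 'r) struct \<Rightarrow> nat \<Rightarrow> 'a set \<Rightarrow> ('f, 'r, 'a) fm set \<Rightarrow> bool"
  where
  "stable_type (_ :: 'u itself) L M n A \<pi> \<longleftrightarrow> partial_type L M n A \<pi> \<and>
     (\<forall>(N :: ('u, 'f, 'r) struct) h C q.
        is_struct L N \<and> elementary_map L M N (univ M) h \<and>
        h ` A \<subseteq> C \<and> C \<subseteq> univ N \<and>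
        q \<in> complete_types L N n C \<and> map_params h ` \<pi> \<subseteq> q \<longrightarrow>
        definable_type L N n C q)"

end

theory Submission
  imports Defs
begin

text \<open>
  Fix a formula \<open>\<phi>(x, y)\<close>. Shelah's 2-rank of a definable set \<open>X\<close> counts how often \<open>X\<close> can be split,
  in the manner of a binary tree, by sets \<open>\<phi>(x, b)\<close>. The proof rests on reading stability as a property
  of single formulas: \<open>p\<close> is stable iff for every \<open>\<phi>\<close> some \<open>\<theta> \<in> p\<close> has finite \<open>\<phi>\<close>-rank.

  If \<open>\<theta>\<close> has finite rank, then every complete type containing \<open>\<theta>\<close> is definable
  (\<open>definable_type_if_finite_rank\<close>): among its formulas pick \<open>\<psi>\<close> of least rank, and \<open>\<phi>(x, c)\<close> is in the
  type iff \<open>\<psi> \<and> \<phi>(x, c)\<close> still has that rank, which is a first-order condition on \<open>c\<close>. Having finite rank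
  is first-order as well, so it survives elementary extensions (\<open>fm_rank_ge_elementary\<close>). Conversely, if
  all of \<open>p\<close> has infinite rank, compactness yields in some elementary extension a realization \<open>a\<close> of \<open>p\<close> and
  pairs \<open>b\<^sub>i, b'\<^sub>i\<close>, each of the same type over \<open>\<CC>\<close> and the earlier pairs, with \<open>\<phi>(a, b\<^sub>i)\<close> and
  \<open>\<not> \<phi>(a, b'\<^sub>i)\<close>. No definition of the type of \<open>a\<close> over \<open>\<CC>\<close> and all the pairs can then be correct on a pair
  beyond its parameters, so \<open>p\<close> is not stable (\<open>stable_type_finite_rank\<close>). The extension has to be
  of size at most \<open>|\<CC>|\<close>; a Skolem hull in an ultrapower provides it.

  What remains is to move the finite rank from a formula \<open>\<theta>(x, c)\<close> of \<open>p\<close> to a formula over \<open>A\<close>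
  (\<open>finite_rank_over\<close>). By invariance all Morley sequences of \<open>p\<close> over \<open>A\<close> of a given length are
  conjugate over \<open>A\<close>. Long Morley sequences that lie in a set of finite rank admit no order, and
  conjugation carries this to all of them: this gives generic stability (\<open>generically_stable\<close>: no
  long Morley sequence over \<open>A\<close> avoids a formula of \<open>p\<close>) and \<open>symmetry\<close>.

  Suppose that every formula of \<open>p\<close> over \<open>A\<close> has infinite rank. This is inherited by \<open>A \<union> e\<close> for \<open>e\<close> realizing
  \<open>p\<close> over \<open>A\<close> (\<open>unranked_step\<close>): were \<open>\<chi>(x, e) \<in> p\<close> of finite rank, then by generic stability and symmetry
  every realization of \<open>p\<close> over \<open>A\<close> would lie in one of finitely many conjugates \<open>\<chi>(x, e\<^sub>j)\<close>, and a formula over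
  \<open>A\<close> would have finite rank because ranks are subadditive. But then one can build a Morley sequence
  \<open>a\<^sub>0, a\<^sub>1, \<dots>\<close> over \<open>A\<close> none of whose members satisfies the finite rank formula \<open>\<theta>(x, c) \<in> p\<close>: at each step
  the formulas over \<open>A \<union> a\<^sub>0 \<dots> a\<^sub>i\<close> in \<open>p\<close> have infinite rank and are not contained in \<open>\<theta>(x, c)\<close>. This contradicts
  generic stability.
\<close>

section \<open>Renaming variables and abstracting parameters\<close>

text \<open>Bound variables are renamed as well, so an injective \<open>f\<close> cannot cause capture; \<open>g\<close> selects the parameters that
  become variables.\<close>

fun ren_tm :: "(nat \<Rightarrow> nat) \<Rightarrow> ('c \<Rightarrow> nat option) \<Rightarrow> ('f, 'c) tm \<Rightarrow> ('f, 'c) tm" where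
  "ren_tm f g (Var i) = Var (f i)"
| "ren_tm f g (Par c) = (case g c of None \<Rightarrow> Par c | Some l \<Rightarrow> Var l)"
| "ren_tm f g (Fn k ts) = Fn k (map (ren_tm f g) ts)"

fun ren :: "(nat \<Rightarrow> nat) \<Rightarrow> ('c \<Rightarrow> nat option) \<Rightarrow> ('f, 'r, 'c) fm \<Rightarrow> ('f, 'r, 'c) fm" where
  "ren f g Fls = Fls"
| "ren f g (Equ t u) = Equ (ren_tm f g t) (ren_tm f g u)"
| "ren f g (Rel r ts) = Rel r (map (ren_tm f g) ts)"
| "ren f g (Imp \<phi> \<psi>) = Imp (ren f g \<phi>) (ren f g \<psi>)"
| "ren f g (Forall k \<phi>) = Forall (f k) (ren f g \<phi>)"

lemma val_ren_tm:
  assumes "\<And>c l. c \<in> set2_tm t \<Longrightarrow> g c = Some l \<Longrightarrow> s l = h c"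
  shows "val M s (map_tm (\<lambda>f. f) h (ren_tm f g t)) = val M (\<lambda>i. s (f i)) (map_tm (\<lambda>f. f) h t)"
  using assms
proof (induction t)
  case (Fn k ts)
  have "map (\<lambda>t. val M s (map_tm (\<lambda>f. f) h (ren_tm f g t))) ts
      = map (\<lambda>t. val M (\<lambda>i. s (f i)) (map_tm (\<lambda>f. f) h t)) ts"
    using Fn by (auto intro!: Fn.IH)
  then show ?case by (simp add: o_def del: map_eq_conv)
qed (auto split: option.splits)

text \<open>Parameters are evaluated through a map \<open>h\<close>, so that one renaming serves a formula together with all its
  images under maps of parameters.\<close>

lemma sat_ren:
  assumes "inj f" "\<And>c l. c \<in> params \<phi> \<Longrightarrow> g c = Some l \<Longrightarrow> l \<notin> range f \<and> s l = h c"
  shows "sat M s (map_params h (ren f g \<phi>)) \<longleftrightarrow> sat M (\<lambda>i. s (f i)) (map_params h \<phi>)"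
  using assms(2)
proof (induction \<phi> arbitrary: s)
  case (Equ t u)
  then show ?case by (simp add: val_ren_tm)
next
  case (Rel r ts)
  then have "map (\<lambda>t. val M s (map_tm (\<lambda>f. f) h (ren_tm f g t))) ts
      = map (\<lambda>t. val M (\<lambda>i. s (f i)) (map_tm (\<lambda>f. f) h t)) ts"
    by (auto intro: val_ren_tm)
  then show ?case by (simp add: o_def del: map_eq_conv)
next
  case (Imp \<phi> \<psi>)
  have "sat M s (map_params h (ren f g \<phi>)) \<longleftrightarrow> sat M (\<lambda>i. s (f i)) (map_params h \<phi>)"
    "sat M s (map_params h (ren f g \<psi>)) \<longleftrightarrow> sat M (\<lambda>i. s (f i)) (map_params h \<psi>)"
    using Imp.prems by (intro Imp.IH Imp.prems; simp)+
  then show ?case by simp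
next
  case (Forall k \<phi>)
  have upd: "(\<lambda>i. (s(f k := a)) (f i)) = (\<lambda>i. s (f i))(k := a)" for a
    using assms(1) by (auto simp: fun_eq_iff inj_eq)
  have "sat M (s(f k := a)) (map_params h (ren f g \<phi>)) \<longleftrightarrow> sat M ((\<lambda>i. s (f i))(k := a)) (map_params h \<phi>)" for a
    unfolding upd[symmetric] using Forall.prems by (intro Forall.IH) auto
  then show ?case by simp
qed simp

lemma wf_tm_ren [simp]: "wf_tm L (ren_tm f g t) = wf_tm L t"
  by (induction t) (auto split: option.splits)

lemma wf_ren [simp]: "wf_fm L (ren f g \<phi>) = wf_fm L \<phi>"
  by (induction \<phi>) auto

lemma vars_ren_tm: "vars_tm (ren_tm f g t) \<subseteq> f ` vars_tm t \<union> {l. \<exists>c\<in>set2_tm t. g c = Some l}"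
proof (induction t)
  case (Par c)
  show ?case by (cases "g c") auto
next
  case (Fn k ts)
  then show ?case by fastforce
qed simp

lemma fv_ren:
  assumes "inj f"
  shows "fv (ren f g \<phi>) \<subseteq> f ` fv \<phi> \<union> {l. \<exists>c\<in>params \<phi>. g c = Some l}"
proof (induction \<phi>)
  case (Equ t u)
  then show ?case using vars_ren_tm[of f g t] vars_ren_tm[of f g u] by fastforce
next
  case (Rel r ts)
  then show ?case using vars_ren_tm[of f g] by fastforce
next
  case (Forall k \<phi>)
  then show ?case using assms by (auto simp: inj_eq)
qed auto

lemma params_ren_tm: "set2_tm (ren_tm f g t) \<subseteq> {c \<in> set2_tm t. g c = None}"
proof (induction t)
  case (Par c)
  show ?case by (cases "g c") auto
next
  case (Fn k ts)
  then show ?case by fastforce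
qed simp

lemma params_ren: "params (ren f g \<phi>) \<subseteq> {c \<in> params \<phi>. g c = None}"
proof (induction \<phi>)
  case (Equ t u)
  then show ?case using params_ren_tm[of f g t] params_ren_tm[of f g u] by fastforce
next
  case (Rel r ts)
  then show ?case using params_ren_tm[of f g] by fastforce
qed auto

lemma wf_tm_map [simp]: "wf_tm L (map_tm (\<lambda>f. f) h t) = wf_tm L t"
  by (induction t) auto

lemma wf_map_params [simp]: "wf_fm L (map_params h \<phi>) = wf_fm L \<phi>"
  by (induction \<phi>) auto

lemma vars_tm_map [simp]: "vars_tm (map_tm (\<lambda>f. f) h t) = vars_tm t"
  by (induction t) auto

lemma fv_map_params [simp]: "fv (map_params h \<phi>) = fv \<phi>"
  by (induction \<phi>) auto

lemma map_params_formulas: "\<phi> \<in> formulas L B n \<Longrightarrow> map_params h \<phi> \<in> formulas L (h ` B) n"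
  by (auto simp: formulas_def fm.set_map)

lemma map_params_comp: "map_params g (map_params h \<phi>) = map_params (g \<circ> h) \<phi>"
  by (simp add: fm.map_comp o_def)

lemma map_params_idem: "(\<And>c. c \<in> params \<phi> \<Longrightarrow> h c = c) \<Longrightarrow> map_params h \<phi> = \<phi>"
  using fm.map_cong[of \<phi> \<phi> "\<lambda>f. f" "\<lambda>f. f" "\<lambda>r. r" "\<lambda>r. r" h "\<lambda>c. c"] by (simp add: fm.map_ident)

lemma formulas_mono: "B \<subseteq> C \<Longrightarrow> n \<le> m \<Longrightarrow> formulas L B n \<subseteq> formulas L C m"
  by (auto simp: formulas_def)

lemma val_cong: "(\<And>i. i \<in> vars_tm t \<Longrightarrow> s i = s' i) \<Longrightarrow> val M s t = val M s' t"
proof (induction t)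
  case (Fn f ts)
  then have "map (val M s) ts = map (val M s') ts" by auto
  then show ?case by (simp del: map_eq_conv)
qed auto

lemma sat_cong: "(\<And>i. i \<in> fv \<phi> \<Longrightarrow> s i = s' i) \<Longrightarrow> sat M s \<phi> = sat M s' \<phi>"
proof (induction \<phi> arbitrary: s s')
  case (Equ t u)
  have "val M s t = val M s' t" "val M s u = val M s' u"
    using Equ by (intro val_cong; simp)+
  then show ?case by simp
next
  case (Rel r ts)
  then have "map (val M s) ts = map (val M s') ts" by (auto intro: val_cong)
  then show ?case by (simp del: map_eq_conv)
next
  case (Imp \<phi> \<psi>)
  have "sat M s \<phi> = sat M s' \<phi>" "sat M s \<psi> = sat M s' \<psi>"
    using Imp.prems by (intro Imp.IH; simp)+
  then show ?case by simp
next
  case (Forall k \<phi>)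
  then have "sat M (s(k := a)) \<phi> = sat M (s'(k := a)) \<phi>" for a
    by (intro Forall.IH) auto
  then show ?case by simp
qed auto

lemma sat_formulas_cong:
  "\<phi> \<in> formulas L B n \<Longrightarrow> (\<And>i. i < n \<Longrightarrow> s i = s' i) \<Longrightarrow> sat M s \<phi> = sat M s' \<phi>"
  by (rule sat_cong) (auto simp: formulas_def)

text \<open>The formula \<open>\<phi>\<close> does not depend on the map \<open>h\<close> of parameters nor on the structure. This is how automorphisms and
  elementary maps enter: they move the parameters \<open>cs\<close> and leave \<open>\<phi>\<close> alone.\<close>

lemma parameters_to_variables:
  assumes "\<psi> \<in> formulas L (B \<union> set cs) n"
  shows "\<exists>\<phi>\<in>formulas L B (n + length cs). \<forall>(M :: ('d, 'f, 'r) struct) h xs. length xs = n \<longrightarrow>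
       sat M ((!) (xs @ map h cs)) (map_params h \<phi>) \<longleftrightarrow> sat M ((!) xs) (map_params h \<psi>)"
proof -
  define m where "m = length cs"
  have "\<exists>l. n \<le> l \<and> l < n + m \<and> cs ! (l - n) = c" if "c \<in> set cs" for c
    using that unfolding in_set_conv_nth m_def by (metis add_diff_cancel_left' le_add1 nat_add_left_cancel_less)
  then obtain l where l: "\<And>c. c \<in> set cs \<Longrightarrow> n \<le> l c \<and> l c < n + m \<and> cs ! (l c - n) = c"
    by metis
  define g where "g c = (if c \<in> B then None else Some (l c))" for c
  \<comment> \<open>Bound variables from \<open>n\<close> on make room for the \<open>m\<close> new variables, whether free or not.\<close>
  define f where "f i = (if i < n then i else i + m)" for i
  have inj: "inj f" by (auto simp: inj_def f_def split: if_splits)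
  have Some: "n \<le> k \<and> k < n + m \<and> cs ! (k - n) = c" if "c \<in> params \<psi>" "g c = Some k" for c k
    using that l assms by (auto simp: g_def formulas_def split: if_splits)
  have "params (ren f g \<psi>) \<subseteq> B"
    using params_ren[of f g \<psi>] by (auto simp: g_def split: if_splits)
  moreover have "f ` fv \<psi> \<union> {l. \<exists>c\<in>params \<psi>. g c = Some l} \<subseteq> {..<n + m}"
    using Some assms by (auto simp: f_def formulas_def)
  with fv_ren[OF inj] have "fv (ren f g \<psi>) \<subseteq> {..<n + m}" by (rule order_trans)
  ultimately have formulas: "ren f g \<psi> \<in> formulas L B (n + length cs)"
    using assms by (simp add: formulas_def m_def)
  have "sat M ((!) (xs @ map h cs)) (map_params h (ren f g \<psi>)) \<longleftrightarrow> sat M ((!) xs) (map_params h \<psi>)"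
    if len: "length xs = n" for M :: "('d, 'f, 'r) struct" and h xs
  proof -
    have "sat M ((!) (xs @ map h cs)) (map_params h (ren f g \<psi>))
        \<longleftrightarrow> sat M (\<lambda>i. (xs @ map h cs) ! f i) (map_params h \<psi>)"
    proof (rule sat_ren[OF inj])
      fix c k assume "c \<in> params \<psi>" "g c = Some k"
      from Some[OF this] show "k \<notin> range f \<and> (xs @ map h cs) ! k = h c"
        using len by (auto simp: f_def nth_append m_def)
    qed
    also have "\<dots> \<longleftrightarrow> sat M ((!) xs) (map_params h \<psi>)"
      by (rule sat_cong) (use assms len in \<open>auto simp: formulas_def f_def nth_append\<close>)
    finally show ?thesis .
  qed
  with formulas show ?thesis by blast
qed

definition block_swap :: "nat \<Rightarrow> nat \<Rightarrow> nat \<Rightarrow> nat" where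
  "block_swap a b i = (if i < a then b + i else if i < a + b then i - a else i)"

definition swap_vars :: "nat \<Rightarrow> nat \<Rightarrow> ('f, 'r, 'c) fm \<Rightarrow> ('f, 'r, 'c) fm" where
  "swap_vars a b = ren (block_swap a b) (\<lambda>_. None)"

lemma map_tm_ren_tm: "map_tm (\<lambda>f. f) h (ren_tm f (\<lambda>_. None) t) = ren_tm f (\<lambda>_. None) (map_tm (\<lambda>f. f) h t)"
  by (induction t) auto

lemma map_params_rename:
  "map_params h (ren f (\<lambda>_. None) \<phi>) = ren f (\<lambda>_. None) (map_params h \<phi>)"
  by (induction \<phi>) (auto simp: map_tm_ren_tm)

lemma fv_rename: "inj f \<Longrightarrow> fv (ren f (\<lambda>_. None) \<phi>) \<subseteq> f ` fv \<phi>"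
  using fv_ren[of f "\<lambda>_. None" \<phi>] by simp

lemma params_rename: "params (ren f (\<lambda>_. None) \<phi>) \<subseteq> params \<phi>"
  using params_ren[of f "\<lambda>_. None" \<phi>] by simp

lemma inj_block_swap: "inj (block_swap a b)"
  unfolding inj_def block_swap_def by (intro allI impI) (simp split: if_splits)

lemma sat_rename:
  "inj f \<Longrightarrow> sat M s (ren f (\<lambda>_. None) \<phi>) \<longleftrightarrow> sat M (\<lambda>i. s (f i)) \<phi>"
  using sat_ren[of f \<phi> "\<lambda>_. None" s "\<lambda>c. c" M] by (simp add: fm.map_ident)

lemma swap_vars_formulas:
  assumes "\<phi> \<in> formulas L B (a + b)"
  shows "swap_vars a b \<phi> \<in> formulas L B (b + a)"
proof -
  have "block_swap a b ` {..<a + b} \<subseteq> {..<b + a}" by (auto simp: block_swap_def)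
  with assms have "block_swap a b ` fv \<phi> \<subseteq> {..<b + a}" unfolding formulas_def by blast
  moreover have "fv (swap_vars a b \<phi>) \<subseteq> block_swap a b ` fv \<phi>"
    unfolding swap_vars_def by (rule fv_rename[OF inj_block_swap])
  moreover have "params (swap_vars a b \<phi>) \<subseteq> params \<phi>"
    unfolding swap_vars_def by (rule params_rename)
  moreover have "wf_fm L (swap_vars a b \<phi>) = wf_fm L \<phi>" by (simp add: swap_vars_def)
  ultimately show ?thesis using assms unfolding formulas_def mem_Collect_eq by (meson order_trans)
qed

lemma sat_swap_vars:
  assumes "\<phi> \<in> formulas L B (a + b)" "length xs = a" "length ys = b"
  shows "sat M ((!) (ys @ xs)) (swap_vars a b \<phi>) \<longleftrightarrow> sat M ((!) (xs @ ys)) \<phi>"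
  unfolding swap_vars_def sat_rename[OF inj_block_swap]
proof (rule sat_formulas_cong[OF assms(1)])
  fix i assume "i < a + b"
  then show "(ys @ xs) ! block_swap a b i = (xs @ ys) ! i"
    unfolding block_swap_def nth_append using assms(2,3) by auto
qed

lemma val_subst_tm: "val M s (subst_tm \<theta> t) = val M (\<lambda>i. val M s (\<theta> i)) t"
proof (induction t)
  case (Fn f ts)
  then have "map (val M s \<circ> subst_tm \<theta>) ts = map (val M (\<lambda>i. val M s (\<theta> i))) ts" by simp
  then show ?case by (simp del: map_eq_conv)
qed auto

lemma sat_subst:
  assumes "\<And>i. \<theta> i = Var i \<or> (\<exists>c. \<theta> i = Par c)"
  shows "sat M s (subst \<theta> \<phi>) \<longleftrightarrow> sat M (\<lambda>i. val M s (\<theta> i)) \<phi>"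
  using assms
proof (induction \<phi> arbitrary: s \<theta>)
  case (Rel r ts)
  have "map (val M s \<circ> subst_tm \<theta>) ts = map (val M (\<lambda>i. val M s (\<theta> i))) ts" 
    by (simp add: val_subst_tm)
  then show ?case by (simp del: map_eq_conv)
next
  case (Forall k \<phi>)
  have "sat M (s(k := a)) (subst (\<theta>(k := Var k)) \<phi>)
      \<longleftrightarrow> sat M ((\<lambda>i. val M s (\<theta> i))(k := a)) \<phi>" for a
  proof -
    have "(\<lambda>i. val M (s(k := a)) ((\<theta>(k := Var k)) i)) = (\<lambda>i. val M s (\<theta> i))(k := a)"
      using Forall.prems by (auto simp: fun_eq_iff) (metis fun_upd_other val.simps(1,2))
    moreover have "(\<theta>(k := Var k)) i = Var i \<or> (\<exists>c. (\<theta>(k := Var k)) i = Par c)" for i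
      using Forall.prems[of i] by auto
    ultimately show ?thesis using Forall.IH[of "\<theta>(k := Var k)" "s(k := a)"] by (simp only:)
  qed
  then show ?case by simp
qed (auto simp: val_subst_tm)

lemma sat_inst:
  assumes "\<phi> \<in> formulas L B (n + length cs)" "length xs = n"
  shows "sat M ((!) xs) (inst n cs \<phi>) \<longleftrightarrow> sat M ((!) (xs @ cs)) \<phi>"
  unfolding inst_def
  by (subst sat_subst) (auto intro!: sat_formulas_cong[OF assms(1)] simp: assms nth_append)

lemma wf_tm_subst: "wf_tm L t \<Longrightarrow> (\<And>i. wf_tm L (\<theta> i)) \<Longrightarrow> wf_tm L (subst_tm \<theta> t)"
  by (induction t) auto

lemma wf_subst: "wf_fm L \<phi> \<Longrightarrow> (\<And>i. wf_tm L (\<theta> i)) \<Longrightarrow> wf_fm L (subst \<theta> \<phi>)"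
  by (induction \<phi> arbitrary: \<theta>) (auto simp: wf_tm_subst)

lemma vars_subst_tm: "vars_tm (subst_tm \<theta> t) = (\<Union>i\<in>vars_tm t. vars_tm (\<theta> i))"
  by (induction t) auto

lemma fv_subst:
  assumes "\<And>i. \<theta> i = Var i \<or> (\<exists>c. \<theta> i = Par c)"
  shows "fv (subst \<theta> \<phi>) \<subseteq> (\<Union>i\<in>fv \<phi>. vars_tm (\<theta> i))"
  using assms
proof (induction \<phi> arbitrary: \<theta>)
  case (Forall k \<phi>)
  have "fv (subst (\<theta>(k := Var k)) \<phi>) \<subseteq> (\<Union>i\<in>fv \<phi>. vars_tm ((\<theta>(k := Var k)) i))"
    by (rule Forall.IH) (use Forall.prems in auto)
  then show ?case by (fastforce split: if_splits)
next
  case (Imp \<phi> \<psi>)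
  show ?case using Imp.IH[OF Imp.prems] by auto
qed (auto simp: vars_subst_tm)

lemma params_subst_tm: "set2_tm (subst_tm \<theta> t) \<subseteq> set2_tm t \<union> (\<Union>i. set2_tm (\<theta> i))"
  by (induction t) fastforce+

lemma params_subst: "params (subst \<theta> \<phi>) \<subseteq> params \<phi> \<union> (\<Union>i. set2_tm (\<theta> i))"
proof (induction \<phi> arbitrary: \<theta>)
  case (Equ t u)
  then show ?case using params_subst_tm[of \<theta> t] params_subst_tm[of \<theta> u] by fastforce
next
  case (Rel r ts)
  then show ?case using params_subst_tm[of \<theta>] by fastforce
next
  case (Imp \<phi> \<psi>)
  from Imp.IH(1)[of \<theta>] Imp.IH(2)[of \<theta>] show ?case by auto
next
  case (Forall k \<phi>)
  have "(\<Union>i. set2_tm ((\<theta>(k := Var k)) i)) \<subseteq> (\<Union>i. set2_tm (\<theta> i))"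
    by (auto split: if_splits)
  with Forall.IH[of "\<theta>(k := Var k)"] show ?case by (simp del: fun_upd_apply) blast
qed auto

lemma inst_formulas:
  assumes "\<phi> \<in> formulas L B (n + length cs)" "B \<subseteq> C" "set cs \<subseteq> C"
  shows "inst n cs \<phi> \<in> formulas L C n"
proof -
  let ?\<theta> = "\<lambda>i. if n \<le> i \<and> i < n + length cs then Par (cs ! (i - n)) else Var i"
  have "wf_fm L (subst ?\<theta> \<phi>)" by (rule wf_subst) (use assms in \<open>auto simp: formulas_def\<close>)
  moreover have "(\<Union>i. set2_tm (?\<theta> i)) \<subseteq> set cs" by (rule UN_least) auto
  then have "params \<phi> \<union> (\<Union>i. set2_tm (?\<theta> i)) \<subseteq> C"
    using assms by (intro Un_least) (auto simp: formulas_def)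
  with params_subst have "params (subst ?\<theta> \<phi>) \<subseteq> C" by (rule order_trans)
  moreover have "(\<Union>i\<in>fv \<phi>. vars_tm (?\<theta> i)) \<subseteq> {..<n}"
    using assms by (intro UN_least) (auto simp: formulas_def)
  then have "fv (subst ?\<theta> \<phi>) \<subseteq> {..<n}"
    by (intro order_trans[OF fv_subst]) auto
  ultimately show ?thesis by (simp add: formulas_def inst_def)
qed

lemma map_tm_subst_tm:
  "map_tm (\<lambda>f. f) h (subst_tm \<theta> t) = subst_tm (map_tm (\<lambda>f. f) h \<circ> \<theta>) (map_tm (\<lambda>f. f) h t)"
  by (induction t) auto

lemma map_params_subst:
  "map_params h (subst \<theta> \<phi>) = subst (map_tm (\<lambda>f. f) h \<circ> \<theta>) (map_params h \<phi>)"
proof (induction \<phi> arbitrary: \<theta>)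
  case (Forall k \<phi>)
  have "map_tm (\<lambda>f. f) h \<circ> \<theta>(k := Var k) = (map_tm (\<lambda>f. f) h \<circ> \<theta>)(k := Var k)" by (auto simp: fun_eq_iff)
  then show ?case by (simp add: Forall.IH del: fun_upd_apply o_apply)
qed (auto simp: map_tm_subst_tm)

lemma map_params_inst:
  fixes \<phi> :: "('f, 'r, 'c) fm"
  shows "map_params h (inst n cs \<phi>) = inst n (map h cs) (map_params h \<phi>)"
proof -
  have "map_tm (\<lambda>f::'f. f) h \<circ> (\<lambda>i. if n \<le> i \<and> i < n + length cs then Par (cs ! (i - n)) else Var i)
     = (\<lambda>i. if n \<le> i \<and> i < n + length (map h cs) then Par (map h cs ! (i - n)) else Var i)"
    by (auto simp: fun_eq_iff)
  then show ?thesis unfolding inst_def map_params_subst by (simp only:)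
qed

section \<open>Shelah's 2-rank\<close>

text \<open>\<open>rank_ge F B k X\<close> says that there is a full binary tree of height \<open>k\<close>, with nodes labelled by elements of \<open>B\<close>,
  such that \<open>X\<close> meets the intersection along every branch of the sets \<open>F b\<close> and their complements. For
  the family of the \<open>\<phi>(x, b)\<close> this is the condition \<open>R(X, \<phi>, 2) \<ge> k\<close>.\<close>

fun rank_ge :: "('b \<Rightarrow> 'x set) \<Rightarrow> 'b set \<Rightarrow> nat \<Rightarrow> 'x set \<Rightarrow> bool" where
  "rank_ge F B 0 X \<longleftrightarrow> X \<noteq> {}"
| "rank_ge F B (Suc k) X \<longleftrightarrow> (\<exists>b\<in>B. rank_ge F B k (X \<inter> F b) \<and> rank_ge F B k (X - F b))"

lemma rank_ge_mono: "rank_ge F B k X \<Longrightarrow> X \<subseteq> Y \<Longrightarrow> rank_ge F B k Y"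
proof (induction k arbitrary: X Y)
  case (Suc k)
  then obtain b where b: "b \<in> B" "rank_ge F B k (X \<inter> F b)" "rank_ge F B k (X - F b)" by auto
  have "rank_ge F B k (Y \<inter> F b)" "rank_ge F B k (Y - F b)"
    using b Suc.prems(2) by (auto intro: Suc.IH[OF b(2)] Suc.IH[OF b(3)])
  then show ?case using b(1) by auto
qed auto

lemma rank_ge_Suc_le: "rank_ge F B (Suc k) X \<Longrightarrow> rank_ge F B k X"
  by (auto intro: rank_ge_mono)

lemma rank_ge_le: "rank_ge F B k X \<Longrightarrow> l \<le> k \<Longrightarrow> rank_ge F B l X"
  by (induction k) (auto simp: le_Suc_eq dest: rank_ge_Suc_le simp del: rank_ge.simps(2))

lemma rank_ge_reindex:
  assumes "\<And>b. b \<in> B \<Longrightarrow> g b \<in> B' \<and> F b = F' (g b)"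
  shows "rank_ge F B k X \<Longrightarrow> rank_ge F' B' k X"
proof (induction k arbitrary: X)
  case (Suc k)
  then obtain b where "b \<in> B" "rank_ge F B k (X \<inter> F b)" "rank_ge F B k (X - F b)" by auto
  then have "g b \<in> B'" "rank_ge F' B' k (X \<inter> F' (g b))" "rank_ge F' B' k (X - F' (g b))"
    using Suc.IH assms by auto
  then show ?case by auto
qed auto

text \<open>In the application \<open>f\<close> and \<open>t\<close> are the actions of an automorphism on \<open>x\<close>-tuples and on \<open>y\<close>-tuples.\<close>

lemma rank_ge_image:
  assumes "\<And>b. b \<in> B \<Longrightarrow> t b \<in> B \<and> (\<forall>x\<in>Y. x \<in> F b \<longleftrightarrow> f x \<in> F (t b))"
  shows "rank_ge F B k X \<Longrightarrow> X \<subseteq> Y \<Longrightarrow> rank_ge F B k (f ` X)"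
proof (induction k arbitrary: X)
  case (Suc k)
  then obtain b where b: "b \<in> B" "rank_ge F B k (X \<inter> F b)" "rank_ge F B k (X - F b)" by auto
  have "rank_ge F B k (f ` X \<inter> F (t b))"
    using assms[OF b(1)] Suc.prems(2) by (intro rank_ge_mono[OF Suc.IH[OF b(2)]]) auto
  moreover have "rank_ge F B k (f ` X - F (t b))"
    using assms[OF b(1)] Suc.prems(2) by (intro rank_ge_mono[OF Suc.IH[OF b(3)]]) auto
  ultimately show ?case using assms[OF b(1)] by auto
qed auto

text \<open>A tree of height \<open>k + l\<close> whose leaves are coloured with two colours contains a tree of height \<open>k\<close> in the first colour or
  one of height \<open>l\<close> in the second: if neither side of the root has a tree of height \<open>l\<close> in the second
  colour, both have one of height \<open>k - 1\<close> in the first.\<close>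

lemma rank_ge_Un: "rank_ge F B (k + l) (X \<union> Y) \<Longrightarrow> rank_ge F B k X \<or> rank_ge F B l Y"
proof (induction "k + l" arbitrary: k l X Y)
  case 0
  then show ?case by auto
next
  case (Suc j)
  show ?case
  proof (rule ccontr)
    assume neg: "\<not> ?thesis"
    obtain b where b: "b \<in> B" "rank_ge F B j ((X \<inter> F b) \<union> (Y \<inter> F b))" "rank_ge F B j ((X - F b) \<union> (Y - F b))"
      using Suc.prems unfolding Suc.hyps(2)[symmetric] by (auto simp: Int_Un_distrib2 Un_Diff)
    show False
    proof (cases k)
      case 0
      then have "X = {}" using neg by auto
      then show False using Suc.prems neg 0 by simp
    next
      case (Suc k')
      have j: "j = k' + l" using Suc Suc.hyps(2) by simp
      have Y: "\<not> rank_ge F B l (Y \<inter> F b)" "\<not> rank_ge F B l (Y - F b)"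
        using neg rank_ge_mono[of F B l _ Y] by blast+
      have "rank_ge F B k' (X \<inter> F b)" "rank_ge F B k' (X - F b)"
        using Suc.hyps(1)[OF j] b(2,3) Y unfolding j by blast+
      then show False using neg Suc b(1) by auto
    qed
  qed
qed

lemma rank_ge_finite_UN:
  assumes "finite I" "\<And>i. i \<in> I \<Longrightarrow> \<not> rank_ge F B k (X i)"
  shows "\<exists>l. \<not> rank_ge F B l (\<Union>i\<in>I. X i)"
  using assms
proof (induction I)
  case empty
  then show ?case by (auto intro: exI[of _ 0])
next
  case (insert i I)
  then obtain l where "\<not> rank_ge F B l (\<Union>i\<in>I. X i)" by auto
  then have "\<not> rank_ge F B (k + l) (X i \<union> (\<Union>i\<in>I. X i))" using insert.prems[of i] rank_ge_Un[of F B k l] by blast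
  then show ?case by auto
qed

lemma rank_ge_finite: "rank_ge F B k X \<Longrightarrow> finite X \<Longrightarrow> k < card X"
proof (induction k arbitrary: X)
  case (Suc k)
  then obtain b where "k < card (X \<inter> F b)" "k < card (X - F b)" by auto
  moreover have "card X = card (X \<inter> F b) + card (X - F b)"
    using Suc.prems(2) by (rule card_Int_Diff)
  ultimately show ?case by simp
qed (auto simp: card_gt_0_iff)

text \<open>A linear order of length \<open>2 ^ k\<close> carries a binary tree of height \<open>k\<close>: cut it in the middle.\<close>

lemma rank_ge_order:
  fixes lo N :: nat
  assumes "\<And>i j. i < N \<Longrightarrow> j < N \<Longrightarrow> c j \<in> B \<and> (a i \<in> F (c j) \<longleftrightarrow> j \<le> i)"
  shows "lo + 2 ^ k \<le> N \<Longrightarrow> a ` {lo..<lo + 2 ^ k} \<subseteq> X \<Longrightarrow> rank_ge F B k X"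
proof (induction k arbitrary: lo X)
  case 0
  have "a lo \<in> a ` {lo..<lo + 2 ^ 0}" by (rule imageI) simp
  with "0.prems"(2) have "a lo \<in> X" by (rule subsetD)
  then show ?case by auto
next
  case (Suc k)
  define mid where "mid = lo + 2 ^ k"
  have "0 < (2 :: nat) ^ k" by simp
  then have le: "mid + 2 ^ k \<le> N" "mid < N" using Suc.prems(1) unfolding mid_def power_Suc by linarith+
  have "rank_ge F B k (X \<inter> F (c mid))"
    by (rule Suc.IH[OF le(1)]) (use le Suc.prems(2) assms in \<open>auto simp: mid_def\<close>)
  moreover have "rank_ge F B k (X - F (c mid))"
    by (rule Suc.IH[of lo]) (use le Suc.prems(2) assms in \<open>auto simp: mid_def\<close>)
  ultimately show ?case using le(2) assms by auto
qed

text \<open>Walk down the tree, entering \<open>F b\<close> when the colour of \<open>b\<close> is new and leaving \<open>F b\<close> when it was met before. There are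
  more levels than colours, so the second case occurs, and the set reached then separates two elements
  of the same colour. In the induction, \<open>S\<close> is the set of colours met so far.\<close>

lemma rank_ge_same_colour:
  assumes "finite K" "col ` B \<subseteq> K" "rank_ge F B (r + Suc (card K)) X"
  obtains b b' where "b \<in> B" "b' \<in> B" "col b = col b'" "rank_ge F B r (X \<inter> F b - F b')"
proof -
  have "\<exists>b\<in>B. \<exists>b'\<in>B. col b = col b' \<and> rank_ge F B r (X \<inter> F b - F b')"
    if "rank_ge F B (r + m) X" "card (K - S) < m" "\<And>s. s \<in> S \<Longrightarrow> \<exists>b\<in>B. col b = s \<and> X \<subseteq> F b" for m X S
    using that
  proof (induction m arbitrary: X S)
    case (Suc m)
    then obtain b where b: "b \<in> B" "rank_ge F B (r + m) (X \<inter> F b)" "rank_ge F B (r + m) (X - F b)" by auto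
    show ?case
    proof (cases "col b \<in> S")
      case True
      then obtain b0 where b0: "b0 \<in> B" "col b0 = col b" "X \<subseteq> F b0" using Suc.prems(3) by metis
      have "rank_ge F B r (X \<inter> F b0 - F b)"
        using rank_ge_le[OF b(3), of r] b0(3) by (auto elim: rank_ge_mono)
      then show ?thesis using b0 b(1) by blast
    next
      case False
      have "card (K - insert (col b) S) < card (K - S)"
        using False b(1) assms(1,2) by (intro psubset_card_mono) auto
      moreover have "\<exists>b'\<in>B. col b' = s \<and> X \<inter> F b \<subseteq> F b'" if "s \<in> insert (col b) S" for s
        using that b(1) Suc.prems(3)[of s] by auto
      ultimately have "\<exists>b1\<in>B. \<exists>b'\<in>B. col b1 = col b' \<and> rank_ge F B r (X \<inter> F b \<inter> F b1 - F b')"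
        using Suc.prems(2) by (intro Suc.IH[OF b(2), of "insert (col b) S"]) auto
      then show ?thesis by (auto elim!: rank_ge_mono intro!: bexI)
    qed
  qed simp
  from this[OF assms(3), of "{}"] show thesis using that by auto
qed

section \<open>Definable sets of tuples\<close>

text \<open>Tuples are lists, so that \<open>(!) xs\<close> is a valuation; its values beyond the length are arbitrary and never
  matter for formulas whose free variables are among the first \<open>n\<close>.\<close>

definition tuples :: "('a, 'f, 'r) struct \<Rightarrow> nat \<Rightarrow> 'a list set" where
  "tuples M n = {xs. length xs = n \<and> set xs \<subseteq> univ M}"

definition dset :: "('a, 'f, 'r) struct \<Rightarrow> nat \<Rightarrow> ('f, 'r, 'a) fm \<Rightarrow> 'a list set" where
  "dset M n \<phi> = {xs \<in> tuples M n. sat M ((!) xs) \<phi>}"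

definition fibre :: "('a, 'f, 'r) struct \<Rightarrow> nat \<Rightarrow> ('f, 'r, 'a) fm \<Rightarrow> 'a list \<Rightarrow> 'a list set" where
  "fibre M n \<phi> c = {xs \<in> tuples M n. sat M ((!) (xs @ c)) \<phi>}"

definition fm_rank_ge ::
  "('a, 'f, 'r) struct \<Rightarrow> nat \<Rightarrow> nat \<Rightarrow> ('f, 'r, 'a) fm \<Rightarrow> nat \<Rightarrow> 'a list set \<Rightarrow> bool" where
  "fm_rank_ge M n m \<phi> = rank_ge (fibre M n \<phi>) (tuples M m)"

abbreviation And :: "('f, 'r, 'c) fm \<Rightarrow> ('f, 'r, 'c) fm \<Rightarrow> ('f, 'r, 'c) fm" where
  "And \<phi> \<psi> \<equiv> Neg (Imp \<phi> (Neg \<psi>))"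

lemma Imp_formulas [simp]:
  "Fls \<in> formulas L B n"
  "Imp \<phi> \<psi> \<in> formulas L B n \<longleftrightarrow> \<phi> \<in> formulas L B n \<and> \<psi> \<in> formulas L B n"
  by (auto simp: formulas_def)

lemma dset_And: "dset M n (And \<phi> \<psi>) = dset M n \<phi> \<inter> dset M n \<psi>"
  by (auto simp: dset_def)

lemma dset_Neg: "dset M n (Neg \<phi>) = tuples M n - dset M n \<phi>"
  by (auto simp: dset_def)

lemma dset_tup: "dset M n \<phi> \<subseteq> tuples M n"
  by (auto simp: dset_def)

lemma dset_inst: "\<phi> \<in> formulas L B (n + m) \<Longrightarrow> length c = m \<Longrightarrow> dset M n (inst n c \<phi>) = fibre M n \<phi> c"
  by (auto simp: dset_def fibre_def tuples_def sat_inst)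

fun exs :: "nat list \<Rightarrow> ('f, 'r, 'c) fm \<Rightarrow> ('f, 'r, 'c) fm" where
  "exs [] \<phi> = \<phi>"
| "exs (k # ks) \<phi> = Neg (Forall k (Neg (exs ks \<phi>)))"

lemma sat_exs:
  "sat M s (exs [d..<d + m] \<phi>) \<longleftrightarrow>
     (\<exists>bs\<in>tuples M m. sat M (\<lambda>i. if d \<le> i \<and> i < d + m then bs ! (i - d) else s i) \<phi>)"
proof (induction m arbitrary: d s)
  case 0
  have "tuples M 0 = {[]}" by (auto simp: tuples_def)
  moreover have "(\<lambda>i. if d \<le> i \<and> i < d + 0 then bs ! (i - d) else s i) = s" for bs
    by (auto simp: fun_eq_iff)
  ultimately show ?case by (simp del: add_0_right)
next
  case (Suc m)
  have upt: "[d..<d + Suc m] = d # [Suc d..<Suc d + m]" by (simp add: upt_conv_Cons)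
  have eq: "(\<lambda>i. if Suc d \<le> i \<and> i < Suc d + m then bs ! (i - Suc d) else (s(d := b)) i)
      = (\<lambda>i. if d \<le> i \<and> i < d + Suc m then (b # bs) ! (i - d) else s i)" for b bs
  proof
    fix i
    show "(if Suc d \<le> i \<and> i < Suc d + m then bs ! (i - Suc d) else (s(d := b)) i)
      = (if d \<le> i \<and> i < d + Suc m then (b # bs) ! (i - d) else s i)"
      by (cases "i = d"; cases "d < i") (simp_all add: nth_Cons' Suc_le_eq)
  qed
  have "sat M s (exs [d..<d + Suc m] \<phi>) \<longleftrightarrow> (\<exists>b\<in>univ M. sat M (s(d := b)) (exs [Suc d..<Suc d + m] \<phi>))"
    unfolding upt by simp
  also have "\<dots> \<longleftrightarrow> (\<exists>b\<in>univ M. \<exists>bs\<in>tuples M m.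
      sat M (\<lambda>i. if d \<le> i \<and> i < d + Suc m then (b # bs) ! (i - d) else s i) \<phi>)"
    unfolding Suc.IH eq ..
  also have "\<dots> \<longleftrightarrow> (\<exists>bs\<in>tuples M (Suc m).
      sat M (\<lambda>i. if d \<le> i \<and> i < d + Suc m then bs ! (i - d) else s i) \<phi>)" (is "?l = ?r")
  proof
    assume ?l
    then obtain b bs where "b \<in> univ M" "bs \<in> tuples M m"
      "sat M (\<lambda>i. if d \<le> i \<and> i < d + Suc m then (b # bs) ! (i - d) else s i) \<phi>" by blast
    then show ?r by (intro bexI[of _ "b # bs"]) (auto simp: tuples_def)
  next
    assume ?r
    then obtain cs where cs: "cs \<in> tuples M (Suc m)"
      "sat M (\<lambda>i. if d \<le> i \<and> i < d + Suc m then cs ! (i - d) else s i) \<phi>" by blast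
    then obtain b bs where "cs = b # bs" by (cases cs) (auto simp: tuples_def)
    with cs show ?l by (intro bexI[of _ b] bexI[of _ bs]) (auto simp: tuples_def)
  qed
  finally show ?case .
qed

lemma exs_simps [simp]:
  "fv (exs ks \<phi>) = fv \<phi> - set ks" "params (exs ks \<phi>) = params \<phi>" "wf_fm L (exs ks \<phi>) = wf_fm L \<phi>"
  "map_params h (exs ks \<phi>) = exs ks (map_params h \<phi>)"
  by (induction ks) auto

text \<open>In \<open>\<phi>(x, y)\<close> the variables \<open>y\<close>, which start at \<open>n\<close>, are moved to start at \<open>d\<close>.\<close>

definition shift_params :: "nat \<Rightarrow> nat \<Rightarrow> ('f, 'r, 'c) fm \<Rightarrow> ('f, 'r, 'c) fm" where
  "shift_params n d = ren (\<lambda>i. if i < n then i else i + (d - n)) (\<lambda>_. None)"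

text \<open>The first-order formula for \<open>rank_ge\<close>. The free variables of \<open>\<chi>\<close> are below \<open>d\<close>; the parameter labelling the root
  is quantified in the fresh variables \<open>d, \<dots>, d + m - 1\<close>, and \<open>x\<close> at the leaves.\<close>

fun rank_fm :: "nat \<Rightarrow> nat \<Rightarrow> ('f, 'r, 'c) fm \<Rightarrow> nat \<Rightarrow> nat \<Rightarrow> ('f, 'r, 'c) fm \<Rightarrow> ('f, 'r, 'c) fm" where
  "rank_fm n m \<phi> 0 d \<chi> = exs [0..<n] \<chi>"
| "rank_fm n m \<phi> (Suc k) d \<chi> = exs [d..<d + m]
     (And (rank_fm n m \<phi> k (d + m) (And \<chi> (shift_params n d \<phi>)))
          (rank_fm n m \<phi> k (d + m) (And \<chi> (Neg (shift_params n d \<phi>)))))"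

lemma inj_shift: "inj (\<lambda>i. if i < n then i else i + (d - n) :: nat)"
  by (intro injI) (simp split: if_splits)

lemma shift_params_formulas:
  assumes "\<phi> \<in> formulas L B (n + m)" "n \<le> d"
  shows "shift_params n d \<phi> \<in> formulas L B (d + m)"
proof -
  have "(\<lambda>i. if i < n then i else i + (d - n)) ` {..<n + m} \<subseteq> {..<d + m}" using assms(2) by auto
  then have "(\<lambda>i. if i < n then i else i + (d - n)) ` fv \<phi> \<subseteq> {..<d + m}"
    using assms unfolding formulas_def by blast
  with fv_rename[OF inj_shift] have "fv (shift_params n d \<phi>) \<subseteq> {..<d + m}"
    unfolding shift_params_def by (rule order_trans)
  moreover have "params (shift_params n d \<phi>) \<subseteq> B"
    unfolding shift_params_def by (rule order_trans[OF params_rename]) (use assms in \<open>simp add: formulas_def\<close>)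
  moreover have "wf_fm L (shift_params n d \<phi>)"
    unfolding shift_params_def using assms by (simp add: formulas_def)
  ultimately show ?thesis by (simp add: formulas_def)
qed

lemma sat_rank_fm:
  assumes "\<phi> \<in> formulas L B (n + m)"
  shows "\<chi> \<in> formulas L B d \<Longrightarrow> n \<le> d \<Longrightarrow> sat M s (rank_fm n m \<phi> k d \<chi>) \<longleftrightarrow>
     fm_rank_ge M n m \<phi> k {xs \<in> tuples M n. sat M (\<lambda>i. if i < n then xs ! i else s i) \<chi>}"
proof (induction k arbitrary: d \<chi> s)
  case 0
  have "sat M s (exs [0..<n] \<chi>) \<longleftrightarrow> (\<exists>bs\<in>tuples M n. sat M (\<lambda>i. if i < n then bs ! i else s i) \<chi>)"
    using sat_exs[of M s 0 n \<chi>] by (simp cong: if_cong)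
  then show ?case unfolding fm_rank_ge_def rank_ge.simps rank_fm.simps by blast
next
  case (Suc k)
  let ?X = "{xs \<in> tuples M n. sat M (\<lambda>i. if i < n then xs ! i else s i) \<chi>}"
  let ?\<phi> = "shift_params n d \<phi>"
  have "?\<phi> \<in> formulas L B (d + m)" "\<chi> \<in> formulas L B (d + m)"
    using Suc.prems shift_params_formulas[OF assms Suc.prems(2)] formulas_mono[of B B d "d + m"] by auto
  then have And: "And \<chi> ?\<phi> \<in> formulas L B (d + m)" "And \<chi> (Neg ?\<phi>) \<in> formulas L B (d + m)"
    by (simp_all del: sat.simps)
  have "sat M (\<lambda>i. if i < n then xs ! i else if d \<le> i \<and> i < d + m then bs ! (i - d) else s i) \<chi>
      \<longleftrightarrow> sat M (\<lambda>i. if i < n then xs ! i else s i) \<chi>" for xs bs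
    by (rule sat_formulas_cong[OF Suc.prems(1)]) auto
  moreover have "sat M (\<lambda>i. if i < n then xs ! i else if d \<le> i \<and> i < d + m then bs ! (i - d) else s i) ?\<phi>
      \<longleftrightarrow> sat M ((!) (xs @ bs)) \<phi>" if "xs \<in> tuples M n" "bs \<in> tuples M m" for xs bs
    unfolding shift_params_def sat_rename[OF inj_shift]
    by (rule sat_formulas_cong[OF assms]) (use that Suc.prems(2) in \<open>auto simp: tuples_def nth_append\<close>)
  ultimately have "{xs \<in> tuples M n. sat M (\<lambda>i. if i < n then xs ! i else
        if d \<le> i \<and> i < d + m then bs ! (i - d) else s i) (And \<chi> ?\<phi>)} = ?X \<inter> fibre M n \<phi> bs"
    "{xs \<in> tuples M n. sat M (\<lambda>i. if i < n then xs ! i else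
        if d \<le> i \<and> i < d + m then bs ! (i - d) else s i) (And \<chi> (Neg ?\<phi>))} = ?X - fibre M n \<phi> bs"
    if "bs \<in> tuples M m" for bs
    using that by (auto simp: fibre_def)
  then show ?case
    using Suc.IH[OF And(1)] Suc.IH[OF And(2)] Suc.prems(2)
    by (simp add: sat_exs fm_rank_ge_def cong: bex_cong del: sat.simps(4)) simp
qed

lemma dset_override:
  assumes "\<chi> \<in> formulas L B n"
  shows "{xs \<in> tuples M n. sat M (\<lambda>i. if i < n then xs ! i else s i) \<chi>} = dset M n \<chi>"
proof -
  have "sat M (\<lambda>i. if i < n then xs ! i else s i) \<chi> = sat M ((!) xs) \<chi>" for xs
    by (rule sat_formulas_cong[OF assms]) simp
  then show ?thesis by (simp add: dset_def)
qed

lemma rank_fm_formulas: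
  assumes "\<phi> \<in> formulas L B (n + m)"
  shows "\<chi> \<in> formulas L B d \<Longrightarrow> n \<le> d \<Longrightarrow>
     rank_fm n m \<phi> k d \<chi> \<in> formulas L B d \<and> fv (rank_fm n m \<phi> k d \<chi>) \<subseteq> {n..<d}"
proof (induction k arbitrary: d \<chi>)
  case 0
  then show ?case by (auto simp: formulas_def)
next
  case (Suc k)
  let ?\<phi> = "shift_params n d \<phi>"
  have "?\<phi> \<in> formulas L B (d + m)" "\<chi> \<in> formulas L B (d + m)"
    using Suc.prems shift_params_formulas[OF assms Suc.prems(2)] formulas_mono[of B B d "d + m"] by auto
  then have And: "And \<chi> ?\<phi> \<in> formulas L B (d + m)" "And \<chi> (Neg ?\<phi>) \<in> formulas L B (d + m)"
    by simp_all
  from Suc.IH[OF And(1)] Suc.IH[OF And(2)] Suc.prems(2) show ?case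
    by (fastforce simp: formulas_def)
qed

lemma map_params_rank_fm:
  "map_params h (rank_fm n m \<phi> k d \<chi>) = rank_fm n m (map_params h \<phi>) k d (map_params h \<chi>)"
  by (induction k arbitrary: d \<chi>) (simp_all add: shift_params_def map_params_rename)

lemma models_sentence:
  assumes "is_struct L M" "\<sigma> \<in> sentences L B"
  shows "models M \<sigma> \<longleftrightarrow> sat M s \<sigma>"
proof -
  have eq: "sat M s' \<sigma> = sat M s \<sigma>" for s' by (rule sat_formulas_cong[OF assms(2)]) simp
  obtain a where "a \<in> univ M" using assms(1) by (auto simp: is_struct_def)
  then have "(\<lambda>_. a) \<in> valuations M" by (auto simp: valuations_def)
  then show ?thesis unfolding models_def using eq by blast
qed

lemma models_inst:
  assumes "is_struct L M" "\<psi> \<in> formulas L B m" "length cs = m"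
  shows "models M (inst 0 cs \<psi>) \<longleftrightarrow> sat M ((!) cs) \<psi>"
proof -
  have "inst 0 cs \<psi> \<in> formulas L (B \<union> set cs) 0"
    by (rule inst_formulas) (use assms in auto)
  from models_sentence[OF assms(1) this, of "(!) []"] show ?thesis
    using sat_inst[of \<psi> L B 0 cs "[]" M] assms by simp
qed

lemma complete_typeD:
  assumes "q \<in> complete_types L M n C"
  shows "C \<subseteq> univ M" "q \<subseteq> formulas L C n" "\<phi> \<in> formulas L C n \<Longrightarrow> \<phi> \<in> q \<or> Neg \<phi> \<in> q"
  using assms by (auto simp: complete_types_def partial_type_def)

lemma partial_type_finite_sat:
  assumes "partial_type L M n C \<pi>" "finite \<Phi>" "\<Phi> \<subseteq> \<pi>"
  obtains xs where "xs \<in> tuples M n" "\<And>\<phi>. \<phi> \<in> \<Phi> \<Longrightarrow> xs \<in> dset M n \<phi>"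
proof -
  obtain s where s: "s \<in> valuations M" "\<forall>\<phi>\<in>\<Phi>. sat M s \<phi>"
    using assms unfolding partial_type_def by blast
  have "sat M ((!) (map s [0..<n])) \<phi>" if "\<phi> \<in> \<Phi>" for \<phi>
  proof -
    have "\<phi> \<in> formulas L C n" using assms that by (auto simp: partial_type_def)
    then have "sat M s \<phi> = sat M ((!) (map s [0..<n])) \<phi>" by (rule sat_formulas_cong) auto
    then show ?thesis using s that by simp
  qed
  then show thesis using s(1) by (intro that[of "map s [0..<n]"]) (auto simp: dset_def tuples_def valuations_def)
qed

lemma complete_type_finite_sat:
  assumes "q \<in> complete_types L M n C" "finite \<Phi>" "\<Phi> \<subseteq> q"
  obtains xs where "xs \<in> tuples M n" "\<And>\<phi>. \<phi> \<in> \<Phi> \<Longrightarrow> xs \<in> dset M n \<phi>"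
  using partial_type_finite_sat[of L M n C q \<Phi>] assms by (auto simp: complete_types_def)

text \<open>Otherwise the type would contain the negation of \<open>\<phi>\<close> along with \<open>\<Phi>\<close>, and these have no common solution.\<close>

lemma complete_type_closed:
  assumes "q \<in> complete_types L M n C" "finite \<Phi>" "\<Phi> \<subseteq> q" "\<phi> \<in> formulas L C n"
    and "tuples M n \<inter> (\<Inter>\<psi>\<in>\<Phi>. dset M n \<psi>) \<subseteq> dset M n \<phi>"
  shows "\<phi> \<in> q"
proof (rule ccontr)
  assume "\<phi> \<notin> q"
  then have "Neg \<phi> \<in> q" using complete_typeD(3)[OF assms(1,4)] by simp
  with assms obtain xs where "xs \<in> tuples M n" "\<And>\<psi>. \<psi> \<in> insert (Neg \<phi>) \<Phi> \<Longrightarrow> xs \<in> dset M n \<psi>"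
    using complete_type_finite_sat[of q L M n C "insert (Neg \<phi>) \<Phi>"] by auto
  then have "xs \<in> tuples M n" "xs \<notin> dset M n \<phi>" "\<forall>\<psi>\<in>\<Phi>. xs \<in> dset M n \<psi>" by (fastforce simp: dset_def)+
  with assms(5) show False by auto
qed

lemma complete_type_Neg:
  assumes "q \<in> complete_types L M n C" "\<phi> \<in> formulas L C n"
  shows "Neg \<phi> \<in> q \<longleftrightarrow> \<phi> \<notin> q"
proof
  assume "Neg \<phi> \<in> q"
  show "\<phi> \<notin> q"
  proof
    assume "\<phi> \<in> q"
    with \<open>Neg \<phi> \<in> q\<close> obtain xs where "\<And>\<psi>. \<psi> \<in> {\<phi>, Neg \<phi>} \<Longrightarrow> xs \<in> dset M n \<psi>"
      using complete_type_finite_sat[OF assms(1), of "{\<phi>, Neg \<phi>}"] by auto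
    from this[of \<phi>] this[of "Neg \<phi>"] show False by (simp add: dset_def)
  qed
qed (use complete_typeD(3)[OF assms] in blast)

lemma complete_type_And:
  assumes "q \<in> complete_types L M n C" "\<phi> \<in> q" "\<psi> \<in> q"
  shows "And \<phi> \<psi> \<in> q"
proof (rule complete_type_closed[OF assms(1), of "{\<phi>, \<psi>}"])
  show "And \<phi> \<psi> \<in> formulas L C n"
    using assms complete_typeD(2)[OF assms(1)] by auto
qed (use assms in \<open>auto simp: dset_And\<close>)

section \<open>Finite rank implies definability\<close>

text \<open>Let \<open>\<theta> \<in> q\<close> have the least rank \<open>r\<close> among the formulas of \<open>q\<close>. If \<open>\<phi>(x, c) \<in> q\<close>, then \<open>\<theta> \<and> \<phi>(x, c)\<close> is in
  \<open>q\<close> and has rank at least \<open>r\<close>. If not, then \<open>\<theta> \<and> \<not> \<phi>(x, c)\<close> has, and \<open>\<theta> \<and> \<phi>(x, c)\<close> cannot have rank \<open>r\<close>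
  too, or \<open>\<theta>\<close> would have rank \<open>r + 1\<close>. So \<open>q\<close> is defined by the formula expressing the rank of \<open>\<theta> \<and> \<phi>(x, y)\<close>.\<close>

lemma definable_type_if_finite_rank:
  fixes N :: "('a, 'f, 'r) struct"
  assumes struct: "is_struct L N" and q: "q \<in> complete_types L N n C"
    and fin: "\<And>m \<phi>. \<phi> \<in> formulas L {} (n + m) \<Longrightarrow> \<exists>\<theta>\<in>q. \<exists>k. \<not> fm_rank_ge N n m \<phi> k (dset N n \<theta>)"
  shows "definable_type L N n C q"
  unfolding definable_type_def
proof (intro allI ballI)
  fix m :: nat and \<phi> :: "('f, 'r, 'a) fm" assume \<phi>: "\<phi> \<in> formulas L {} (n + m)"
  \<comment> \<open>\<open>k\<close> is the first rank that some formula of \<open>q\<close> fails to have, so \<open>r = k - 1\<close> below.\<close>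
  define k where "k = (LEAST k. \<exists>\<theta>\<in>q. \<not> fm_rank_ge N n m \<phi> k (dset N n \<theta>))"
  have "\<exists>k. \<exists>\<theta>\<in>q. \<not> fm_rank_ge N n m \<phi> k (dset N n \<theta>)" using fin[OF \<phi>] by blast
  then have "\<exists>\<theta>\<in>q. \<not> fm_rank_ge N n m \<phi> k (dset N n \<theta>)" unfolding k_def by (rule LeastI_ex)
  then obtain \<theta> where \<theta>: "\<theta> \<in> q" "\<not> fm_rank_ge N n m \<phi> k (dset N n \<theta>)" by blast
  have "k \<noteq> 0"
  proof
    assume "k = 0"
    then have "dset N n \<theta> = {}" using \<theta>(2) by (simp add: fm_rank_ge_def)
    then show False using complete_type_finite_sat[OF q, of "{\<theta>}"] \<theta>(1) by auto
  qed
  then obtain r where r: "k = Suc r" by (cases k) auto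
  have large: "fm_rank_ge N n m \<phi> r (dset N n \<chi>)" if "\<chi> \<in> q" for \<chi>
    using not_less_Least[of r "\<lambda>k. \<exists>\<theta>\<in>q. \<not> fm_rank_ge N n m \<phi> k (dset N n \<theta>)"] that r
    unfolding k_def[symmetric] by auto
  have \<theta>C: "\<theta> \<in> formulas L C n" using \<theta>(1) complete_typeD(2)[OF q] by blast
  have \<phi>C: "\<phi> \<in> formulas L C (n + m)" using \<phi> formulas_mono[of "{}" C] by blast
  have And: "And \<theta> \<phi> \<in> formulas L C (n + m)"
    using \<theta>C \<phi>C formulas_mono[of C C n "n + m"] by auto
  define \<rho> where "\<rho> = rank_fm n m \<phi> r (n + m) (And \<theta> \<phi>)"
  \<comment> \<open>\<open>\<rho>\<close> has its free variables from \<open>n\<close> on; a definition has them from \<open>0\<close> on.\<close>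
  define \<psi> where "\<psi> = ren (block_swap n m) (\<lambda>_. None) \<rho>"
  have \<rho>: "\<rho> \<in> formulas L C (n + m)" "fv \<rho> \<subseteq> {n..<n + m}"
    using rank_fm_formulas[OF \<phi>C And] by (auto simp: \<rho>_def)
  have "block_swap n m ` {n..<n + m} \<subseteq> {..<m}" by (auto simp: block_swap_def)
  then have "block_swap n m ` fv \<rho> \<subseteq> {..<m}" using \<rho>(2) by blast
  with fv_rename[OF inj_block_swap] have "fv \<psi> \<subseteq> {..<m}" unfolding \<psi>_def by (rule order_trans)
  moreover have "params \<psi> \<subseteq> C"
    unfolding \<psi>_def by (rule order_trans[OF params_rename]) (use \<rho> in \<open>simp add: formulas_def\<close>)
  ultimately have \<psi>: "\<psi> \<in> formulas L C m" using \<rho>(1) by (simp add: formulas_def \<psi>_def)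
  have "inst n cs \<phi> \<in> q \<longleftrightarrow> models N (inst 0 cs \<psi>)" if cs: "length cs = m" "set cs \<subseteq> C" for cs
  proof -
    have inst: "inst n cs \<phi> \<in> formulas L C n" using inst_formulas[OF _ _ cs(2), of \<phi> L "{}" n] \<phi> cs by simp
    have d: "dset N n (inst n cs \<phi>) = fibre N n \<phi> cs" by (rule dset_inst[OF \<phi> cs(1)])
    have tuples: "cs \<in> tuples N m" using cs complete_typeD(1)[OF q] by (auto simp: tuples_def)
    have "models N (inst 0 cs \<psi>) \<longleftrightarrow> sat N (\<lambda>i. cs ! block_swap n m i) \<rho>"
      unfolding models_inst[OF struct \<psi> cs(1)] unfolding \<psi>_def sat_rename[OF inj_block_swap] ..
    also have "\<dots> \<longleftrightarrow> fm_rank_ge N n m \<phi> r (dset N n \<theta> \<inter> fibre N n \<phi> cs)"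
    proof -
      have s: "sat N (\<lambda>i. if i < n then xs ! i else cs ! block_swap n m i) \<chi> \<longleftrightarrow> sat N ((!) (xs @ cs)) \<chi>"
        if "xs \<in> tuples N n" "\<chi> \<in> formulas L C (n + m)" for xs \<chi>
        by (rule sat_formulas_cong[OF that(2)]) (use that(1) in \<open>auto simp: tuples_def nth_append block_swap_def\<close>)
      have t: "sat N ((!) (xs @ cs)) \<theta> \<longleftrightarrow> sat N ((!) xs) \<theta>" if "xs \<in> tuples N n" for xs
        by (rule sat_formulas_cong[OF \<theta>C]) (use that in \<open>auto simp: tuples_def nth_append\<close>)
      have "{xs \<in> tuples N n. sat N (\<lambda>i. if i < n then xs ! i else cs ! block_swap n m i) (And \<theta> \<phi>)}
          = dset N n \<theta> \<inter> fibre N n \<phi> cs"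
        using s[OF _ And] t by (auto simp: dset_def fibre_def)
      then show ?thesis unfolding \<rho>_def sat_rank_fm[OF \<phi>C And le_add1] by simp
    qed
    also have "\<dots> \<longleftrightarrow> inst n cs \<phi> \<in> q"
    proof
      assume *: "fm_rank_ge N n m \<phi> r (dset N n \<theta> \<inter> fibre N n \<phi> cs)"
      show "inst n cs \<phi> \<in> q"
      proof (rule ccontr)
        assume "inst n cs \<phi> \<notin> q"
        then have "And \<theta> (Neg (inst n cs \<phi>)) \<in> q"
          using complete_type_Neg[OF q inst] complete_type_And[OF q \<theta>(1)] by simp
        then have "fm_rank_ge N n m \<phi> r (dset N n \<theta> \<inter> (tuples N n - fibre N n \<phi> cs))"
          by (metis large d dset_And dset_Neg)
        moreover have "dset N n \<theta> \<inter> (tuples N n - fibre N n \<phi> cs) = dset N n \<theta> - fibre N n \<phi> cs"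
          using dset_tup by blast
        ultimately have "fm_rank_ge N n m \<phi> r (dset N n \<theta> - fibre N n \<phi> cs)" by simp
        then show False using * \<theta>(2) tuples unfolding r fm_rank_ge_def by auto
      qed
    next
      assume "inst n cs \<phi> \<in> q"
      from large[OF complete_type_And[OF q \<theta>(1) this]] show "fm_rank_ge N n m \<phi> r (dset N n \<theta> \<inter> fibre N n \<phi> cs)"
        unfolding dset_And d .
    qed
    finally show ?thesis by simp
  qed
  then show "\<exists>\<psi>\<in>formulas L C m. \<forall>cs. length cs = m \<and> set cs \<subseteq> C \<longrightarrow>
      (inst n cs \<phi> \<in> q) = models N (inst 0 cs \<psi>)" using \<psi> by blast
qed

lemma fm_rank_ge_elementary:
  fixes M :: "('a, 'f, 'r) struct" and N :: "('b, 'f, 'r) struct" and h :: "'a \<Rightarrow> 'b"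
  assumes "is_struct L M" "is_struct L N" "elementary_map L M N (univ M) h"
    and "\<phi> \<in> formulas L {} (n + m)" "\<theta> \<in> formulas L (univ M) n"
  shows "fm_rank_ge N n m (map_params h \<phi>) k (dset N n (map_params h \<theta>)) \<longleftrightarrow> fm_rank_ge M n m \<phi> k (dset M n \<theta>)"
proof -
  have \<phi>M: "\<phi> \<in> formulas L (univ M) (n + m)" using assms(4) formulas_mono[of "{}" "univ M"] by blast
  have \<theta>h: "map_params h \<theta> \<in> formulas L (univ N) n"
    using map_params_formulas[OF assms(5), of h] assms(3) formulas_mono[of "h ` univ M" "univ N"]
    by (auto simp: elementary_map_def)
  have \<phi>N: "map_params h \<phi> \<in> formulas L (univ N) (n + m)"
    using map_params_formulas[OF assms(4), of h] formulas_mono[of "{}" "univ N"] by auto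
  let ?\<rho> = "rank_fm n m \<phi> k n \<theta>"
  have sent: "?\<rho> \<in> sentences L (univ M)"
    using rank_fm_formulas[OF \<phi>M assms(5)] by (auto simp: formulas_def)
  have sent': "map_params h ?\<rho> \<in> sentences L (univ N)"
    using map_params_formulas[OF sent, of h] assms(3) formulas_mono[of "h ` univ M" "univ N"]
    by (auto simp: elementary_map_def)
  have "models N (map_params h ?\<rho>) \<longleftrightarrow> fm_rank_ge N n m (map_params h \<phi>) k (dset N n (map_params h \<theta>))"
    using models_sentence[OF assms(2) sent'] sat_rank_fm[OF \<phi>N \<theta>h order_refl] dset_override[OF \<theta>h]
    by (simp add: map_params_rank_fm)
  moreover have "models M ?\<rho> \<longleftrightarrow> fm_rank_ge M n m \<phi> k (dset M n \<theta>)"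
    using models_sentence[OF assms(1) sent] sat_rank_fm[OF \<phi>M assms(5) order_refl] dset_override[OF assms(5)] by simp
  ultimately show ?thesis using assms(3) sent by (simp add: elementary_map_def)
qed

section \<open>Ultrafilters\<close>

definition ultra :: "'i set set \<Rightarrow> bool" where
  "ultra U \<longleftrightarrow> {} \<notin> U \<and> (\<forall>A B. A \<in> U \<and> B \<in> U \<longrightarrow> A \<inter> B \<in> U) \<and>
     (\<forall>A B. A \<in> U \<and> A \<subseteq> B \<longrightarrow> B \<in> U) \<and> (\<forall>A. A \<in> U \<or> - A \<in> U)"

text \<open>A maximal family with the finite intersection property, by Zorn's lemma.\<close>

lemma ultra_exists:
  assumes "\<And>F. finite F \<Longrightarrow> F \<subseteq> S \<Longrightarrow> \<Inter>F \<noteq> {}"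
  obtains U where "ultra U" "S \<subseteq> U"
proof -
  define fip where "fip U \<longleftrightarrow> (\<forall>F. finite F \<and> F \<subseteq> U \<longrightarrow> \<Inter>F \<noteq> {})" for U :: "'a set set"
  have "\<exists>U\<in>{U. S \<subseteq> U \<and> fip U}. \<forall>V\<in>{U. S \<subseteq> U \<and> fip U}. U \<subseteq> V \<longrightarrow> V = U"
  proof (rule subset_Zorn_nonempty)
    show "{U. S \<subseteq> U \<and> fip U} \<noteq> {}" using assms by (auto simp: fip_def)
  next
    fix \<C> assume \<C>: "\<C> \<noteq> {}" "subset.chain {U. S \<subseteq> U \<and> fip U} \<C>"
    have "\<Inter>F \<noteq> {}" if F: "finite F" "F \<subseteq> \<Union>\<C>" for F
    proof -
      have "\<exists>U\<in>\<C>. F \<subseteq> U"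
        using F
      proof (induction F)
        case empty
        then show ?case using \<C>(1) by auto
      next
        case (insert A F)
        then obtain U V where "U \<in> \<C>" "F \<subseteq> U" "V \<in> \<C>" "A \<in> V" by auto
        moreover from this have "U \<subseteq> V \<or> V \<subseteq> U" using \<C>(2) by (auto simp: subset_chain_def)
        ultimately show ?case by blast
      qed
      then show ?thesis using F(1) \<C>(2) unfolding subset.chain_def fip_def by blast
    qed
    moreover have "S \<subseteq> \<Union>\<C>" using \<C> unfolding subset_chain_def by blast
    ultimately show "\<Union>\<C> \<in> {U. S \<subseteq> U \<and> fip U}" by (auto simp: fip_def)
  qed
  then obtain U where U: "S \<subseteq> U" "fip U" and max: "\<And>V. S \<subseteq> V \<Longrightarrow> fip V \<Longrightarrow> U \<subseteq> V \<Longrightarrow> V = U" by auto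
  have fipD: "\<Inter>F \<noteq> {}" if "finite F" "F \<subseteq> U" for F using U(2) that by (simp add: fip_def)
  have mem: "B \<in> U" if F: "finite F" "F \<subseteq> U" "\<Inter>F \<subseteq> B" for F B
  proof -
    have "\<Inter>G \<noteq> {}" if "finite G" "G \<subseteq> insert B U" for G
    proof -
      have "finite ((G - {B}) \<union> F)" "(G - {B}) \<union> F \<subseteq> U" using that F by auto
      then have "\<Inter>((G - {B}) \<union> F) \<noteq> {}" by (rule fipD)
      moreover have "\<Inter>((G - {B}) \<union> F) \<subseteq> X" if "X \<in> G" for X
        by (cases "X = B") (use F(3) that in auto)
      then have "\<Inter>((G - {B}) \<union> F) \<subseteq> \<Inter>G" by (rule Inter_greatest)
      ultimately show ?thesis by auto
    qed
    then have "fip (insert B U)" by (simp add: fip_def)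
    from max[OF _ this] U(1) show ?thesis by auto
  qed
  have "{} \<notin> U"
  proof
    assume "{} \<in> U"
    then show False using fipD[of "{{}}"] by simp
  qed
  moreover have "A \<inter> B \<in> U" if "A \<in> U" "B \<in> U" for A B using mem[of "{A, B}"] that by auto
  moreover have "B \<in> U" if "A \<in> U" "A \<subseteq> B" for A B using mem[of "{A}"] that by auto
  moreover have "A \<in> U \<or> - A \<in> U" for A
  proof (rule ccontr)
    assume neg: "\<not> ?thesis"
    then have "\<not> fip (insert A U)" using max[of "insert A U"] U(1) by auto
    then obtain G where G: "finite G" "G \<subseteq> insert A U" "\<Inter>G = {}" by (auto simp: fip_def)
    have "- A \<in> U" by (rule mem[of "G - {A}"]) (use G in auto)
    then show False using neg by simp
  qed
  ultimately have "ultra U" unfolding ultra_def by blast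
  then show thesis using U(1) by (rule that)
qed

lemma ultra_Inter: "ultra U \<Longrightarrow> finite F \<Longrightarrow> F \<subseteq> U \<Longrightarrow> \<Inter>F \<noteq> {}"
proof -
  assume U: "ultra U" and F: "finite F" "F \<subseteq> U"
  from F have "\<Inter>F \<in> U"
  proof (induction F)
    case empty
    then show ?case using U unfolding ultra_def by (metis Inf_empty Un_UNIV_right subset_UNIV)
  next
    case (insert A F)
    then show ?case using U unfolding ultra_def by simp
  qed
  then show ?thesis using U unfolding ultra_def by metis
qed

lemma ultra_Compl: "ultra U \<Longrightarrow> - A \<in> U \<longleftrightarrow> A \<notin> U"
  unfolding ultra_def by (metis Compl_disjoint)

lemma ultra_mono: "ultra U \<Longrightarrow> A \<in> U \<Longrightarrow> A \<subseteq> B \<Longrightarrow> B \<in> U"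
  unfolding ultra_def by blast

lemma ultra_Int: "ultra U \<Longrightarrow> A \<in> U \<Longrightarrow> B \<in> U \<Longrightarrow> A \<inter> B \<in> U"
  unfolding ultra_def by blast

section \<open>Saturation and homogeneity\<close>

lemma tuples_extend:
  assumes "is_struct L M" "xs \<in> tuples M n"
  shows "\<exists>s\<in>valuations M. \<forall>i<n. s i = xs ! i"
proof -
  obtain a where "a \<in> univ M" using assms(1) by (auto simp: is_struct_def)
  then show ?thesis using assms(2)
    by (intro bexI[of _ "\<lambda>i. if i < n then xs ! i else a"]) (auto simp: valuations_def tuples_def)
qed

lemma sat_extend:
  assumes "\<phi> \<in> formulas L C n" "\<And>i. i < n \<Longrightarrow> s i = xs ! i" "xs \<in> tuples M n"
  shows "sat M s \<phi> \<longleftrightarrow> xs \<in> dset M n \<phi>"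
  using assms(3) sat_formulas_cong[OF assms(1), of s "(!) xs" M] assms(2) by (simp add: dset_def)

text \<open>The definition of a monster model speaks of complete types. An ultrafilter containing the solution
  sets of \<open>\<Phi>\<close> yields a complete type extending \<open>\<Phi>\<close>.\<close>

lemma saturation:
  assumes M: "monster L \<kappa> M" and B: "B \<subseteq> univ M" "small \<kappa> B" and \<Phi>: "\<Phi> \<subseteq> formulas L B n"
    and fin: "\<And>\<Phi>0. finite \<Phi>0 \<Longrightarrow> \<Phi>0 \<subseteq> \<Phi> \<Longrightarrow> \<exists>xs\<in>tuples M n. \<forall>\<phi>\<in>\<Phi>0. xs \<in> dset M n \<phi>"
  shows "\<exists>xs\<in>tuples M n. \<forall>\<phi>\<in>\<Phi>. xs \<in> dset M n \<phi>"
proof -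
  have struct: "is_struct L M" using M by (simp add: monster_def)
  have "\<Inter>F \<noteq> {}" if F: "finite F" "F \<subseteq> insert (tuples M n) (dset M n ` \<Phi>)" for F
  proof -
    from F have "finite (F - {tuples M n})" "F - {tuples M n} \<subseteq> dset M n ` \<Phi>" by auto
    then obtain \<Phi>0 where \<Phi>0: "finite \<Phi>0" "\<Phi>0 \<subseteq> \<Phi>" "F - {tuples M n} = dset M n ` \<Phi>0"
      by (meson finite_subset_image)
    from fin[OF this(1,2)] obtain xs where "xs \<in> tuples M n" "\<forall>\<phi>\<in>\<Phi>0. xs \<in> dset M n \<phi>" by blast
    then have "\<forall>X\<in>F. xs \<in> X" using \<Phi>0(3) by blast
    then show ?thesis by blast
  qed
  then obtain U where U: "ultra U" "insert (tuples M n) (dset M n ` \<Phi>) \<subseteq> U" by (rule ultra_exists)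
  define q where "q = {\<phi> \<in> formulas L B n. dset M n \<phi> \<in> U}"
  have "partial_type L M n B q"
    unfolding partial_type_def
  proof (intro conjI allI impI)
    fix \<Psi> assume \<Psi>: "finite \<Psi> \<and> \<Psi> \<subseteq> q"
    have "\<Inter>(insert (tuples M n) (dset M n ` \<Psi>)) \<noteq> {}"
      by (rule ultra_Inter[OF U(1)]) (use \<Psi> U(2) in \<open>auto simp: q_def\<close>)
    then obtain xs where xs: "xs \<in> tuples M n" "\<forall>\<psi>\<in>\<Psi>. xs \<in> dset M n \<psi>" by auto
    obtain s where s: "s \<in> valuations M" "\<And>i. i < n \<Longrightarrow> s i = xs ! i"
      using tuples_extend[OF struct xs(1)] by blast
    have "\<forall>\<psi>\<in>\<Psi>. sat M s \<psi>"
      using xs \<Psi> sat_extend[OF _ s(2) xs(1), of _ L B] by (auto simp: q_def)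
    then show "\<exists>s\<in>valuations M. \<forall>\<psi>\<in>\<Psi>. sat M s \<psi>" using s(1) by blast
  qed (use B in \<open>auto simp: q_def\<close>)
  moreover have "\<phi> \<in> q \<or> Neg \<phi> \<in> q" if \<phi>: "\<phi> \<in> formulas L B n" for \<phi>
  proof (cases "dset M n \<phi> \<in> U")
    case False
    then have "- dset M n \<phi> \<in> U" using ultra_Compl[OF U(1)] by blast
    then have "tuples M n \<inter> - dset M n \<phi> \<in> U" using ultra_Int[OF U(1)] U(2) by blast
    then have "dset M n (Neg \<phi>) \<in> U" by (simp add: dset_Neg Diff_eq)
    then show ?thesis using \<phi> by (simp add: q_def)
  qed (use \<phi> in \<open>simp add: q_def\<close>)
  ultimately have "q \<in> complete_types L M n B" by (simp add: complete_types_def)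
  moreover have "\<forall>q\<in>complete_types L M n B. \<exists>s\<in>valuations M. \<forall>\<phi>\<in>q. sat M s \<phi>"
    using M B by (simp add: monster_def)
  ultimately obtain s where s: "s \<in> valuations M" "\<forall>\<phi>\<in>q. sat M s \<phi>" by blast
  let ?xs = "map s [0..<n]"
  have tuples: "?xs \<in> tuples M n" using s(1) by (auto simp: tuples_def valuations_def)
  have "?xs \<in> dset M n \<phi>" if "\<phi> \<in> \<Phi>" for \<phi>
  proof -
    have "\<phi> \<in> formulas L B n" "\<phi> \<in> q" using that \<Phi> U(2) by (auto simp: q_def)
    then show ?thesis using s(2) sat_extend[of \<phi> L B n s ?xs M] tuples by simp
  qed
  then show ?thesis using tuples by blast
qed

definition aut_over :: "('f, 'r) lang \<Rightarrow> ('a, 'f, 'r) struct \<Rightarrow> 'a set \<Rightarrow> ('a \<Rightarrow> 'a) \<Rightarrow> bool" where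
  "aut_over L M A g \<longleftrightarrow> automorphism L M g \<and> (\<forall>a\<in>A. g a = a)"

lemma aut_univ: "automorphism L M g \<Longrightarrow> a \<in> univ M \<Longrightarrow> g a \<in> univ M"
  unfolding automorphism_def bij_betw_def by blast

lemma aut_tup: "automorphism L M g \<Longrightarrow> xs \<in> tuples M n \<Longrightarrow> map g xs \<in> tuples M n"
  by (auto simp: tuples_def dest: aut_univ)

lemma val_univ:
  "is_struct L M \<Longrightarrow> s \<in> valuations M \<Longrightarrow> wf_tm L t \<Longrightarrow> set2_tm t \<subseteq> univ M \<Longrightarrow> val M s t \<in> univ M"
proof (induction t)
  case (Fn f ts)
  then have "set (map (val M s) ts) \<subseteq> univ M" by auto
  then show ?case using Fn.prems unfolding is_struct_def by fastforce
qed (auto simp: valuations_def)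

lemma val_aut:
  assumes "is_struct L M" "automorphism L M g" "s \<in> valuations M"
  shows "wf_tm L t \<Longrightarrow> set2_tm t \<subseteq> univ M \<Longrightarrow> val M (\<lambda>i. g (s i)) (map_tm (\<lambda>f. f) g t) = g (val M s t)"
proof (induction t)
  case (Fn f ts)
  have "set (map (val M s) ts) \<subseteq> univ M" using Fn.prems assms by (auto intro!: val_univ)
  then have g: "g (intf M f (map (val M s) ts)) = intf M f (map g (map (val M s) ts))"
    using Fn.prems assms(2) unfolding automorphism_def by fastforce
  have "map (\<lambda>t. val M (\<lambda>i. g (s i)) (map_tm (\<lambda>f. f) g t)) ts = map (\<lambda>t. g (val M s t)) ts"
    using Fn by auto
  then show ?case using g by (simp add: o_def del: map_eq_conv)
qed auto

lemma sat_aut: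
  assumes "is_struct L M" "automorphism L M g"
  shows "wf_fm L \<phi> \<Longrightarrow> params \<phi> \<subseteq> univ M \<Longrightarrow> s \<in> valuations M \<Longrightarrow>
     sat M (\<lambda>i. g (s i)) (map_params g \<phi>) \<longleftrightarrow> sat M s \<phi>"
proof (induction \<phi> arbitrary: s)
  case (Equ t u)
  have "val M s t \<in> univ M" "val M s u \<in> univ M" using Equ assms by (auto intro: val_univ)
  moreover have "inj_on g (univ M)" using assms(2) by (simp add: automorphism_def bij_betw_def)
  ultimately show ?case using Equ assms by (auto simp: val_aut inj_on_eq_iff)
next
  case (Rel r ts)
  have "set (map (val M s) ts) \<subseteq> univ M" using Rel.prems assms by (auto intro!: val_univ)
  then have g: "intr M r (map (val M s) ts) \<longleftrightarrow> intr M r (map g (map (val M s) ts))"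
    using Rel.prems assms(2) unfolding automorphism_def by fastforce
  have "map (\<lambda>t. val M (\<lambda>i. g (s i)) (map_tm (\<lambda>f. f) g t)) ts = map (\<lambda>t. g (val M s t)) ts"
    using Rel.prems assms by (auto intro!: val_aut)
  then show ?case using g by (simp add: o_def del: map_eq_conv)
next
  case (Forall k \<phi>)
  have IH: "sat M ((\<lambda>i. g (s i))(k := g a)) (map_params g \<phi>) \<longleftrightarrow> sat M (s(k := a)) \<phi>" if "a \<in> univ M" for a
  proof -
    have "s(k := a) \<in> valuations M" using that Forall.prems by (auto simp: valuations_def)
    moreover have "(\<lambda>i. g ((s(k := a)) i)) = (\<lambda>i. g (s i))(k := g a)" by (auto simp: fun_eq_iff)
    ultimately show ?thesis using Forall.IH[of "s(k := a)"] Forall.prems by (simp del: fun_upd_apply)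
  qed
  have "univ M = g ` univ M" using assms(2) by (simp add: automorphism_def bij_betw_def)
  then have "(\<forall>b\<in>univ M. sat M ((\<lambda>i. g (s i))(k := b)) (map_params g \<phi>))
      \<longleftrightarrow> (\<forall>a\<in>univ M. sat M ((\<lambda>i. g (s i))(k := g a)) (map_params g \<phi>))"
    by (metis (no_types, lifting) image_iff)
  then show ?case using IH by simp
qed auto

lemma dset_aut:
  assumes "is_struct L M" "automorphism L M g" "\<phi> \<in> formulas L (univ M) n" "xs \<in> tuples M n"
  shows "map g xs \<in> dset M n (map_params g \<phi>) \<longleftrightarrow> xs \<in> dset M n \<phi>"
proof -
  obtain s where s: "s \<in> valuations M" "\<And>i. i < n \<Longrightarrow> s i = xs ! i"
    using tuples_extend[OF assms(1,4)] by blast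
  have "map_params g \<phi> \<in> formulas L (g ` univ M) n" by (rule map_params_formulas[OF assms(3)])
  then have "sat M (\<lambda>i. g (s i)) (map_params g \<phi>) \<longleftrightarrow> map g xs \<in> dset M n (map_params g \<phi>)"
    by (rule sat_extend) (use s assms aut_tup in \<open>auto simp: tuples_def dest: aut_univ\<close>)
  then show ?thesis
    using sat_aut[OF assms(1,2), of \<phi> s] sat_extend[OF assms(3) s(2) assms(4)] assms(3) s(1)
    by (simp add: formulas_def)
qed

lemma fibre_aut:
  assumes "is_struct L M" "aut_over L M A g" "\<phi> \<in> formulas L A (n + m)" "A \<subseteq> univ M"
    "xs \<in> tuples M n" "c \<in> tuples M m"
  shows "map g xs \<in> fibre M n \<phi> (map g c) \<longleftrightarrow> xs \<in> fibre M n \<phi> c"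
proof -
  have aut: "automorphism L M g" using assms(2) by (simp add: aut_over_def)
  have "map_params g \<phi> = \<phi>"
    using assms(2,3) by (intro map_params_idem) (auto simp: aut_over_def formulas_def)
  moreover have "xs @ c \<in> tuples M (n + m)" using assms(5,6) by (auto simp: tuples_def)
  moreover have "\<phi> \<in> formulas L (univ M) (n + m)" using assms(3,4) formulas_mono by blast
  ultimately have "map g (xs @ c) \<in> dset M (n + m) \<phi> \<longleftrightarrow> xs @ c \<in> dset M (n + m) \<phi>"
    using dset_aut[OF assms(1) aut, of \<phi> "n + m" "xs @ c"] by simp
  then show ?thesis using assms(5,6) aut_tup[OF aut]
    by (auto simp: dset_def fibre_def tuples_def)
qed

text \<open>Sending \<open>a\<close> to \<open>b\<close> and fixing \<open>B\<close> is well defined and elementary because the types agree; strong homogeneity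
  extends it to an automorphism.\<close>

lemma homogeneity:
  fixes M :: "('a, 'f, 'r) struct"
  assumes M: "monster L \<kappa> M" and B: "B \<subseteq> univ M" "small \<kappa> (B \<union> set a)" and tuples: "a \<in> tuples M l" "b \<in> tuples M l"
    and type: "\<And>\<phi>. \<phi> \<in> formulas L B l \<Longrightarrow> a \<in> dset M l \<phi> \<Longrightarrow> b \<in> dset M l \<phi>"
  obtains g where "aut_over L M B g" "map g a = b"
proof -
  have struct: "is_struct L M" using M by (simp add: monster_def)
  have type': "a \<in> dset M l \<phi> \<longleftrightarrow> b \<in> dset M l \<phi>" if "\<phi> \<in> formulas L B l" for \<phi>
    using type[OF that] type[of "Neg \<phi>"] that tuples by (auto simp: dset_Neg)
  have len: "length a = l" "length b = l" using tuples by (auto simp: tuples_def)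
  have Bfix: "b ! i = a ! i" if "i < l" "a ! i \<in> B" for i
    using type[of "Equ (Var i) (Par (a ! i))"] that tuples by (auto simp: formulas_def dset_def)
  have eq: "b ! i = b ! j" if "i < l" "j < l" "a ! i = a ! j" for i j
    using type[of "Equ (Var i) (Var j)"] that tuples by (auto simp: formulas_def dset_def)
  define h where "h c = (if c \<in> B then c else b ! (SOME i. i < l \<and> a ! i = c))" for c
  have h: "h (a ! i) = b ! i" if "i < l" for i
  proof (cases "a ! i \<in> B")
    case False
    define j where "j = (SOME j. j < l \<and> a ! j = a ! i)"
    have "j < l \<and> a ! j = a ! i" unfolding j_def by (rule someI[of _ i]) (use that in simp)
    then have "b ! j = b ! i" using eq that by blast
    then show ?thesis using False by (simp add: h_def j_def)
  qed (use Bfix that in \<open>simp add: h_def\<close>)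
  then have map: "map h a = b" using len by (auto intro: nth_equalityI)
  have "elementary_map L M M (B \<union> set a) h"
    unfolding elementary_map_def
  proof (intro conjI ballI)
    show "B \<union> set a \<subseteq> univ M" using B tuples by (auto simp: tuples_def)
    have "h ` set a = set b" using map by auto
    then show "h ` (B \<union> set a) \<subseteq> univ M" using B tuples by (auto simp: tuples_def h_def image_Un)
    fix \<sigma> assume \<sigma>: "\<sigma> \<in> sentences L (B \<union> set a)"
    then obtain \<phi> where \<phi>: "\<phi> \<in> formulas L B (0 + length a)"
      "\<And>(M :: ('a, 'f, 'r) struct) h xs. length xs = 0 \<Longrightarrow>
         sat M ((!) (xs @ map h a)) (map_params h \<phi>) \<longleftrightarrow> sat M ((!) xs) (map_params h \<sigma>)"
      using parameters_to_variables[where 'd = 'a] by blast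
    have \<phi>l: "\<phi> \<in> formulas L B l" using \<phi>(1) len by simp
    have id: "map_params h \<phi> = \<phi>" using \<phi>l by (intro map_params_idem) (auto simp: h_def formulas_def)
    have "map_params h \<sigma> \<in> sentences L (h ` (B \<union> set a))" by (rule map_params_formulas[OF \<sigma>])
    then have "models M (map_params h \<sigma>) \<longleftrightarrow> sat M ((!) b) \<phi>"
      using models_sentence[OF struct] \<phi>(2)[of "[]" M h] id map by simp
    moreover have "models M \<sigma> \<longleftrightarrow> sat M ((!) a) \<phi>"
      using models_sentence[OF struct \<sigma>] \<phi>(2)[of "[]" M "\<lambda>c. c"] by (simp add: fm.map_ident)
    ultimately show "models M \<sigma> \<longleftrightarrow> models M (map_params h \<sigma>)"
      using type'[OF \<phi>l] tuples by (simp add: dset_def)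
  qed
  moreover have "\<forall>B h. small \<kappa> B \<and> elementary_map L M M B h \<longrightarrow>
      (\<exists>g. automorphism L M g \<and> (\<forall>b\<in>B. g b = h b))"
    using M by (simp add: monster_def)
  ultimately obtain g where g: "automorphism L M g" "\<forall>c\<in>B \<union> set a. g c = h c"
    using B(2) by blast
  have "map g a = map h a" using g(2) by simp
  then show thesis using g map by (intro that[of g]) (auto simp: aut_over_def h_def)
qed

lemma small_Un_finite:
  assumes "monster L \<kappa> M" "small \<kappa> B" "finite F"
  shows "small \<kappa> (B \<union> F)"
proof -
  have \<kappa>: "Card_order \<kappa>" "(natLeq, \<kappa>) \<in> ordLess" using assms(1) by (auto simp: monster_def)
  have "(card_of F, natLeq) \<in> ordLess" using assms(3) finite_iff_ordLess_natLeq by blast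
  then have "(card_of F, \<kappa>) \<in> ordLess" using \<kappa>(2) by (rule ordLess_transitive)
  moreover have "infinite (Field \<kappa>)"
  proof
    assume "finite (Field \<kappa>)"
    then have "(card_of (Field \<kappa>), natLeq) \<in> ordLess" using finite_iff_ordLess_natLeq by blast
    then have "(\<kappa>, natLeq) \<in> ordLess"
      using card_of_Field_ordIso[OF \<kappa>(1)] ordIso_ordLess_trans ordIso_symmetric by blast
    then show False using \<kappa>(2) not_ordLess_ordLeq ordLess_imp_ordLeq by blast
  qed
  ultimately show ?thesis
    using card_of_Un_ordLess_infinite_Field[of \<kappa> B F] \<kappa>(1) assms(2) unfolding small_def by blast
qed

section \<open>Realizations and Morley sequences\<close>

lemma finite_params: "finite (params \<phi>)"
proof (induction \<phi>)
  have tm: "finite (set2_tm t)" for t :: "('a, 'c) tm" by (induction t) auto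
  case (Equ t u)
  then show ?case using tm by auto
next
  have tm: "finite (set2_tm t)" for t :: "('a, 'c) tm" by (induction t) auto
  case (Rel r ts)
  then show ?case using tm by auto
qed auto

text \<open>The assumption \<open>finite_rank\<close> is the consequence of stability from which the behaviour of Morley sequences is derived.\<close>

locale finite_rank_type =
  fixes L :: "('f, 'r) lang" and M :: "('a, 'f, 'r) struct" and \<kappa> :: "'k rel" and n :: nat
    and p :: "('f, 'r, 'a) fm set"
  assumes M: "monster L \<kappa> M" and p: "p \<in> complete_types L M n (univ M)"
    and finite_rank: "\<And>m \<phi>. \<phi> \<in> formulas L {} (n + m) \<Longrightarrow> \<exists>\<theta>\<in>p. \<exists>k. \<not> fm_rank_ge M n m \<phi> k (dset M n \<theta>)"
begin

definition base :: "'a set \<Rightarrow> bool" where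
  "base A \<longleftrightarrow> A \<subseteq> univ M \<and> small \<kappa> A"

text \<open>\<open>base A\<close> allows to realize types over \<open>A\<close>; invariance makes Morley sequences over \<open>A\<close> conjugate.
  Both are inherited when finitely many elements are added to \<open>A\<close>.\<close>

definition inv_base :: "'a set \<Rightarrow> bool" where
  "inv_base A \<longleftrightarrow> base A \<and> invariant_type L M A p"

definition over :: "'a set \<Rightarrow> ('f, 'r, 'a) fm set" where
  "over A = {\<theta> \<in> p. params \<theta> \<subseteq> A}"

definition realizes :: "'a set \<Rightarrow> 'a list \<Rightarrow> bool" where
  "realizes A a \<longleftrightarrow> a \<in> tuples M n \<and> (\<forall>\<theta>\<in>over A. a \<in> dset M n \<theta>)"

text \<open>Each member realizes \<open>p\<close> over \<open>A\<close> and the members before it.\<close>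

fun morley :: "'a set \<Rightarrow> 'a list list \<Rightarrow> bool" where
  "morley A [] \<longleftrightarrow> True"
| "morley A (a # as) \<longleftrightarrow> realizes A a \<and> morley (A \<union> set a) as"

abbreviation elems :: "'a list list \<Rightarrow> 'a set" where
  "elems as \<equiv> \<Union>(set ` set as)"

lemma struct: "is_struct L M" using M by (simp add: monster_def)

lemma p_formulas: "\<theta> \<in> p \<Longrightarrow> \<theta> \<in> formulas L (univ M) n"
  using complete_typeD(2)[OF p] by blast

lemma over_mono: "A \<subseteq> B \<Longrightarrow> over A \<subseteq> over B" by (auto simp: over_def)

lemma over_formulas: "over A \<subseteq> formulas L A n"
  using p_formulas by (auto simp: over_def formulas_def)

lemma realizes_mono: "A \<subseteq> B \<Longrightarrow> realizes B a \<Longrightarrow> realizes A a"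
  using over_mono[of A B] by (auto simp: realizes_def)

lemma realizes_tup: "realizes A a \<Longrightarrow> a \<in> tuples M n" by (simp add: realizes_def)

lemma realizes_set: "realizes A a \<Longrightarrow> set a \<subseteq> univ M" by (auto simp: realizes_def tuples_def)

lemma base_extend: "base A \<Longrightarrow> finite F \<Longrightarrow> F \<subseteq> univ M \<Longrightarrow> base (A \<union> F)"
  using small_Un_finite[OF M] by (auto simp: base_def)

lemma base_params: "base A \<Longrightarrow> \<theta> \<in> p \<Longrightarrow> base (A \<union> params \<theta>)"
  using p_formulas by (auto intro!: base_extend finite_params simp: formulas_def)

lemma inv_base_extend: "inv_base A \<Longrightarrow> finite F \<Longrightarrow> F \<subseteq> univ M \<Longrightarrow> inv_base (A \<union> F)"
  using base_extend by (auto simp: inv_base_def invariant_type_def)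

lemma morley_mono: "A \<subseteq> B \<Longrightarrow> morley B as \<Longrightarrow> morley A as"
proof (induction as arbitrary: A B)
  case (Cons a as)
  have "A \<union> set a \<subseteq> B \<union> set a" using Cons.prems by auto
  from Cons.IH[OF this] show ?case using Cons.prems realizes_mono[of A B a] by simp
qed auto

lemma morley_append: "morley A (as @ bs) \<longleftrightarrow> morley A as \<and> morley (A \<union> elems as) bs"
  by (induction as arbitrary: A) (auto simp: Un_assoc)

lemma morley_nth: "morley A as \<Longrightarrow> i < length as \<Longrightarrow> realizes (A \<union> elems (take i as)) (as ! i)"
proof (induction as arbitrary: A i)
  case (Cons a as)
  then show ?case
    using Cons.IH[of "A \<union> set a" "i - 1"] by (cases i) (simp_all add: Un_assoc)
qed auto

lemma morley_real: "morley A as \<Longrightarrow> a \<in> set as \<Longrightarrow> realizes A a"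
  using morley_nth realizes_mono[of A] by (metis Un_upper1 in_set_conv_nth)

lemma morley_elems: "morley A as \<Longrightarrow> elems as \<subseteq> univ M"
  using morley_real realizes_set by blast

lemma morley_pair:
  assumes "morley A as" "i < j" "j < length as"
  shows "morley A [as ! i, as ! j]"
proof -
  have "as ! i \<in> set (take j as)" using assms by (auto simp: in_set_conv_nth)
  then have "A \<union> set (as ! i) \<subseteq> A \<union> elems (take j as)" by auto
  then have "realizes (A \<union> set (as ! i)) (as ! j)" using morley_nth[OF assms(1,3)] realizes_mono by blast
  then show ?thesis using morley_real[OF assms(1), of "as ! i"] assms by auto
qed

lemma over_conj:
  assumes "finite \<Phi>" "\<Phi> \<subseteq> over A"
  shows "\<exists>\<theta>\<in>over A. dset M n \<theta> \<subseteq> (\<Inter>\<phi>\<in>\<Phi>. dset M n \<phi>)"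
  using assms
proof (induction \<Phi>)
  case empty
  have "Neg Fls \<in> p" by (rule complete_type_closed[OF p, of "{}"]) (auto simp: dset_Neg dset_def)
  then have "Neg Fls \<in> over A" by (simp add: over_def)
  then show ?case by blast
next
  case (insert \<phi> \<Phi>)
  then obtain \<theta> where \<theta>: "\<theta> \<in> over A" "dset M n \<theta> \<subseteq> (\<Inter>\<phi>\<in>\<Phi>. dset M n \<phi>)" by auto
  have "\<phi> \<in> p" "\<theta> \<in> p" "params \<phi> \<subseteq> A" "params \<theta> \<subseteq> A" using insert.prems \<theta>(1) by (auto simp: over_def)
  then have "And \<phi> \<theta> \<in> over A" using complete_type_And[OF p] by (simp add: over_def)
  moreover have "dset M n (And \<phi> \<theta>) \<subseteq> (\<Inter>\<phi>\<in>insert \<phi> \<Phi>. dset M n \<phi>)" using \<theta>(2) by (auto simp: dset_And)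
  ultimately show ?case by blast
qed

text \<open>Compactness in the form used below: if no realization of \<open>p\<close> over \<open>A\<close> satisfies all of \<open>\<Psi>\<close>, this is
  due to a single formula of \<open>p\<close> over \<open>A\<close> and finitely many formulas of \<open>\<Psi>\<close>.\<close>

lemma over_compact:
  assumes "base B" "A \<subseteq> B" "\<Psi> \<subseteq> formulas L B n" 
    and none: "\<And>a. realizes A a \<Longrightarrow> \<exists>\<psi>\<in>\<Psi>. a \<notin> dset M n \<psi>"
  obtains \<theta> \<Psi>0 where "\<theta> \<in> over A" "finite \<Psi>0" "\<Psi>0 \<subseteq> \<Psi>" "dset M n \<theta> \<inter> (\<Inter>\<psi>\<in>\<Psi>0. dset M n \<psi>) = {}"
proof -
  have sub: "over A \<union> \<Psi> \<subseteq> formulas L B n"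
    using over_formulas[of A] formulas_mono[OF assms(2), of n n L] assms(3) by blast
  have unreal: "\<not> (\<exists>xs\<in>tuples M n. \<forall>\<phi>\<in>over A \<union> \<Psi>. xs \<in> dset M n \<phi>)"
  proof
    assume "\<exists>xs\<in>tuples M n. \<forall>\<phi>\<in>over A \<union> \<Psi>. xs \<in> dset M n \<phi>"
    then obtain xs where "realizes A xs" "\<forall>\<phi>\<in>\<Psi>. xs \<in> dset M n \<phi>" by (auto simp: realizes_def)
    then show False using none by blast
  qed
  have "\<not> (\<forall>\<Phi>0. finite \<Phi>0 \<longrightarrow> \<Phi>0 \<subseteq> over A \<union> \<Psi> \<longrightarrow> (\<exists>xs\<in>tuples M n. \<forall>\<phi>\<in>\<Phi>0. xs \<in> dset M n \<phi>))"
    (is "\<not> ?fin")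
  proof
    assume ?fin
    have "B \<subseteq> univ M" "small \<kappa> B" using assms(1) by (auto simp: base_def)
    then have "\<exists>xs\<in>tuples M n. \<forall>\<phi>\<in>over A \<union> \<Psi>. xs \<in> dset M n \<phi>"
      by (rule saturation[OF M _ _ sub \<open>?fin\<close>[rule_format]])
    with unreal show False by (rule notE)
  qed
  then have "\<exists>\<Phi>0. finite \<Phi>0 \<and> \<Phi>0 \<subseteq> over A \<union> \<Psi> \<and> (\<forall>xs\<in>tuples M n. \<exists>\<phi>\<in>\<Phi>0. xs \<notin> dset M n \<phi>)"
    by simp
  then obtain \<Phi>0 where \<Phi>0: "finite \<Phi>0" "\<Phi>0 \<subseteq> over A \<union> \<Psi>" "\<forall>xs\<in>tuples M n. \<exists>\<phi>\<in>\<Phi>0. xs \<notin> dset M n \<phi>"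
    by (elim exE conjE)
  have "finite (\<Phi>0 \<inter> over A)" using \<Phi>0(1) by simp
  then obtain \<theta> where \<theta>: "\<theta> \<in> over A" "dset M n \<theta> \<subseteq> (\<Inter>\<phi>\<in>\<Phi>0 \<inter> over A. dset M n \<phi>)"
    using over_conj[of "\<Phi>0 \<inter> over A" A] by blast
  have "dset M n \<theta> \<inter> (\<Inter>\<psi>\<in>\<Phi>0 \<inter> \<Psi>. dset M n \<psi>) = {}"
  proof (rule ccontr)
    assume "\<not> ?thesis"
    then obtain xs where xs: "xs \<in> dset M n \<theta>" "\<forall>\<psi>\<in>\<Phi>0 \<inter> \<Psi>. xs \<in> dset M n \<psi>" by blast
    then have "\<forall>\<phi>\<in>\<Phi>0. xs \<in> dset M n \<phi>" using \<theta>(2) \<Phi>0(2) by blast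
    moreover have "xs \<in> tuples M n" using xs(1) by (simp add: dset_def)
    ultimately show False using \<Phi>0(3) by blast
  qed
  with \<theta>(1) \<Phi>0(1) show thesis by (intro that[of \<theta> "\<Phi>0 \<inter> \<Psi>"]) auto
qed

lemma over_nonempty: "\<theta> \<in> p \<Longrightarrow> dset M n \<theta> \<noteq> {}"
  using complete_type_finite_sat[OF p, of "{\<theta>}"] by auto

lemma realizes_exists:
  assumes "base A" obtains a where "realizes A a"
proof (rule ccontr)
  assume "\<not> thesis"
  then have none: "\<not> realizes A a" for a using that by blast
  obtain \<theta> \<Psi>0 where "\<theta> \<in> over A" "\<Psi>0 \<subseteq> {}" "dset M n \<theta> \<inter> (\<Inter>\<psi>\<in>\<Psi>0. dset M n \<psi>) = {}"
    by (rule over_compact[OF assms order_refl, of "{}"]) (use none in auto)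
  then show False using over_nonempty[of \<theta>] by (auto simp: over_def)
qed

lemma morley_exists:
  assumes "base A" shows "\<exists>as. morley A as \<and> length as = k"
  using assms
proof (induction k arbitrary: A)
  case (Suc k)
  obtain a where a: "realizes A a" using realizes_exists[OF Suc.prems] by blast
  then have "base (A \<union> set a)" using base_extend[OF Suc.prems] realizes_set by simp
  then obtain as where "morley (A \<union> set a) as" "length as = k" using Suc.IH by blast
  with a show ?case by (intro exI[of _ "a # as"]) simp
qed simp

text \<open>Invariance as defined says that the image of \<open>p\<close> is \<open>p\<close>. It reflects membership since \<open>p\<close> is complete.\<close>

lemma inv_iff:
  assumes "inv_base A" "aut_over L M A g" "\<theta> \<in> formulas L (univ M) n"
  shows "map_params g \<theta> \<in> p \<longleftrightarrow> \<theta> \<in> p"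
proof -
  have img: "map_params g ` p = p"
    using assms(1,2) by (simp add: inv_base_def invariant_type_def aut_over_def)
  then have imp: "map_params g \<psi> \<in> p" if "\<psi> \<in> p" for \<psi> using that by blast
  show ?thesis
  proof
    assume *: "map_params g \<theta> \<in> p"
    show "\<theta> \<in> p"
    proof (rule ccontr)
      assume "\<theta> \<notin> p"
      then have "Neg \<theta> \<in> p" using complete_type_Neg[OF p assms(3)] by simp
      then have "Neg (map_params g \<theta>) \<in> p" using imp[of "Neg \<theta>"] by simp
      then show False using * complete_type_Neg[OF p p_formulas[OF *]] by simp
    qed
  qed (use imp in blast)
qed

lemma inst_inv_iff:
  assumes "inv_base A" "aut_over L M A g" "\<phi> \<in> formulas L A (n + m)" "c \<in> tuples M m"
  shows "inst n (map g c) \<phi> \<in> p \<longleftrightarrow> inst n c \<phi> \<in> p"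
proof -
  have A: "A \<subseteq> univ M" using assms(1) by (simp add: inv_base_def base_def)
  have "map_params g \<phi> = \<phi>"
    using assms(2,3) by (intro map_params_idem) (auto simp: aut_over_def formulas_def)
  moreover have "inst n c \<phi> \<in> formulas L (univ M) n"
    by (rule inst_formulas[OF _ A]) (use assms(3,4) in \<open>auto simp: tuples_def\<close>)
  ultimately show ?thesis using inv_iff[OF assms(1,2), of "inst n c \<phi>"] by (simp add: map_params_inst)
qed

lemma inst_over:
  assumes "\<phi> \<in> formulas L B (n + m)" "length c = m" "set c \<subseteq> B" "inst n c \<phi> \<in> p"
  shows "inst n c \<phi> \<in> over B"
  using inst_formulas[of \<phi> L B n c B] assms by (auto simp: over_def formulas_def)

lemma realizes_fam:
  assumes "realizes B a" "\<phi> \<in> formulas L B (n + m)" "length c = m" "set c \<subseteq> B" "inst n c \<phi> \<in> p"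
  shows "a \<in> fibre M n \<phi> c"
  using assms inst_over[OF assms(2-)] dset_inst[OF assms(2,3), of M] by (auto simp: realizes_def)

lemma aut_intf:
  "automorphism L M g \<Longrightarrow> (k, length as) \<in> funs L \<Longrightarrow> set as \<subseteq> univ M \<Longrightarrow>
     g (intf M k as) = intf M k (map g as)"
  unfolding automorphism_def by blast

lemma aut_intr:
  "automorphism L M g \<Longrightarrow> (k, length as) \<in> rels L \<Longrightarrow> set as \<subseteq> univ M \<Longrightarrow>
     intr M k as \<longleftrightarrow> intr M k (map g as)"
  unfolding automorphism_def by blast

lemma aut_comp:
  assumes "aut_over L M A f" "aut_over L M A g"
  shows "aut_over L M A (f \<circ> g)"
proof -
  have f: "automorphism L M f" and g: "automorphism L M g" using assms by (auto simp: aut_over_def)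
  have img: "set (map g as) \<subseteq> univ M" if "set as \<subseteq> univ M" for as
    using aut_univ[OF g] that by auto
  have "f (g (intf M k as)) = intf M k (map f (map g as))"
    if "(k, length as) \<in> funs L" "set as \<subseteq> univ M" for k as
    using aut_intf[OF g that] aut_intf[OF f, of k "map g as"] img[OF that(2)] that(1) by simp
  moreover have "intr M k as \<longleftrightarrow> intr M k (map f (map g as))"
    if "(k, length as) \<in> rels L" "set as \<subseteq> univ M" for k as
    using aut_intr[OF g that] aut_intr[OF f, of k "map g as"] img[OF that(2)] that(1) by simp
  moreover have "bij_betw (f \<circ> g) (univ M) (univ M)"
    using f g by (auto simp: automorphism_def intro: bij_betw_trans)
  ultimately show ?thesis using assms by (auto simp: aut_over_def automorphism_def)
qed

text \<open>Suppose \<open>g\<close> carries the sequence \<open>as\<close> to \<open>bs'\<close>. By invariance \<open>g a\<close> realizes \<open>p\<close> over \<open>A\<close> and \<open>bs'\<close>, just as \<open>b\<close> does, so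
  homogeneity gives an automorphism over \<open>A\<close> and \<open>bs'\<close> from \<open>g a\<close> to \<open>b\<close> to compose with \<open>g\<close>.\<close>

lemma morley_conj:
  assumes "inv_base A" "morley A as" "morley A bs" "length as = length bs"
  shows "\<exists>g. aut_over L M A g \<and> map (map g) as = bs"
  using assms(2-)
proof (induction as arbitrary: bs rule: rev_induct)
  case Nil
  have "aut_over L M A (\<lambda>x. x)" by (simp add: aut_over_def automorphism_def bij_betw_def)
  then show ?case using Nil by auto
next
  case (snoc a as)
  then obtain b bs' where bs: "bs = bs' @ [b]" "length as = length bs'" by (cases bs rule: rev_cases) auto
  with snoc.prems have as: "morley A as" "realizes (A \<union> elems as) a" and bs': "morley A bs'" "realizes (A \<union> elems bs') b"
    by (auto simp: morley_append)
  from snoc.IH[OF as(1) bs'(1) bs(2)] obtain g where g: "aut_over L M A g" "map (map g) as = bs'" by blast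
  have aut: "automorphism L M g" using g(1) by (simp add: aut_over_def)
  define B where "B = A \<union> elems bs'"
  have A: "A \<subseteq> univ M" "base A" using assms(1) by (auto simp: inv_base_def base_def)
  have B: "base B" unfolding B_def using base_extend[OF A(2) _ morley_elems[OF bs'(1)]] by simp
  have gB: "g ` (A \<union> elems as) = B"
  proof -
    have "g ` A = A" using g(1) by (auto simp: aut_over_def)
    moreover have "g ` elems as = elems (map (map g) as)" by auto
    ultimately show ?thesis using g(2) by (simp add: B_def image_Un)
  qed
  have ga: "map g a \<in> tuples M n" "b \<in> tuples M n" using aut_tup[OF aut] as(2) bs'(2) by (auto simp: realizes_def)
  have "base (B \<union> set (map g a))" by (rule base_extend[OF B]) (use ga in \<open>auto simp: tuples_def\<close>)
  then have small: "small \<kappa> (B \<union> set (map g a))" by (simp add: base_def)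
  have "b \<in> dset M n \<phi>" if \<phi>: "\<phi> \<in> formulas L B n" "map g a \<in> dset M n \<phi>" for \<phi>
  proof (rule ccontr)
    assume b: "b \<notin> dset M n \<phi>"
    have \<phi>M: "\<phi> \<in> formulas L (univ M) n" using \<phi>(1) B formulas_mono unfolding base_def by blast
    have "Neg \<phi> \<in> p"
    proof (rule ccontr)
      assume "Neg \<phi> \<notin> p"
      then have "\<phi> \<in> over B" using complete_type_Neg[OF p \<phi>M] \<phi>(1) by (auto simp: over_def formulas_def)
      then show False using b bs'(2) by (simp add: realizes_def B_def)
    qed
    define k where "k = inv_into (A \<union> elems as) g"
    have k: "k c \<in> A \<union> elems as \<and> g (k c) = c" if "c \<in> B" for c
      using inv_into_into[of c g "A \<union> elems as"] f_inv_into_f[of c g "A \<union> elems as"] that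
      unfolding gB k_def by blast
    \<comment> \<open>The preimage of \<open>\<not> \<phi>\<close> under \<open>g\<close>, a formula over \<open>A\<close> and \<open>as\<close>.\<close>
    define \<psi> where "\<psi> = map_params k (Neg \<phi>)"
    have "map_params g \<psi> = Neg \<phi>"
      unfolding \<psi>_def map_params_comp by (rule map_params_idem) (use \<phi>(1) k in \<open>auto simp: formulas_def\<close>)
    moreover have \<psi>: "\<psi> \<in> formulas L (A \<union> elems as) n"
    proof -
      have "Neg \<phi> \<in> formulas L B n" using \<phi>(1) by simp
      from map_params_formulas[OF this, of k] show ?thesis
        unfolding \<psi>_def using formulas_mono[of "k ` B" "A \<union> elems as" n n L] k
        by (meson image_subsetI order_refl subsetD)
    qed
    moreover have \<psi>M: "\<psi> \<in> formulas L (univ M) n"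
      using \<psi> A(1) morley_elems[OF as(1)] formulas_mono[of "A \<union> elems as" "univ M" n n L] by blast
    ultimately have "\<psi> \<in> over (A \<union> elems as)"
      using inv_iff[OF assms(1) g(1) \<psi>M] \<open>Neg \<phi> \<in> p\<close> by (simp add: over_def formulas_def)
    then have "a \<in> dset M n \<psi>" using as(2) by (simp add: realizes_def)
    then have "map g a \<in> dset M n (Neg \<phi>)"
      using dset_aut[OF struct aut \<psi>M realizes_tup[OF as(2)]] \<open>map_params g \<psi> = Neg \<phi>\<close> by simp
    then show False using \<phi>(2) by (simp add: dset_Neg)
  qed
  then obtain f where f: "aut_over L M B f" "map f (map g a) = b"
    using homogeneity[OF M _ small ga] B unfolding base_def by blast
  have fA: "aut_over L M A f" using f(1) by (auto simp: aut_over_def B_def)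
  have "map f x = x" if "x \<in> set bs'" for x
    using f(1) that by (intro map_idI) (auto simp: aut_over_def B_def)
  then have "map (map f) bs' = bs'" by (simp add: map_idI)
  moreover have "map (map f) (map (map g) (as @ [a])) = map (map f) bs' @ [b]"
    using g(2) f(2) by (simp del: map_map)
  ultimately have "map (map (f \<circ> g)) (as @ [a]) = bs" using bs(1) by (simp add: o_def)
  then show ?case using aut_comp[OF fA g(1)] by blast
qed

section \<open>Morley sequences admit no order\<close>

text \<open>Parameters of \<open>\<phi>\<close> can be regarded as further variables \<open>y\<close> with fixed values, and fixing values leaves fewer
  sets to split with.\<close>

lemma finite_rank_params:
  assumes "\<phi> \<in> formulas L (univ M) (n + m)"
  shows "\<exists>\<theta>\<in>p. \<exists>k. \<not> fm_rank_ge M n m \<phi> k (dset M n \<theta>)"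
proof -
  obtain cs where cs: "set cs = params \<phi>" using finite_list[OF finite_params[of \<phi>]] by (rule exE)
  then have "\<phi> \<in> formulas L ({} \<union> set cs) (n + m)" using assms by (simp add: formulas_def)
  from parameters_to_variables[OF this, where 'd = 'a]
  obtain \<phi>' where \<phi>': "\<phi>' \<in> formulas L {} (n + m + length cs)"
    "\<forall>(M :: ('a, 'f, 'r) struct) h xs. length xs = n + m \<longrightarrow>
       sat M ((!) (xs @ map h cs)) (map_params h \<phi>') \<longleftrightarrow> sat M ((!) xs) (map_params h \<phi>)"
    by (rule bexE)
  have "\<phi>' \<in> formulas L {} (n + (m + length cs))" using \<phi>'(1) by (simp add: add.assoc)
  from finite_rank[OF this]
  obtain \<theta> k where \<theta>: "\<theta> \<in> p" "\<not> fm_rank_ge M n (m + length cs) \<phi>' k (dset M n \<theta>)" by (elim bexE exE)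
  have "set cs \<subseteq> univ M" using cs assms by (auto simp: formulas_def)
  moreover have "sat M ((!) (x @ b @ cs)) \<phi>' \<longleftrightarrow> sat M ((!) (x @ b)) \<phi>" if "x \<in> tuples M n" "b \<in> tuples M m" for x b
    using that \<phi>'(2)[rule_format, of "x @ b" M "\<lambda>c. c"] by (simp add: tuples_def fm.map_ident)
  ultimately have "b @ cs \<in> tuples M (m + length cs) \<and> fibre M n \<phi> b = fibre M n \<phi>' (b @ cs)" if "b \<in> tuples M m" for b
    using that by (auto simp: tuples_def fibre_def)
  from rank_ge_reindex[of "tuples M m" "\<lambda>b. b @ cs", OF this] have "\<not> fm_rank_ge M n m \<phi> k (dset M n \<theta>)"
    using \<theta>(2) unfolding fm_rank_ge_def by blast
  then show ?thesis using \<theta>(1) by blast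
qed

text \<open>Let \<open>bs\<close> be a Morley sequence of length \<open>K = 2 ^ k\<close> inside a formula \<open>\<theta>\<close> that does not have \<open>\<phi>\<close>-rank \<open>k\<close>. If some
  Morley sequence \<open>as\<close> over \<open>A\<close> avoided \<open>\<phi>(x, c) \<in> p\<close>, then for each \<open>j\<close> its first \<open>j\<close> members could be prolonged by
  realizations of \<open>p\<close> over \<open>c\<close> as well, which satisfy \<open>\<phi>(x, c)\<close>. Conjugating the result to \<open>bs\<close> turns \<open>c\<close> into
  some \<open>d\<^sub>j\<close> with \<open>\<phi>(b\<^sub>i, d\<^sub>j)\<close> iff \<open>j \<le> i\<close>: an order of length \<open>2 ^ k\<close> inside \<open>\<theta>\<close>, hence rank \<open>k\<close>.\<close>

lemma generically_stable:
  assumes A: "inv_base A" and \<phi>: "\<phi> \<in> formulas L A (n + m)"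
  shows "\<exists>K. \<forall>c\<in>tuples M m. inst n c \<phi> \<in> p \<longrightarrow>
    (\<forall>as. morley A as \<and> length as = K \<longrightarrow> (\<exists>a\<in>set as. a \<in> fibre M n \<phi> c))"
proof -
  have Au: "A \<subseteq> univ M" "base A" using A by (auto simp: inv_base_def base_def)
  have "\<phi> \<in> formulas L (univ M) (n + m)" using \<phi> formulas_mono[OF Au(1) order_refl] by (rule subsetD[rotated])
  from finite_rank_params[OF this]
  obtain \<theta> k where \<theta>: "\<theta> \<in> p" "\<not> fm_rank_ge M n m \<phi> k (dset M n \<theta>)" by (elim bexE exE)
  let ?K = "2 ^ k :: nat"
  obtain bs where bs: "morley (A \<union> params \<theta>) bs" "length bs = ?K"
    using morley_exists[OF base_params[OF Au(2) \<theta>(1)]] by blast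
  have bsA: "morley A bs" using morley_mono[OF _ bs(1)] by blast
  have member: "\<exists>a\<in>set as. a \<in> fibre M n \<phi> c"
    if c: "c \<in> tuples M m" "inst n c \<phi> \<in> p" and as: "morley A as" "length as = ?K" for c as
  proof (rule ccontr)
    assume neg: "\<not> (\<exists>a\<in>set as. a \<in> fibre M n \<phi> c)"
    have cl: "length c = m" "set c \<subseteq> univ M" using c(1) by (auto simp: tuples_def)
    have "\<exists>d\<in>tuples M m. \<forall>i<?K. bs ! i \<in> fibre M n \<phi> d \<longleftrightarrow> j \<le> i" if j: "j < ?K" for j
    proof -
      have "base (A \<union> (set c \<union> elems (take j as)))"
        by (rule base_extend[OF Au(2)]) (use cl morley_elems[OF as(1)] set_take_subset[of j as] in auto)
      then obtain ds where ds: "morley (A \<union> (set c \<union> elems (take j as))) ds" "length ds = ?K - j"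
        using morley_exists by blast
      let ?es = "take j as @ ds"
      have "morley A (take j as)" using as(1) morley_append[of A "take j as" "drop j as"] by simp
      moreover have "morley (A \<union> elems (take j as)) ds" by (rule morley_mono[OF _ ds(1)]) auto
      ultimately have es: "morley A ?es" "length ?es = ?K" using ds(2) j as(2) by (auto simp: morley_append)
      then obtain g where g: "aut_over L M A g" "map (map g) ?es = bs"
        using morley_conj[OF A es(1) bsA] bs(2) by auto
      have "bs ! i \<in> fibre M n \<phi> (map g c) \<longleftrightarrow> j \<le> i" if i: "i < ?K" for i
      proof -
        have "?es ! i \<in> set ?es" using i es(2) by (metis nth_mem)
        then have t: "?es ! i \<in> tuples M n" using morley_real[OF es(1)] realizes_tup by blast
        have "bs ! i = map g (?es ! i)" using g(2) i es(2) by (metis nth_map)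
        then have "bs ! i \<in> fibre M n \<phi> (map g c) \<longleftrightarrow> ?es ! i \<in> fibre M n \<phi> c"
          using fibre_aut[OF struct g(1) \<phi> Au(1) t c(1)] by simp
        also have "\<dots> \<longleftrightarrow> j \<le> i"
        proof (cases "j \<le> i")
          case True
          then have "?es ! i = ds ! (i - j)" "i - j < length ds" using j i as(2) ds(2) by (auto simp: nth_append)
          then have "realizes (A \<union> (set c \<union> elems (take j as))) (?es ! i)"
            using morley_real[OF ds(1)] nth_mem by metis
          then have "realizes (A \<union> set c) (?es ! i)" by (rule realizes_mono[rotated]) auto
          moreover have "\<phi> \<in> formulas L (A \<union> set c) (n + m)" using \<phi> formulas_mono[of A "A \<union> set c"] by blast
          ultimately have "?es ! i \<in> fibre M n \<phi> c" by (rule realizes_fam) (use cl c(2) in auto)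
          then show ?thesis using True by simp
        next
          case False
          then have "?es ! i = as ! i" "i < length as" using j as(2) by (auto simp: nth_append)
          then show ?thesis using neg False nth_mem by metis
        qed
        finally show ?thesis .
      qed
      moreover have "map g c \<in> tuples M m" using aut_tup g(1) c(1) by (auto simp: aut_over_def)
      ultimately show ?thesis by blast
    qed
    then obtain d where "\<And>j. j < ?K \<Longrightarrow> d j \<in> tuples M m \<and> (\<forall>i<?K. bs ! i \<in> fibre M n \<phi> (d j) \<longleftrightarrow> j \<le> i)" by metis
    \<comment> \<open>The members of \<open>bs\<close> satisfy \<open>\<theta>\<close> since \<open>bs\<close> is Morley over the parameters of \<open>\<theta>\<close> too.\<close>
    moreover have "(\<lambda>i. bs ! i) ` {0..<0 + 2 ^ k} \<subseteq> dset M n \<theta>"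
    proof
      fix b assume "b \<in> (\<lambda>i. bs ! i) ` {0..<0 + 2 ^ k}"
      then have "b \<in> set bs" using bs(2) by auto
      then have "realizes (A \<union> params \<theta>) b" using morley_real[OF bs(1)] by blast
      then show "b \<in> dset M n \<theta>" using \<theta>(1) by (auto simp: realizes_def over_def)
    qed
    ultimately have "rank_ge (fibre M n \<phi>) (tuples M m) k (dset M n \<theta>)"
      by (intro rank_ge_order[of ?K d "tuples M m" "\<lambda>i. bs ! i" "fibre M n \<phi>" 0 k]) auto
    then show False using \<theta>(2) by (simp add: fm_rank_ge_def)
  qed
  show ?thesis
    by (intro exI[of _ ?K] ballI allI impI, elim conjE) (rule member; assumption)
qed

text \<open>If \<open>\<chi>\<close> told the order in the pair \<open>e1, e2\<close>, it would tell the order of any two members of any Morley sequence over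
  \<open>A\<close>. Let such a sequence lie in a formula of finite \<open>\<chi>\<close>-rank. Its odd members, with the even members as parameters,
  are then ordered.\<close>

lemma symmetry:
  assumes A: "inv_base A" and \<chi>: "\<chi> \<in> formulas L A (n + n)" and e: "morley A [e1, e2]" "e2 \<in> fibre M n \<chi> e1"
  shows "e1 \<in> fibre M n \<chi> e2"
proof (rule ccontr)
  assume neg: "e1 \<notin> fibre M n \<chi> e2"
  have Au: "A \<subseteq> univ M" "base A" using A by (auto simp: inv_base_def base_def)
  have "\<chi> \<in> formulas L (univ M) (n + n)" using \<chi> formulas_mono[OF Au(1) order_refl] by (rule subsetD[rotated])
  from finite_rank_params[OF this]
  obtain \<theta> k where \<theta>: "\<theta> \<in> p" "\<not> fm_rank_ge M n n \<chi> k (dset M n \<theta>)" by (elim bexE exE)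
  let ?K = "2 ^ k :: nat"
  obtain bs where bs: "morley (A \<union> params \<theta>) bs" "length bs = 2 * ?K"
    using morley_exists[OF base_params[OF Au(2) \<theta>(1)]] by blast
  have bsA: "morley A bs" using morley_mono[OF _ bs(1)] by blast
  have realizes: "realizes (A \<union> params \<theta>) (bs ! i)" if "i < 2 * ?K" for i
    using morley_real[OF bs(1)] bs(2) that nth_mem by metis
  have te: "e1 \<in> tuples M n" "e2 \<in> tuples M n" using e(1) realizes_tup by auto
  have pair: "bs ! v \<in> fibre M n \<chi> (bs ! u) \<and> bs ! u \<notin> fibre M n \<chi> (bs ! v)" if "u < v" "v < 2 * ?K" for u v
  proof -
    have "morley A [bs ! u, bs ! v]" using morley_pair[OF bsA] that bs(2) by simp
    then obtain g where g: "aut_over L M A g" "map (map g) [e1, e2] = [bs ! u, bs ! v]"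
      using morley_conj[OF A e(1)] by fastforce
    then show ?thesis
      using fibre_aut[OF struct g(1) \<chi> Au(1), of e2 e1] fibre_aut[OF struct g(1) \<chi> Au(1), of e1 e2] te e(2) neg
      by simp
  qed
  have "bs ! (2 * j) \<in> tuples M n \<and> (bs ! (2 * i + 1) \<in> fibre M n \<chi> (bs ! (2 * j)) \<longleftrightarrow> j \<le> i)"
    if "i < ?K" "j < ?K" for i j
  proof (cases "j \<le> i")
    case True
    then show ?thesis using pair[of "2 * j" "2 * i + 1"] realizes[of "2 * j"] realizes_tup that by auto
  next
    case False
    then show ?thesis using pair[of "2 * i + 1" "2 * j"] realizes[of "2 * j"] realizes_tup that by auto
  qed
  moreover have "(\<lambda>i. bs ! (2 * i + 1)) ` {0..<0 + 2 ^ k} \<subseteq> dset M n \<theta>"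
    using realizes \<theta>(1) by (auto simp: realizes_def over_def)
  ultimately have "rank_ge (fibre M n \<chi>) (tuples M n) k (dset M n \<theta>)"
    by (intro rank_ge_order[of ?K "\<lambda>j. bs ! (2 * j)" "tuples M n" "\<lambda>i. bs ! (2 * i + 1)" "fibre M n \<chi>" 0 k]) auto
  then show False using \<theta>(2) by (simp add: fm_rank_ge_def)
qed

section \<open>Finite rank over the base\<close>

definition unranked :: "nat \<Rightarrow> ('f, 'r, 'a) fm \<Rightarrow> 'a set \<Rightarrow> bool" where
  "unranked m \<phi> A \<longleftrightarrow> (\<forall>\<theta>\<in>over A. \<forall>k. fm_rank_ge M n m \<phi> k (dset M n \<theta>))"

text \<open>Suppose a formula \<open>\<chi>'(x, e)\<close> of \<open>p\<close> has finite rank. So has \<open>\<chi>'(x, a)\<close> for every other realization \<open>a\<close> of \<open>p\<close> over \<open>A\<close>, by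
  conjugation, and \<open>\<chi>'(x, a) \<in> p\<close>. By \<open>symmetry\<close> also \<open>\<chi>'(a, x) \<in> p\<close>, and by generic stability \<open>\<chi>'(a, e')\<close> holds for some
  member \<open>e'\<close> of any Morley sequence of fixed length. So the sets \<open>\<chi>'(x, e')\<close>, for \<open>e'\<close> in one such sequence, cover
  the realizations of \<open>p\<close> over \<open>A\<close>; by compactness they cover a formula of \<open>p\<close> over \<open>A\<close>, whose rank
  is finite because the rank of a finite union is.\<close>

lemma unranked_step:
  assumes A: "inv_base A" and \<phi>: "\<phi> \<in> formulas L {} (n + m)" and unr: "unranked m \<phi> A" and e: "realizes A e"
  shows "unranked m \<phi> (A \<union> set e)"
  unfolding unranked_def
proof (intro ballI allI, rule ccontr)
  fix \<chi> k assume \<chi>: "\<chi> \<in> over (A \<union> set e)" and fin: "\<not> fm_rank_ge M n m \<phi> k (dset M n \<chi>)"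
  have Au: "A \<subseteq> univ M" "base A" using A by (auto simp: inv_base_def base_def)
  have el: "length e = n" "set e \<subseteq> univ M" "e \<in> tuples M n" using e by (auto simp: realizes_def tuples_def)
  have "\<chi> \<in> formulas L (A \<union> set e) n" using \<chi> over_formulas by blast
  from parameters_to_variables[OF this, where 'd = 'a]
  obtain \<chi>' where \<chi>': "\<chi>' \<in> formulas L A (n + length e)"
    "\<forall>(M :: ('a, 'f, 'r) struct) h xs. length xs = n \<longrightarrow>
       sat M ((!) (xs @ map h e)) (map_params h \<chi>') \<longleftrightarrow> sat M ((!) xs) (map_params h \<chi>)"
    by (rule bexE)
  have \<chi>'A: "\<chi>' \<in> formulas L A (n + n)" using \<chi>'(1) el by simp
  have d: "dset M n \<chi> = fibre M n \<chi>' e"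
    using \<chi>'(2)[rule_format, of _ M "\<lambda>c. c"] by (auto simp: dset_def fibre_def fm.map_ident tuples_def)
  have inst: "inst n c \<chi>' \<in> formulas L (univ M) n" if "c \<in> tuples M n" for c
    by (rule inst_formulas[OF _ Au(1)]) (use that \<chi>'A in \<open>auto simp: tuples_def\<close>)
  have "\<chi> \<in> p" using \<chi> by (simp add: over_def)
  then have "inst n e \<chi>' \<in> p"
    by (intro complete_type_closed[OF p, of "{\<chi>}"]) (use inst[OF el(3)] dset_inst[OF \<chi>'A el(1), of M] d in auto)
  then have in_p: "inst n a \<chi>' \<in> p" if a: "realizes A a" for a
  proof -
    obtain g where g: "aut_over L M A g" "map (map g) [e] = [a]"
      using morley_conj[OF A, of "[e]" "[a]"] e a by auto
    then show ?thesis using inst_inv_iff[OF A g(1) \<chi>'A el(3)] \<open>inst n e \<chi>' \<in> p\<close> by simp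
  qed
  have small: "\<not> fm_rank_ge M n m \<phi> k (fibre M n \<chi>' a)" if a: "realizes A a" for a
  proof
    assume "fm_rank_ge M n m \<phi> k (fibre M n \<chi>' a)"
    have at: "a \<in> tuples M n" using a by (rule realizes_tup)
    obtain g where g: "aut_over L M A g" "map (map g) [a] = [e]"
      using morley_conj[OF A, of "[a]" "[e]"] e a by auto
    have aut: "automorphism L M g" and g0: "aut_over L M {} g" using g(1) by (auto simp: aut_over_def)
    have "rank_ge (fibre M n \<phi>) (tuples M m) k (map g ` fibre M n \<chi>' a)"
    proof (rule rank_ge_image[where t = "map g" and Y = "tuples M n"])
      show "map g b \<in> tuples M m \<and> (\<forall>x\<in>tuples M n. (x \<in> fibre M n \<phi> b) = (map g x \<in> fibre M n \<phi> (map g b)))"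
        if "b \<in> tuples M m" for b
        using fibre_aut[OF struct g0 \<phi>] that aut_tup[OF aut] by auto
    qed (use \<open>fm_rank_ge M n m \<phi> k (fibre M n \<chi>' a)\<close> in \<open>auto simp: fm_rank_ge_def fibre_def\<close>)
    moreover have "map g ` fibre M n \<chi>' a \<subseteq> fibre M n \<chi>' e"
    proof
      fix y assume "y \<in> map g ` fibre M n \<chi>' a"
      then obtain x where x: "x \<in> fibre M n \<chi>' a" "y = map g x" by blast
      then have "x \<in> tuples M n" by (simp add: fibre_def)
      then show "y \<in> fibre M n \<chi>' e" using fibre_aut[OF struct g(1) \<chi>'A Au(1) _ at, of x] x g(2) by simp
    qed
    ultimately have "fm_rank_ge M n m \<phi> k (fibre M n \<chi>' e)" unfolding fm_rank_ge_def by (rule rank_ge_mono)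
    then show False using fin d by simp
  qed
  \<comment> \<open>\<open>\<eta>(x, y)\<close> is \<open>\<chi>'(y, x)\<close>.\<close>
  define \<eta> where "\<eta> = swap_vars n n \<chi>'"
  have \<eta>: "\<eta> \<in> formulas L A (n + n)" unfolding \<eta>_def by (rule swap_vars_formulas[OF \<chi>'A])
  have \<eta>_fam: "x \<in> fibre M n \<eta> a \<longleftrightarrow> a \<in> fibre M n \<chi>' x" if "x \<in> tuples M n" "a \<in> tuples M n" for x a
    using that sat_swap_vars[OF \<chi>'A, of a x M] by (auto simp: fibre_def \<eta>_def tuples_def)
  have \<eta>_p: "inst n a \<eta> \<in> p" if a: "realizes A a" for a
  proof (rule ccontr)
    assume "inst n a \<eta> \<notin> p"
    have al: "length a = n" "set a \<subseteq> univ M" "a \<in> tuples M n" using a by (auto simp: realizes_def tuples_def)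
    have "inst n a \<eta> \<in> formulas L (A \<union> set a) n"
      using inst_formulas[of \<eta> L A n a "A \<union> set a"] \<eta> al by simp
    moreover from this have "inst n a \<eta> \<in> formulas L (univ M) n"
      using Au al formulas_mono[of "A \<union> set a" "univ M" n n L] by blast
    ultimately have "Neg (inst n a \<eta>) \<in> over (A \<union> set a)"
      using complete_type_Neg[OF p] \<open>inst n a \<eta> \<notin> p\<close> by (simp add: over_def formulas_def)
    moreover obtain e' where e': "realizes (A \<union> set a) e'"
      using realizes_exists[OF base_extend[OF Au(2) _ al(2)]] by auto
    ultimately have "e' \<in> dset M n (Neg (inst n a \<eta>))" by (simp add: realizes_def)
    then have "e' \<notin> fibre M n \<eta> a" using dset_inst[OF \<eta> al(1), of M] by (simp add: dset_Neg)
    moreover have te': "e' \<in> tuples M n" using e' by (rule realizes_tup)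
    ultimately have "a \<notin> fibre M n \<chi>' e'" using \<eta>_fam[OF te' al(3)] by simp
    moreover have "morley A [a, e']" using a e' by simp
    moreover have "\<chi>' \<in> formulas L (A \<union> set a) (n + n)" using \<chi>'A formulas_mono[of A "A \<union> set a"] by blast
    then have "e' \<in> fibre M n \<chi>' a" by (rule realizes_fam[OF e']) (use al in_p[OF a] in auto)
    ultimately show False using symmetry[OF A \<chi>'A] by blast
  qed
  obtain K where K: "\<And>c as. c \<in> tuples M n \<Longrightarrow> inst n c \<eta> \<in> p \<Longrightarrow> morley A as \<Longrightarrow> length as = K \<Longrightarrow>
      \<exists>a\<in>set as. a \<in> fibre M n \<eta> c"
    using generically_stable[OF A \<eta>] by blast
  obtain es where es: "morley A es" "length es = K" using morley_exists[OF Au(2)] by blast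
  have es_tup: "x \<in> tuples M n" if "x \<in> set es" for x using morley_real[OF es(1) that] by (rule realizes_tup)
  have cover: "\<exists>x\<in>set es. a \<in> fibre M n \<chi>' x" if a: "realizes A a" for a
    using K[OF realizes_tup[OF a] \<eta>_p[OF a] es] \<eta>_fam es_tup realizes_tup[OF a] by blast
  let ?B = "A \<union> elems es"
  have B: "base ?B" using base_extend[OF Au(2) _ morley_elems[OF es(1)]] by simp
  let ?\<Psi> = "(\<lambda>x. Neg (inst n x \<chi>')) ` set es"
  have d': "dset M n (Neg (inst n x \<chi>')) = tuples M n - fibre M n \<chi>' x" if "x \<in> set es" for x
    using dset_inst[OF \<chi>'A, of x M] es_tup[OF that] by (simp add: dset_Neg tuples_def)
  have \<Psi>B: "?\<Psi> \<subseteq> formulas L ?B n"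
  proof
    fix \<psi> assume "\<psi> \<in> ?\<Psi>"
    then obtain x where x: "x \<in> set es" "\<psi> = Neg (inst n x \<chi>')" by blast
    have "inst n x \<chi>' \<in> formulas L ?B n"
      by (rule inst_formulas[of _ _ A]) (use x(1) \<chi>'A es_tup[OF x(1)] in \<open>auto simp: tuples_def\<close>)
    then show "\<psi> \<in> formulas L ?B n" using x(2) by simp
  qed
  obtain \<theta> \<Psi>0 where \<theta>: "\<theta> \<in> over A" "\<Psi>0 \<subseteq> ?\<Psi>" "dset M n \<theta> \<inter> (\<Inter>\<psi>\<in>\<Psi>0. dset M n \<psi>) = {}"
  proof (rule over_compact[OF B Un_upper1 \<Psi>B])
    fix a assume "realizes A a"
    then obtain x where "x \<in> set es" "a \<in> fibre M n \<chi>' x" using cover by blast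
    then show "\<exists>\<psi>\<in>?\<Psi>. a \<notin> dset M n \<psi>" using d' by blast
  qed blast
  have sub: "dset M n \<theta> \<subseteq> (\<Union>x\<in>set es. fibre M n \<chi>' x)"
  proof
    fix y assume y: "y \<in> dset M n \<theta>"
    then obtain \<psi> where "\<psi> \<in> \<Psi>0" "y \<notin> dset M n \<psi>" using \<theta>(3) by blast
    then obtain x where "x \<in> set es" "y \<notin> tuples M n - fibre M n \<chi>' x" using \<theta>(2) d' by blast
    then show "y \<in> (\<Union>x\<in>set es. fibre M n \<chi>' x)" using y by (auto simp: dset_def)
  qed
  obtain l where "\<not> rank_ge (fibre M n \<phi>) (tuples M m) l (\<Union>x\<in>set es. fibre M n \<chi>' x)"
    using rank_ge_finite_UN[of "set es" "fibre M n \<phi>" "tuples M m" k "fibre M n \<chi>'"] small morley_real[OF es(1)]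
    unfolding fm_rank_ge_def by blast
  then have "\<not> fm_rank_ge M n m \<phi> l (dset M n \<theta>)" using sub rank_ge_mono unfolding fm_rank_ge_def by blast
  then show False using unr \<theta>(1) by (auto simp: unranked_def)
qed

lemma unranked_morley:
  assumes "inv_base A" "\<phi> \<in> formulas L {} (n + m)" "unranked m \<phi> A" "morley A as"
  shows "unranked m \<phi> (A \<union> elems as)"
  using assms(4)
proof (induction as rule: rev_induct)
  case Nil
  then show ?case using assms(3) by simp
next
  case (snoc a as)
  then have as: "morley A as" "realizes (A \<union> elems as) a" by (auto simp: morley_append)
  have "inv_base (A \<union> elems as)" using inv_base_extend[OF assms(1) _ morley_elems[OF as(1)]] by simp
  then have "unranked m \<phi> (A \<union> elems as \<union> set a)"
    using unranked_step[OF _ assms(2) snoc.IH[OF as(1)] as(2)] by blast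
  then show ?case by (simp add: Un_ac)
qed

text \<open>If this fails, then it fails over \<open>A\<close> and any Morley sequence over \<open>A\<close>, so the sequence can always be prolonged outside
  the finite rank formula \<open>\<theta> \<in> p\<close>, against generic stability.\<close>

theorem finite_rank_over:
  assumes A: "inv_base A" and \<phi>: "\<phi> \<in> formulas L {} (n + m)"
  shows "\<exists>\<theta>\<in>over A. \<exists>k. \<not> fm_rank_ge M n m \<phi> k (dset M n \<theta>)"
proof (rule ccontr)
  assume "\<not> ?thesis"
  then have unr: "unranked m \<phi> A" by (auto simp: unranked_def)
  have Au: "A \<subseteq> univ M" "base A" using A by (auto simp: inv_base_def base_def)
  from finite_rank[OF \<phi>]
  obtain \<theta> k where \<theta>: "\<theta> \<in> p" "\<not> fm_rank_ge M n m \<phi> k (dset M n \<theta>)" by (elim bexE exE)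
  obtain cs where cs: "set cs = params \<theta>" using finite_list[OF finite_params[of \<theta>]] by (rule exE)
  have csu: "cs \<in> tuples M (length cs)" using cs p_formulas[OF \<theta>(1)] by (auto simp: tuples_def formulas_def)
  have "\<theta> \<in> formulas L ({} \<union> set cs) n" using p_formulas[OF \<theta>(1)] cs by (simp add: formulas_def)
  from parameters_to_variables[OF this, where 'd = 'a]
  obtain \<theta>' where \<theta>': "\<theta>' \<in> formulas L {} (n + length cs)"
    "\<forall>(M :: ('a, 'f, 'r) struct) h xs. length xs = n \<longrightarrow>
       sat M ((!) (xs @ map h cs)) (map_params h \<theta>') \<longleftrightarrow> sat M ((!) xs) (map_params h \<theta>)"
    by (rule bexE)
  have \<theta>'A: "\<theta>' \<in> formulas L A (n + length cs)" using \<theta>'(1) formulas_mono[of "{}" A] by blast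
  have d: "dset M n \<theta> = fibre M n \<theta>' cs"
    using \<theta>'(2)[rule_format, of _ M "\<lambda>c. c"] by (auto simp: dset_def fibre_def fm.map_ident tuples_def)
  have "inst n cs \<theta>' \<in> formulas L (univ M) n"
    by (rule inst_formulas[OF \<theta>'A Au(1)]) (use csu in \<open>simp add: tuples_def\<close>)
  then have cs_p: "inst n cs \<theta>' \<in> p"
    by (intro complete_type_closed[OF p, of "{\<theta>}"]) (use \<theta>(1) dset_inst[OF \<theta>'A refl, of M] d in auto)
  from generically_stable[OF A \<theta>'A]
  obtain K where "\<forall>c\<in>tuples M (length cs). inst n c \<theta>' \<in> p \<longrightarrow>
      (\<forall>as. morley A as \<and> length as = K \<longrightarrow> (\<exists>a\<in>set as. a \<in> fibre M n \<theta>' c))" by (rule exE)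
  from this[rule_format, OF csu cs_p] have K: "\<exists>a\<in>set as. a \<in> dset M n \<theta>"
    if "morley A as" "length as = K" for as using that d by simp
  have "\<exists>as. morley A as \<and> length as = j \<and> (\<forall>a\<in>set as. a \<notin> dset M n \<theta>)" for j
  proof (induction j)
    case (Suc j)
    then obtain as where as: "morley A as" "length as = j" "\<forall>a\<in>set as. a \<notin> dset M n \<theta>" by blast
    have B: "base (A \<union> elems as)" using base_extend[OF Au(2) _ morley_elems[OF as(1)]] by simp
    have "\<exists>a. realizes (A \<union> elems as) a \<and> a \<notin> dset M n \<theta>"
    proof (rule ccontr)
      assume none: "\<not> ?thesis"
      have "{Neg \<theta>} \<subseteq> formulas L (A \<union> elems as \<union> params \<theta>) n"
        using p_formulas[OF \<theta>(1)] by (auto simp: formulas_def)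
      then obtain \<chi> \<Psi>0 where \<chi>: "\<chi> \<in> over (A \<union> elems as)" "\<Psi>0 \<subseteq> {Neg \<theta>}"
        "dset M n \<chi> \<inter> (\<Inter>\<psi>\<in>\<Psi>0. dset M n \<psi>) = {}"
        by (rule over_compact[OF base_params[OF B \<theta>(1)] Un_upper1]) (use none in \<open>auto simp: dset_Neg\<close>)
      have "dset M n \<chi> \<subseteq> dset M n \<theta>"
      proof
        fix y assume y: "y \<in> dset M n \<chi>"
        then have "y \<notin> dset M n (Neg \<theta>)" using \<chi>(2,3) by blast
        then show "y \<in> dset M n \<theta>" using y by (auto simp: dset_def)
      qed
      moreover have "fm_rank_ge M n m \<phi> k (dset M n \<chi>)"
        using unranked_morley[OF A \<phi> unr as(1)] \<chi>(1) by (simp add: unranked_def)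
      ultimately have "fm_rank_ge M n m \<phi> k (dset M n \<theta>)" unfolding fm_rank_ge_def by (metis rank_ge_mono)
      then show False using \<theta>(2) by simp
    qed
    then obtain a where "realizes (A \<union> elems as) a" "a \<notin> dset M n \<theta>" by blast
    then show ?case using as by (intro exI[of _ "as @ [a]"]) (auto simp: morley_append)
  qed simp
  then show False using K by blast
qed

end

section \<open>Cardinality of sets generated by finitary operations\<close>

abbreviation (input) card_le :: "'a set \<Rightarrow> 'b set \<Rightarrow> bool" where
  "card_le A B \<equiv> (card_of A, card_of B) \<in> ordLeq"

lemma card_le_trans: "card_le A B \<Longrightarrow> card_le B C \<Longrightarrow> card_le A C"
  by (rule ordLeq_transitive)

lemma card_le_subset: "A \<subseteq> B \<Longrightarrow> card_le B K \<Longrightarrow> card_le A K"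
  by (rule card_le_trans[OF card_of_mono1])

lemma card_le_image: "card_le A K \<Longrightarrow> card_le (f ` A) K"
  by (rule card_le_trans[OF card_of_image])

lemma card_le_Times: "infinite K \<Longrightarrow> card_le A K \<Longrightarrow> card_le B K \<Longrightarrow> card_le (A \<times> B) K"
  by (rule card_of_Sigma_ordLeq_infinite) auto

lemma card_le_nat: "infinite K \<Longrightarrow> card_le (A :: nat set) K"
  by (rule card_le_subset[OF subset_UNIV]) (use infinite_iff_card_of_nat in blast)

lemma card_le_UN: "infinite K \<Longrightarrow> card_le I K \<Longrightarrow> (\<And>i. i \<in> I \<Longrightarrow> card_le (A i) K) \<Longrightarrow> card_le (\<Union>i\<in>I. A i) K"
  by (rule card_of_UNION_ordLeq_infinite) auto

lemma card_le_Un: "infinite K \<Longrightarrow> card_le A K \<Longrightarrow> card_le B K \<Longrightarrow> card_le (A \<union> B) K"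
  by (rule card_of_Un_ordLeq_infinite_Field) (simp_all add: Field_card_of card_of_Card_order card_of_card_order_on)

lemma card_le_lists:
  assumes K: "infinite K" and S: "card_le S K"
  shows "card_le (lists S) K"
proof -
  have "card_le {xs \<in> lists S. length xs = j} K" for j
  proof (induction j)
    case 0
    have "{xs \<in> lists S. length xs = 0} \<subseteq> (\<lambda>_. []) ` {0 :: nat}" by auto
    then show ?case by (rule card_le_subset) (intro card_le_image card_le_nat K)
  next
    case (Suc j)
    have "{xs \<in> lists S. length xs = Suc j} \<subseteq> (\<lambda>(x, xs). x # xs) ` (S \<times> {xs \<in> lists S. length xs = j})"
    proof
      fix xs assume "xs \<in> {xs \<in> lists S. length xs = Suc j}"
      then obtain y ys where "xs = y # ys" "y \<in> S" "ys \<in> lists S" "length ys = j" by (cases xs) auto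
      then show "xs \<in> (\<lambda>(x, xs). x # xs) ` (S \<times> {xs \<in> lists S. length xs = j})"
        by (intro image_eqI[of _ _ "(y, ys)"]) auto
    qed
    then show ?case by (rule card_le_subset) (intro card_le_image card_le_Times K S Suc)
  qed
  then have "card_le (\<Union>j\<in>UNIV. {xs \<in> lists S. length xs = j}) K"
    by (intro card_le_UN card_le_nat K)
  then show ?thesis by (rule card_le_subset[rotated]) auto
qed

inductive_set hull :: "('o \<Rightarrow> 'h list \<Rightarrow> 'h) \<Rightarrow> 'o set \<Rightarrow> 'h set \<Rightarrow> 'h set"
  for apply_op :: "'o \<Rightarrow> 'h list \<Rightarrow> 'h" and Op :: "'o set" and X :: "'h set" where
  base: "x \<in> X \<Longrightarrow> x \<in> hull apply_op Op X"
| step: "q \<in> Op \<Longrightarrow> (\<forall>x\<in>set xs. x \<in> hull apply_op Op X) \<Longrightarrow> apply_op q xs \<in> hull apply_op Op X"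

fun exec :: "('o \<Rightarrow> 'h list \<Rightarrow> 'h) \<Rightarrow> ('h + 'o \<times> nat) list \<Rightarrow> 'h list \<Rightarrow> 'h list" where
  "exec apply_op [] st = st"
| "exec apply_op (Inl x # prog) st = exec apply_op prog (x # st)"
| "exec apply_op (Inr (q, k) # prog) st = exec apply_op prog (apply_op q (rev (take k st)) # drop k st)"

lemma exec_append: "exec apply_op (p1 @ p2) st = exec apply_op p2 (exec apply_op p1 st)"
  by (induction apply_op p1 st rule: exec.induct) auto

text \<open>An element of the hull is the value of a term. Written in postfix order, the term is a program for a stack machine, and
  programs are lists over a set that is easy to count.\<close>

lemma hull_exec:
  assumes "x \<in> hull apply_op Op X"
  shows "\<exists>prog\<in>lists (Inl ` X \<union> Inr ` (Op \<times> UNIV)). \<forall>st. exec apply_op prog st = x # st"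
  using assms
proof induction
  case (base x)
  then show ?case by (intro bexI[of _ "[Inl x]"]) auto
next
  case (step q xs)
  let ?P = "lists (Inl ` X \<union> Inr ` (Op \<times> UNIV))"
  have "\<exists>prog\<in>?P. \<forall>st. exec apply_op prog st = rev xs @ st"
    using step(2)
  proof (induction xs)
    case Nil
    show ?case by (intro bexI[of _ "[]"]) auto
  next
    case (Cons x xs)
    then obtain p1 p2 where "p1 \<in> ?P" "\<forall>st. exec apply_op p1 st = x # st" "p2 \<in> ?P" "\<forall>st. exec apply_op p2 st = rev xs @ st"
      by auto
    then show ?case by (intro bexI[of _ "p1 @ p2"]) (auto simp: exec_append)
  qed
  then obtain prog where "prog \<in> ?P" "\<forall>st. exec apply_op prog st = rev xs @ st" by blast
  then show ?case using step(1)
    by (intro bexI[of _ "prog @ [Inr (q, length xs)]"]) (auto simp: exec_append)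
qed

lemma card_le_hull:
  assumes K: "infinite K" and "card_le X K" "card_le Op K"
  shows "card_le (hull apply_op Op X) K"
proof -
  let ?P = "lists (Inl ` X \<union> Inr ` (Op \<times> (UNIV :: nat set)))"
  have "hull apply_op Op X \<subseteq> (\<lambda>prog. hd (exec apply_op prog [])) ` ?P"
  proof
    fix x assume "x \<in> hull apply_op Op X"
    from hull_exec[OF this] obtain prog where "prog \<in> ?P" "\<forall>st. exec apply_op prog st = x # st" by blast
    then show "x \<in> (\<lambda>prog. hd (exec apply_op prog [])) ` ?P" by (intro image_eqI[of _ _ prog]) auto
  qed
  moreover have "card_le ?P K"
    by (intro card_le_lists card_le_Un card_le_image card_le_Times card_le_nat K assms)
  ultimately show ?thesis using card_le_subset card_le_image by blast
qed

definition fms :: "('f, 'r) lang \<Rightarrow> 'c set \<Rightarrow> ('f, 'r, 'c) fm set" where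
  "fms L B = {\<phi>. wf_fm L \<phi> \<and> params \<phi> \<subseteq> B}"

lemma card_le_fms:
  fixes L :: "('f, 'r) lang" and B :: "'c set"
  assumes K: "infinite K" and L: "card_le (funs L) K" "card_le (rels L) K" and B: "card_le B K"
  shows "card_le (fms L B) K"
proof -
  define T where "T = {t. wf_tm L t \<and> set2_tm t \<subseteq> B}"
  have "t \<in> hull (\<lambda>(f, k) ts. Fn f ts) (funs L) (range Var \<union> Par ` B)" if "t \<in> T" for t
    using that unfolding T_def
  proof (induction t)
    case (Fn f ts)
    then have "(\<lambda>(f, k) ts. Fn f ts) (f, length ts) ts \<in> hull (\<lambda>(f, k) ts. Fn f ts) (funs L) (range Var \<union> Par ` B)"
      by (intro hull.step) auto
    then show ?case by simp
  qed (auto intro: hull.base)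
  then have "T \<subseteq> hull (\<lambda>(f, k) ts. Fn f ts) (funs L) (range Var \<union> Par ` B)" by blast
  then have T: "card_le T K"
    by (rule card_le_subset) (intro card_le_hull card_le_Un card_le_image card_le_nat K L B)
  define X where "X = (\<lambda>_. Fls) ` {0 :: nat} \<union> (\<lambda>(t, u). Equ t u) ` (T \<times> T)
    \<union> (\<lambda>((r, k), ts). Rel r ts) ` (rels L \<times> lists T)"
  define apply_op :: "nat option \<Rightarrow> ('f, 'r, 'c) fm list \<Rightarrow> ('f, 'r, 'c) fm" where
    "apply_op q xs = (case q of None \<Rightarrow> Imp (xs ! 0) (xs ! 1) | Some k \<Rightarrow> Forall k (xs ! 0))" for q xs
  have "\<phi> \<in> hull apply_op UNIV X" if "\<phi> \<in> fms L B" for \<phi>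
    using that unfolding fms_def
  proof (induction \<phi>)
    case Fls
    show ?case by (rule hull.base) (simp add: X_def)
  next
    case (Equ t u)
    then have "(t, u) \<in> T \<times> T" by (auto simp: T_def)
    then show ?case unfolding X_def by (intro hull.base UnI1 UnI2) (rule image_eqI[of _ _ "(t, u)"], auto)
  next
    case (Rel r ts)
    then have "((r, length ts), ts) \<in> rels L \<times> lists T" by (auto simp: T_def)
    then show ?case unfolding X_def by (intro hull.base UnI2) (rule image_eqI[of _ _ "((r, length ts), ts)"], auto)
  next
    case (Imp \<phi> \<psi>)
    then have "apply_op None [\<phi>, \<psi>] \<in> hull apply_op UNIV X" by (intro hull.step) auto
    moreover have "apply_op None [\<phi>, \<psi>] = Imp \<phi> \<psi>" by (simp add: apply_op_def)
    ultimately show ?case by simp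
  next
    case (Forall k \<phi>)
    then have "apply_op (Some k) [\<phi>] \<in> hull apply_op UNIV X" by (intro hull.step) auto
    moreover have "apply_op (Some k) [\<phi>] = Forall k \<phi>" by (simp add: apply_op_def)
    ultimately show ?case by simp
  qed
  then have sub: "fms L B \<subseteq> hull apply_op UNIV X" by blast
  have "(UNIV :: nat option set) \<subseteq> (\<lambda>_. None) ` {0 :: nat} \<union> range Some"
  proof
    fix x :: "nat option"
    show "x \<in> (\<lambda>_. None) ` {0 :: nat} \<union> range Some" by (cases x) auto
  qed
  then have "card_le (UNIV :: nat option set) K"
    by (rule card_le_subset) (intro card_le_Un card_le_image card_le_nat K)
  moreover have "card_le X K"
    unfolding X_def by (intro card_le_Un card_le_image card_le_Times card_le_nat card_le_lists K T L)
  ultimately have "card_le (hull apply_op UNIV X) K" by (intro card_le_hull K)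
  then show ?thesis by (rule card_le_subset[OF sub])
qed

text \<open>Otherwise saturation would realize the type of an element different from all elements.\<close>

lemma monster_not_small:
  fixes L :: "('f, 'r) lang" and M :: "('a, 'f, 'r) struct"
  assumes M: "monster L \<kappa> M" and inf: "infinite (univ M)"
  shows "\<not> small \<kappa> (univ M)"
proof
  assume small: "small \<kappa> (univ M)"
  let ?\<phi> = "\<lambda>c. Neg (Equ (Var 0) (Par c)) :: ('f, 'r, 'a) fm"
  have d: "dset M 1 (?\<phi> c) = tuples M 1 - {[c]}" for c
    by (auto simp: dset_def tuples_def length_Suc_conv)
  have "\<exists>xs\<in>tuples M 1. \<forall>\<phi>\<in>?\<phi> ` univ M. xs \<in> dset M 1 \<phi>"
  proof (rule saturation[OF M order_refl small])
    show "?\<phi> ` univ M \<subseteq> formulas L (univ M) 1" by (auto simp: formulas_def)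
    fix \<Phi>0 :: "('f, 'r, 'a) fm set" assume "finite \<Phi>0" "\<Phi>0 \<subseteq> ?\<phi> ` univ M"
    then obtain F where F: "F \<subseteq> univ M" "finite F" "\<Phi>0 = ?\<phi> ` F" by (meson finite_subset_image)
    obtain a where "a \<in> univ M" "a \<notin> F" using inf F(2) by (meson finite_subset subsetI)
    then show "\<exists>xs\<in>tuples M 1. \<forall>\<phi>\<in>\<Phi>0. xs \<in> dset M 1 \<phi>"
      unfolding F(3) ball_simps(9) d by (intro bexI[of _ "[a]"]) (auto simp: tuples_def)
  qed
  then obtain xs where xs: "xs \<in> tuples M 1" "\<forall>c\<in>univ M. xs \<noteq> [c]" unfolding ball_simps(9) d by blast
  then obtain c where "xs = [c]" "c \<in> univ M" by (auto simp: tuples_def length_Suc_conv)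
  then show False using xs(2) by blast
qed

lemma small_card_le:
  assumes M: "monster L \<kappa> M" and inf: "infinite (univ M)" and F: "small \<kappa> F"
  shows "card_le F (univ M)"
proof -
  have "Card_order \<kappa>" using M by (simp add: monster_def)
  then have "Well_order \<kappa>" by (rule card_order_on_well_order_on)
  then have "(\<kappa>, card_of (univ M)) \<in> ordLeq"
    using monster_not_small[OF M inf] not_ordLess_iff_ordLeq[of \<kappa> "card_of (univ M)"]
    by (simp add: small_def card_of_Well_order)
  then show ?thesis using F ordLess_imp_ordLeq ordLeq_transitive unfolding small_def by blast
qed

section \<open>Small ultraproducts\<close>

lemma finite_fv: "finite (fv \<phi>)"
proof (induction \<phi>)
  have tm: "finite (vars_tm t)" for t :: "('a, 'c) tm" by (induction t) auto
  case (Equ t u)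
  then show ?case using tm by auto
next
  have tm: "finite (vars_tm t)" for t :: "('a, 'c) tm" by (induction t) auto
  case (Rel r ts)
  then show ?case using tm by auto
qed auto

text \<open>The Skolem hull, in the ultrapower of \<open>M\<close> by \<open>U\<close>, of \<open>M\<close> and the classes of the functions in \<open>X\<close>. It is formed on the level
  of functions \<open>'i \<Rightarrow> 'a\<close>, where it has at most as many elements as \<open>M\<close>. Hence the quotient can be coded
  in any type \<open>'u\<close> that is at least as large as \<open>M\<close>.\<close>

locale small_ultraproduct =
  fixes L :: "('f, 'r) lang" and M :: "('a, 'f, 'r) struct" and U :: "'i set set"
    and X :: "('i \<Rightarrow> 'a) set" and ty :: "'u itself"
  assumes struct: "is_struct L M" and U: "ultra U"
    and X: "\<And>F i. F \<in> X \<Longrightarrow> F i \<in> univ M"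
    and inf: "infinite (univ M)" and card_u: "card_le (univ M) (UNIV :: 'u set)"
    and card: "card_le (funs L) (univ M)" "card_le (rels L) (univ M)" "card_le X (univ M)"
begin

definition clamp :: "'a \<Rightarrow> 'a" where
  "clamp a = (if a \<in> univ M then a else (SOME a. a \<in> univ M))"

lemma clamp_univ: "clamp a \<in> univ M"
proof -
  have "(SOME a. a \<in> univ M) \<in> univ M" using struct by (intro some_in_eq[THEN iffD2]) (simp add: is_struct_def)
  then show ?thesis by (simp add: clamp_def)
qed

text \<open>The operation \<open>Inl (\<phi>, k)\<close> picks, at every index separately, a counterexample to \<open>\<forall>v\<^sub>k. \<phi>\<close> if there is one; this
  is what the universal quantifier needs in Los's theorem.\<close>

definition apply_op :: "('f, 'r, 'a) fm \<times> nat + 'f \<Rightarrow> ('i \<Rightarrow> 'a) list \<Rightarrow> 'i \<Rightarrow> 'a" where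
  "apply_op q Fs i = clamp (case q of
     Inl (\<phi>, k) \<Rightarrow> SOME a. a \<in> univ M \<and> \<not> sat M ((\<lambda>v. (Fs ! v) i)(k := a)) \<phi>
   | Inr f \<Rightarrow> intf M f (map (\<lambda>F. F i) Fs))"

definition H :: "('i \<Rightarrow> 'a) set" where
  "H = hull apply_op (Inl ` (fms L (univ M) \<times> UNIV) \<union> Inr ` fst ` funs L) ((\<lambda>a _. a) ` univ M \<union> X)"

lemma H_univ: "F \<in> H \<Longrightarrow> F i \<in> univ M"
  unfolding H_def by (induction rule: hull.induct) (auto simp: X apply_op_def clamp_univ)

lemma H_const: "a \<in> univ M \<Longrightarrow> (\<lambda>_. a) \<in> H"
  unfolding H_def by (rule hull.base) blast

lemma H_X: "F \<in> X \<Longrightarrow> F \<in> H"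
  unfolding H_def by (rule hull.base) blast

lemma H_fun: "(f, k) \<in> funs L \<Longrightarrow> set Fs \<subseteq> H \<Longrightarrow> (\<lambda>i. clamp (intf M f (map (\<lambda>F. F i) Fs))) \<in> H"
proof -
  assume f: "(f, k) \<in> funs L" and Fs: "set Fs \<subseteq> H"
  have "Inr f \<in> Inr ` fst ` funs L" using f by force
  then have "apply_op (Inr f) Fs \<in> H" unfolding H_def by (intro hull.step) (use Fs in \<open>auto simp: H_def\<close>)
  then show ?thesis by (simp add: apply_op_def[abs_def])
qed

lemma H_witness:
  assumes "\<phi> \<in> fms L (univ M)" "set Fs \<subseteq> H"
  shows "\<exists>F\<in>H. \<forall>i. \<forall>a\<in>univ M. \<not> sat M ((\<lambda>v. (Fs ! v) i)(k := a)) \<phi> \<longrightarrow>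
    \<not> sat M ((\<lambda>v. (Fs ! v) i)(k := F i)) \<phi>"
proof (intro bexI allI ballI impI)
  show "apply_op (Inl (\<phi>, k)) Fs \<in> H"
    unfolding H_def by (intro hull.step) (use assms in \<open>auto simp: H_def\<close>)
  fix i a assume "a \<in> univ M" "\<not> sat M ((\<lambda>v. (Fs ! v) i)(k := a)) \<phi>"
  then have "(SOME a. a \<in> univ M \<and> \<not> sat M ((\<lambda>v. (Fs ! v) i)(k := a)) \<phi>) \<in> univ M \<and>
      \<not> sat M ((\<lambda>v. (Fs ! v) i)(k := SOME a. a \<in> univ M \<and> \<not> sat M ((\<lambda>v. (Fs ! v) i)(k := a)) \<phi>)) \<phi>"
    by (intro someI[of "\<lambda>a. a \<in> univ M \<and> \<not> sat M ((\<lambda>v. (Fs ! v) i)(k := a)) \<phi>" a]) simp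
  then show "\<not> sat M ((\<lambda>v. (Fs ! v) i)(k := apply_op (Inl (\<phi>, k)) Fs i)) \<phi>" by (simp add: apply_op_def clamp_def)
qed

lemma H_card: "card_le H (UNIV :: 'u set)"
proof -
  have "card_le H (univ M)"
    unfolding H_def
    by (intro card_le_hull card_le_Un card_le_image card_le_Times card_le_fms card_le_nat inf card card_of_mono1) simp_all
  then show ?thesis using card_u by (rule card_le_trans)
qed

definition code :: "('i \<Rightarrow> 'a) \<Rightarrow> 'u" where
  "code = (SOME \<iota>. inj_on \<iota> H)"

lemma inj_code: "inj_on code H"
proof -
  have "\<exists>\<iota> :: ('i \<Rightarrow> 'a) \<Rightarrow> 'u. inj_on \<iota> H" using H_card card_of_ordLeq[of H "UNIV :: 'u set"] by auto
  then show ?thesis unfolding code_def by (rule someI_ex)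
qed

definition ae :: "('i \<Rightarrow> 'a) \<Rightarrow> ('i \<Rightarrow> 'a) \<Rightarrow> bool" where
  "ae F G \<longleftrightarrow> {i. F i = G i} \<in> U"

lemma ae_refl: "ae F F"
proof -
  have "UNIV \<in> U" using U ultra_Compl[OF U, of "{}"] by (auto simp: ultra_def)
  then show ?thesis by (simp add: ae_def)
qed

lemma ae_sym: "ae F G \<Longrightarrow> ae G F"
  by (simp add: ae_def eq_commute)

lemma ae_trans: "ae F G \<Longrightarrow> ae G K \<Longrightarrow> ae F K"
  unfolding ae_def by (rule ultra_mono[OF U ultra_Int[OF U, of "{i. F i = G i}" "{i. G i = K i}"]]) auto

text \<open>A canonical representative of the class of \<open>F\<close> inside the hull.\<close>

definition nf :: "('i \<Rightarrow> 'a) \<Rightarrow> 'i \<Rightarrow> 'a" where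
  "nf F = (SOME G. G \<in> H \<and> ae F G)"

lemma nf: "F \<in> H \<Longrightarrow> nf F \<in> H \<and> ae F (nf F)"
  unfolding nf_def by (rule someI[of _ F]) (simp add: ae_refl)

lemma nf_eq: "ae F G \<Longrightarrow> nf F = nf G"
  unfolding nf_def by (metis ae_sym ae_trans)

definition cls :: "('i \<Rightarrow> 'a) \<Rightarrow> 'u" where
  "cls F = code (nf F)"

definition rep :: "'u \<Rightarrow> 'i \<Rightarrow> 'a" where
  "rep = inv_into H code"

definition N :: "('u, 'f, 'r) struct" where
  "N = \<lparr>univ = cls ` H, intf = (\<lambda>f us. cls (\<lambda>i. clamp (intf M f (map (\<lambda>u. rep u i) us)))),
        intr = (\<lambda>r us. {i. intr M r (map (\<lambda>u. rep u i) us)} \<in> U)\<rparr>"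

definition emb :: "'a \<Rightarrow> 'u" where
  "emb a = cls (\<lambda>_. a)"

lemma rep_cls: "F \<in> H \<Longrightarrow> rep (cls F) = nf F"
  using nf inj_code by (simp add: rep_def cls_def)

lemma rep_cls_ae: "F \<in> H \<Longrightarrow> ae (rep (cls F)) F"
  using nf ae_sym rep_cls by metis

lemma rep_H: "u \<in> univ N \<Longrightarrow> rep u \<in> H"
  using rep_cls nf by (auto simp: N_def)

lemma cls_rep: "u \<in> univ N \<Longrightarrow> cls (rep u) = u"
proof -
  assume "u \<in> univ N"
  then obtain F where "F \<in> H" "u = cls F" by (auto simp: N_def)
  then show ?thesis using nf_eq[OF ae_sym, of F "nf F"] nf[of F] rep_cls[of F] by (simp add: cls_def)
qed

lemma eq_iff_ae:
  assumes "u \<in> univ N" "w \<in> univ N"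
  shows "u = w \<longleftrightarrow> ae (rep u) (rep w)"
proof
  assume "ae (rep u) (rep w)"
  then have "cls (rep u) = cls (rep w)" using nf_eq by (simp add: cls_def)
  then show "u = w" using cls_rep assms by simp
qed (simp add: ae_refl)

lemma cls_univ: "F \<in> H \<Longrightarrow> cls F \<in> univ N"
  by (simp add: N_def)

lemma struct_N: "is_struct L N"
proof -
  obtain a where "a \<in> univ M" using struct by (auto simp: is_struct_def)
  then have "univ N \<noteq> {}" using H_const cls_univ by blast
  moreover have "intf N f us \<in> univ N" if "(f, k) \<in> funs L" "set us \<subseteq> univ N" for f k us
  proof -
    have "set (map rep us) \<subseteq> H" using that(2) rep_H by auto
    from H_fun[OF that(1) this] have "cls (\<lambda>i. clamp (intf M f (map (\<lambda>u. rep u i) us))) \<in> univ N"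
      by (intro cls_univ) (simp add: o_def)
    then show ?thesis by (simp add: N_def)
  qed
  ultimately show ?thesis unfolding is_struct_def by auto
qed

lemma ultra_all:
  assumes "finite I" "\<And>j. j \<in> I \<Longrightarrow> {i. P j i} \<in> U"
  shows "{i. \<forall>j\<in>I. P j i} \<in> U"
  using assms
proof (induction I)
  case empty
  then show ?case using ae_refl[of undefined] by (simp add: ae_def)
next
  case (insert j I)
  then have "{i. P j i} \<inter> {i. \<forall>j\<in>I. P j i} \<in> U" by (intro ultra_Int[OF U]) auto
  then show ?case by (rule ultra_mono[OF U]) auto
qed

lemma los_tm:
  assumes s: "\<And>v. s v \<in> univ N"
  shows "wf_tm L t \<Longrightarrow> set2_tm t \<subseteq> univ M \<Longrightarrow> val N s (map_tm (\<lambda>f. f) emb t) \<in> univ N \<and>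
    ae (rep (val N s (map_tm (\<lambda>f. f) emb t))) (\<lambda>i. val M (\<lambda>v. rep (s v) i) t)"
proof (induction t)
  case (Var v)
  then show ?case using s ae_refl by simp
next
  case (Par c)
  then show ?case using H_const cls_univ rep_cls_ae by (simp add: emb_def)
next
  case (Fn f ts)
  let ?us = "map (\<lambda>t. val N s (map_tm (\<lambda>f. f) emb t)) ts"
  let ?F = "\<lambda>i. clamp (intf M f (map (\<lambda>u. rep u i) ?us))"
  have us: "set ?us \<subseteq> univ N" using Fn by auto
  have v: "val N s (map_tm (\<lambda>f. f) emb (Fn f ts)) = cls ?F" by (simp add: N_def o_def)
  have "set (map rep ?us) \<subseteq> H" using us rep_H by auto
  from H_fun[OF _ this, of f "length ts"] have F: "?F \<in> H" using Fn.prems by (simp add: o_def)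
  have "{i. \<forall>t\<in>set ts. rep (val N s (map_tm (\<lambda>f. f) emb t)) i = val M (\<lambda>v. rep (s v) i) t} \<in> U"
    by (rule ultra_all) (use Fn in \<open>auto simp: ae_def\<close>)
  then have "ae ?F (\<lambda>i. val M (\<lambda>v. rep (s v) i) (Fn f ts))"
    unfolding ae_def
  proof (rule ultra_mono[OF U], intro subsetI CollectI)
    fix i assume "i \<in> {i. \<forall>t\<in>set ts. rep (val N s (map_tm (\<lambda>f. f) emb t)) i = val M (\<lambda>v. rep (s v) i) t}"
    then have "map (\<lambda>u. rep u i) ?us = map (val M (\<lambda>v. rep (s v) i)) ts" by simp
    moreover have "val M (\<lambda>v. rep (s v) i) (Fn f ts) \<in> univ M"
      by (rule val_univ[OF struct _ Fn.prems]) (use s rep_H H_univ in \<open>auto simp: valuations_def\<close>)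
    ultimately show "?F i = val M (\<lambda>v. rep (s v) i) (Fn f ts)" by (simp add: clamp_def del: map_map)
  qed
  then show ?case unfolding v using rep_cls_ae[OF F] cls_univ[OF F] ae_trans by blast
qed

text \<open>Los's theorem, for formulas with parameters from \<open>M\<close>. The nontrivial case is a universal formula that fails on a set
  of indices in \<open>U\<close>: the hull contains a function picking counterexamples on this set.\<close>

theorem los:
  "\<phi> \<in> fms L (univ M) \<Longrightarrow> (\<And>v. s v \<in> univ N) \<Longrightarrow>
    sat N s (map_params emb \<phi>) \<longleftrightarrow> {i. sat M (\<lambda>v. rep (s v) i) \<phi>} \<in> U"
proof (induction \<phi> arbitrary: s)
  case Fls
  then show ?case using U by (simp add: ultra_def)
next
  case (Equ t u)
  let ?t = "val N s (map_tm (\<lambda>f. f) emb t)" and ?u = "val N s (map_tm (\<lambda>f. f) emb u)"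
  have t: "?t \<in> univ N" "ae (rep ?t) (\<lambda>i. val M (\<lambda>v. rep (s v) i) t)"
    and u: "?u \<in> univ N" "ae (rep ?u) (\<lambda>i. val M (\<lambda>v. rep (s v) i) u)"
    using los_tm[of s t] los_tm[of s u] Equ by (auto simp: fms_def)
  have "?t = ?u \<longleftrightarrow> ae (rep ?t) (rep ?u)"
    by (rule eq_iff_ae[OF t(1) u(1)])
  also have "\<dots> \<longleftrightarrow> ae (\<lambda>i. val M (\<lambda>v. rep (s v) i) t) (\<lambda>i. val M (\<lambda>v. rep (s v) i) u)"
    using ae_trans[OF ae_sym[OF t(2)] ae_trans[OF _ u(2)]] ae_trans[OF t(2) ae_trans[OF _ ae_sym[OF u(2)]]]
    by (rule iffI)
  finally show ?case by (simp add: ae_def)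
next
  case (Rel r ts)
  let ?us = "map (\<lambda>t. val N s (map_tm (\<lambda>f. f) emb t)) ts"
  let ?Z = "{i. \<forall>t\<in>set ts. rep (val N s (map_tm (\<lambda>f. f) emb t)) i = val M (\<lambda>v. rep (s v) i) t}"
  have Z: "?Z \<in> U"
  proof (rule ultra_all)
    fix t assume "t \<in> set ts"
    then have "wf_tm L t" "set2_tm t \<subseteq> univ M" using Rel.prems(1) by (auto simp: fms_def)
    then show "{i. rep (val N s (map_tm (\<lambda>f. f) emb t)) i = val M (\<lambda>v. rep (s v) i) t} \<in> U"
      using los_tm[OF Rel.prems(2)] by (simp add: ae_def)
  qed simp
  have eq: "map (\<lambda>u. rep u i) ?us = map (val M (\<lambda>v. rep (s v) i)) ts" if "i \<in> ?Z" for i using that by simp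
  have "sat N s (map_params emb (Rel r ts)) \<longleftrightarrow> {i. intr M r (map (\<lambda>u. rep u i) ?us)} \<in> U"
    by (simp add: N_def o_def)
  also have "\<dots> \<longleftrightarrow> {i. sat M (\<lambda>v. rep (s v) i) (Rel r ts)} \<in> U"
  proof
    assume "{i. intr M r (map (\<lambda>u. rep u i) ?us)} \<in> U"
    from ultra_Int[OF U this Z] show "{i. sat M (\<lambda>v. rep (s v) i) (Rel r ts)} \<in> U"
      by (rule ultra_mono[OF U]) (use eq in \<open>auto simp del: map_map\<close>)
  next
    assume "{i. sat M (\<lambda>v. rep (s v) i) (Rel r ts)} \<in> U"
    from ultra_Int[OF U this Z] show "{i. intr M r (map (\<lambda>u. rep u i) ?us)} \<in> U"
      by (rule ultra_mono[OF U]) (use eq in \<open>auto simp del: map_map\<close>)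
  qed
  finally show ?case .
next
  case (Imp \<phi> \<psi>)
  let ?A = "{i. sat M (\<lambda>v. rep (s v) i) \<phi>}" and ?B = "{i. sat M (\<lambda>v. rep (s v) i) \<psi>}"
  have IH: "sat N s (map_params emb \<phi>) \<longleftrightarrow> ?A \<in> U" "sat N s (map_params emb \<psi>) \<longleftrightarrow> ?B \<in> U"
    using Imp by (auto simp: fms_def)
  have "{i. sat M (\<lambda>v. rep (s v) i) (Imp \<phi> \<psi>)} = - ?A \<union> ?B" by auto
  moreover have "- ?A \<union> ?B \<in> U \<longleftrightarrow> (?A \<in> U \<longrightarrow> ?B \<in> U)"
  proof
    assume *: "- ?A \<union> ?B \<in> U"
    show "?A \<in> U \<longrightarrow> ?B \<in> U"
    proof
      assume "?A \<in> U"
      from ultra_Int[OF U * this] show "?B \<in> U" by (rule ultra_mono[OF U]) auto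
    qed
  next
    assume *: "?A \<in> U \<longrightarrow> ?B \<in> U"
    show "- ?A \<union> ?B \<in> U"
    proof (cases "?A \<in> U")
      case True
      with * have "?B \<in> U" by simp
      then show ?thesis by (rule ultra_mono[OF U]) auto
    next
      case False
      then have "- ?A \<in> U" using ultra_Compl[OF U] by simp
      then show ?thesis by (rule ultra_mono[OF U]) auto
    qed
  qed
  ultimately show ?case using IH by simp
next
  case (Forall k \<phi>)
  have \<phi>: "\<phi> \<in> fms L (univ M)" using Forall.prems by (simp add: fms_def)
  have IH: "sat N (s(k := u)) (map_params emb \<phi>) \<longleftrightarrow> {i. sat M ((\<lambda>v. rep (s v) i)(k := rep u i)) \<phi>} \<in> U"
    if "u \<in> univ N" for u
  proof -
    have "(\<lambda>v. rep ((s(k := u)) v) i) = (\<lambda>v. rep (s v) i)(k := rep u i)" for i by (auto simp: fun_eq_iff)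
    moreover have "(s(k := u)) v \<in> univ N" for v using Forall.prems(2) that by simp
    ultimately show ?thesis using Forall.IH[OF \<phi>, of "s(k := u)"] by (simp only:)
  qed
  let ?Z = "{i. \<forall>a\<in>univ M. sat M ((\<lambda>v. rep (s v) i)(k := a)) \<phi>}"
  have "(\<forall>u\<in>univ N. sat N (s(k := u)) (map_params emb \<phi>)) \<longleftrightarrow> ?Z \<in> U"
  proof
    assume Z: "?Z \<in> U"
    show "\<forall>u\<in>univ N. sat N (s(k := u)) (map_params emb \<phi>)"
    proof
      fix u assume u: "u \<in> univ N"
      from Z have "{i. sat M ((\<lambda>v. rep (s v) i)(k := rep u i)) \<phi>} \<in> U"
        by (rule ultra_mono[OF U]) (use H_univ[OF rep_H[OF u]] in auto)
      then show "sat N (s(k := u)) (map_params emb \<phi>)" using IH[OF u] by simp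
    qed
  next
    assume all: "\<forall>u\<in>univ N. sat N (s(k := u)) (map_params emb \<phi>)"
    have "\<exists>b. \<forall>v\<in>fv \<phi>. v < b" using finite_fv[of \<phi>] by (simp add: finite_nat_set_iff_bounded)
    then obtain b where b: "\<forall>v\<in>fv \<phi>. v < b" by (rule exE)
    let ?Fs = "map (\<lambda>v. rep (s v)) [0..<b]"
    have "set ?Fs \<subseteq> H" using Forall.prems(2) rep_H by auto
    from H_witness[OF \<phi> this, of k]
    obtain F where F: "F \<in> H" "\<forall>i. \<forall>a\<in>univ M. \<not> sat M ((\<lambda>v. (?Fs ! v) i)(k := a)) \<phi> \<longrightarrow>
        \<not> sat M ((\<lambda>v. (?Fs ! v) i)(k := F i)) \<phi>" by (elim bexE)
    have c: "sat M ((\<lambda>v. (?Fs ! v) i)(k := a)) \<phi> \<longleftrightarrow> sat M ((\<lambda>v. rep (s v) i)(k := a)) \<phi>" for i a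
      by (rule sat_cong) (use b in auto)
    have "sat N (s(k := cls F)) (map_params emb \<phi>)" using all cls_univ[OF F(1)] by blast
    then have "{i. sat M ((\<lambda>v. rep (s v) i)(k := rep (cls F) i)) \<phi>} \<in> U"
      using IH[OF cls_univ[OF F(1)]] by simp
    from ultra_Int[OF U this rep_cls_ae[OF F(1), unfolded ae_def]]
    show "?Z \<in> U"
    proof (rule ultra_mono[OF U], intro subsetI CollectI ballI)
      fix i a assume i: "i \<in> {i. sat M ((\<lambda>v. rep (s v) i)(k := rep (cls F) i)) \<phi>} \<inter> {i. rep (cls F) i = F i}"
        and a: "a \<in> univ M"
      then have "rep (cls F) i = F i" "sat M ((\<lambda>v. rep (s v) i)(k := rep (cls F) i)) \<phi>" by auto
      then have "sat M ((\<lambda>v. rep (s v) i)(k := F i)) \<phi>" by metis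
      then show "sat M ((\<lambda>v. rep (s v) i)(k := a)) \<phi>" using F(2)[rule_format, OF a, of i] unfolding c by blast
    qed
  qed
  then show ?case by simp
qed

lemma los_list:
  assumes \<phi>: "\<phi> \<in> formulas L (univ M) (length Fs)" and Fs: "set Fs \<subseteq> H"
  shows "sat N ((!) (map cls Fs)) (map_params emb \<phi>) \<longleftrightarrow> {i. sat M ((!) (map (\<lambda>F. F i) Fs)) \<phi>} \<in> U"
proof -
  obtain a where "a \<in> univ M" using struct by (auto simp: is_struct_def)
  define s where "s v = (if v < length Fs then cls (Fs ! v) else cls (\<lambda>_. a))" for v
  have s: "s v \<in> univ N" for v using Fs H_const[OF \<open>a \<in> univ M\<close>] cls_univ by (simp add: s_def subset_iff)
  let ?Z = "{i. \<forall>v\<in>{..<length Fs}. rep (s v) i = (Fs ! v) i}"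
  have Z: "?Z \<in> U"
  proof (rule ultra_all)
    fix v assume "v \<in> {..<length Fs}"
    then have "Fs ! v \<in> H" "s v = cls (Fs ! v)" using Fs by (auto simp: s_def)
    then show "{i. rep (s v) i = (Fs ! v) i} \<in> U" using rep_cls_ae by (simp add: ae_def)
  qed simp
  have eq: "sat M (\<lambda>v. rep (s v) i) \<phi> \<longleftrightarrow> sat M ((!) (map (\<lambda>F. F i) Fs)) \<phi>" if "i \<in> ?Z" for i
    by (rule sat_formulas_cong[OF \<phi>]) (use that in auto)
  have "map_params emb \<phi> \<in> formulas L (emb ` univ M) (length Fs)" by (rule map_params_formulas[OF \<phi>])
  then have "sat N ((!) (map cls Fs)) (map_params emb \<phi>) \<longleftrightarrow> sat N s (map_params emb \<phi>)"
    by (rule sat_formulas_cong) (simp add: s_def)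
  also have "\<dots> \<longleftrightarrow> {i. sat M (\<lambda>v. rep (s v) i) \<phi>} \<in> U"
    using \<phi> s by (intro los) (auto simp: fms_def formulas_def)
  also have "\<dots> \<longleftrightarrow> {i. sat M ((!) (map (\<lambda>F. F i) Fs)) \<phi>} \<in> U"
  proof
    assume "{i. sat M (\<lambda>v. rep (s v) i) \<phi>} \<in> U"
    from ultra_Int[OF U this Z] show "{i. sat M ((!) (map (\<lambda>F. F i) Fs)) \<phi>} \<in> U"
      by (rule ultra_mono[OF U]) (use eq in blast)
  next
    assume "{i. sat M ((!) (map (\<lambda>F. F i) Fs)) \<phi>} \<in> U"
    from ultra_Int[OF U this Z] show "{i. sat M (\<lambda>v. rep (s v) i) \<phi>} \<in> U"
      by (rule ultra_mono[OF U]) (use eq in blast)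
  qed
  finally show ?thesis .
qed

lemma emb_univ: "emb ` univ M \<subseteq> univ N"
  using H_const cls_univ by (auto simp: emb_def)

lemma elementary_emb: "elementary_map L M N (univ M) emb"
  unfolding elementary_map_def
proof (intro conjI ballI)
  fix \<sigma> assume \<sigma>: "\<sigma> \<in> sentences L (univ M)"
  have "map_params emb \<sigma> \<in> sentences L (emb ` univ M)" by (rule map_params_formulas[OF \<sigma>])
  then have "models N (map_params emb \<sigma>) \<longleftrightarrow> sat N ((!) (map cls [])) (map_params emb \<sigma>)"
    by (rule models_sentence[OF struct_N])
  also have "\<dots> \<longleftrightarrow> {i :: 'i. sat M ((!) []) \<sigma>} \<in> U" using los_list[of \<sigma> "[]"] \<sigma> by simp
  also have "\<dots> \<longleftrightarrow> sat M ((!) []) \<sigma>" using U ae_refl[of undefined] by (simp add: ultra_def ae_def)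
  also have "\<dots> \<longleftrightarrow> models M \<sigma>" using models_sentence[OF struct \<sigma>] by simp
  finally show "models M \<sigma> \<longleftrightarrow> models N (map_params emb \<sigma>)" by simp
qed (use emb_univ in auto)

end

section \<open>A stable type over the monster model has finite rank\<close>

text \<open>\<open>k\<close> applications of \<open>rank_ge_same_colour\<close>: the colour of \<open>c\<close> is the set of formulas of \<open>\<Delta>\<close> true of \<open>c\<close> and the
  pairs chosen before. There are \<open>2 ^ |\<Delta>|\<close> colours, and each pair costs one level more than that.\<close>

lemma same_type_pairs:
  assumes "finite \<Delta>" "fm_rank_ge M n m \<phi> (r + k * Suc (card (Pow \<Delta>))) X"
  shows "\<exists>b. (\<forall>i<k. fst (b i) \<in> tuples M m \<and> snd (b i) \<in> tuples M m \<and>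
       (\<forall>\<psi>\<in>\<Delta>. sat M ((!) (fst (b i) @ concat (map (\<lambda>j. fst (b j) @ snd (b j)) [0..<i]))) \<psi> \<longleftrightarrow>
          sat M ((!) (snd (b i) @ concat (map (\<lambda>j. fst (b j) @ snd (b j)) [0..<i]))) \<psi>)) \<and>
     fm_rank_ge M n m \<phi> r {x \<in> X. \<forall>i<k. x \<in> fibre M n \<phi> (fst (b i)) \<and> x \<notin> fibre M n \<phi> (snd (b i))}"
  using assms(2)
proof (induction k arbitrary: r)
  case 0
  then show ?case by simp
next
  case (Suc k)
  let ?K = "Suc (card (Pow \<Delta>))"
  have "fm_rank_ge M n m \<phi> ((r + ?K) + k * ?K) X" using Suc.prems by (simp add: algebra_simps)
  from Suc.IH[OF this] obtain b where
    b: "\<forall>i<k. fst (b i) \<in> tuples M m \<and> snd (b i) \<in> tuples M m \<and>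
       (\<forall>\<psi>\<in>\<Delta>. sat M ((!) (fst (b i) @ concat (map (\<lambda>j. fst (b j) @ snd (b j)) [0..<i]))) \<psi> \<longleftrightarrow>
          sat M ((!) (snd (b i) @ concat (map (\<lambda>j. fst (b j) @ snd (b j)) [0..<i]))) \<psi>)"
    and rank: "fm_rank_ge M n m \<phi> (r + ?K) {x \<in> X. \<forall>i<k. x \<in> fibre M n \<phi> (fst (b i)) \<and> x \<notin> fibre M n \<phi> (snd (b i))}"
    by (elim exE conjE)
  let ?Y = "{x \<in> X. \<forall>i<k. x \<in> fibre M n \<phi> (fst (b i)) \<and> x \<notin> fibre M n \<phi> (snd (b i))}"
  let ?h = "concat (map (\<lambda>j. fst (b j) @ snd (b j)) [0..<k])"
  define col where "col c = {\<psi> \<in> \<Delta>. sat M ((!) (c @ ?h)) \<psi>}" for c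
  obtain c c' where c: "c \<in> tuples M m" "c' \<in> tuples M m" "col c = col c'"
    "rank_ge (fibre M n \<phi>) (tuples M m) r (?Y \<inter> fibre M n \<phi> c - fibre M n \<phi> c')"
  proof (rule rank_ge_same_colour)
    show "finite (Pow \<Delta>)" using assms(1) by simp
    show "col ` tuples M m \<subseteq> Pow \<Delta>" by (auto simp: col_def)
    show "rank_ge (fibre M n \<phi>) (tuples M m) (r + ?K) ?Y" using rank by (simp add: fm_rank_ge_def)
  qed
  define b' where "b' = b(k := (c, c'))"
  have hist: "map (\<lambda>j. fst (b' j) @ snd (b' j)) [0..<i] = map (\<lambda>j. fst (b j) @ snd (b j)) [0..<i]"
    if "i \<le> k" for i using that by (simp add: b'_def)
  have col: "sat M ((!) (c @ ?h)) \<psi> \<longleftrightarrow> sat M ((!) (c' @ ?h)) \<psi>" if "\<psi> \<in> \<Delta>" for \<psi>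
    using c(3) that by (auto simp: col_def)
  have set: "{x \<in> X. \<forall>i<Suc k. x \<in> fibre M n \<phi> (fst (b' i)) \<and> x \<notin> fibre M n \<phi> (snd (b' i))}
      = ?Y \<inter> fibre M n \<phi> c - fibre M n \<phi> c'"
    by (auto simp: b'_def less_Suc_eq)
  show ?case
  proof (intro exI[of _ b'] conjI allI impI)
    show "fm_rank_ge M n m \<phi> r {x \<in> X. \<forall>i<Suc k. x \<in> fibre M n \<phi> (fst (b' i)) \<and> x \<notin> fibre M n \<phi> (snd (b' i))}"
      unfolding set fm_rank_ge_def by (rule c(4))
    fix i assume i: "i < Suc k"
    show "fst (b' i) \<in> tuples M m" "snd (b' i) \<in> tuples M m"
      using i b c(1,2) by (auto simp: b'_def less_Suc_eq)
    show "\<forall>\<psi>\<in>\<Delta>. sat M ((!) (fst (b' i) @ concat (map (\<lambda>j. fst (b' j) @ snd (b' j)) [0..<i]))) \<psi> \<longleftrightarrow>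
          sat M ((!) (snd (b' i) @ concat (map (\<lambda>j. fst (b' j) @ snd (b' j)) [0..<i]))) \<psi>"
      unfolding hist[OF less_Suc_eq_le[THEN iffD1, OF i]]
      using i b col by (cases "i = k") (simp_all add: b'_def)
  qed
qed

lemma complete_type_realized:
  fixes N :: "('a, 'f, 'r) struct"
  assumes "is_struct L N" "a \<in> tuples N n" "C \<subseteq> univ N"
  shows "{\<chi> \<in> formulas L C n. sat N ((!) a) \<chi>} \<in> complete_types L N n C"
proof -
  obtain s where s: "s \<in> valuations N" "\<forall>i<n. s i = a ! i" using tuples_extend[OF assms(1,2)] by blast
  have "sat N s \<chi>" if "\<chi> \<in> formulas L C n" "sat N ((!) a) \<chi>" for \<chi>
    using sat_formulas_cong[OF that(1), of s "(!) a" N] s(2) that(2) by simp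
  then have "partial_type L N n C {\<chi> \<in> formulas L C n. sat N ((!) a) \<chi>}"
    unfolding partial_type_def using s(1) assms(3) by (intro conjI allI impI bexI[of _ s]) auto
  then show ?thesis by (auto simp: complete_types_def)
qed

text \<open>Were all ranks infinite, \<open>same_type_pairs\<close> would provide any finite part of the following situation: a tuple \<open>a\<close>
  realizing \<open>p\<close> and pairs \<open>b\<^sub>i, b'\<^sub>i\<close>, each of the same type over \<open>M\<close> and the earlier pairs, with \<open>\<phi>(a, b\<^sub>i)\<close> and
  \<open>\<not> \<phi>(a, b'\<^sub>i)\<close>. A small ultraproduct \<open>N\<close> over the set of all candidates realizes the whole of it. The type of
  \<open>a\<close> over \<open>M\<close> and the pairs extends \<open>p\<close>, but a \<open>\<phi>\<close>-definition of it would have its parameters before some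
  pair \<open>b\<^sub>k, b'\<^sub>k\<close>, which it could not tell apart.\<close>

lemma stable_type_finite_rank:
  fixes L :: "('f, 'r) lang" and M :: "('a, 'f, 'r) struct"
  assumes M: "monster L \<kappa> M" and p: "p \<in> complete_types L M n (univ M)"
    and card: "card_le (univ M) (UNIV :: 'u set)"
    and stable: "stable_type TYPE('u) L M n (univ M) p"
    and \<phi>: "\<phi> \<in> formulas L {} (n + m)"
  shows "\<exists>\<theta>\<in>p. \<exists>k. \<not> fm_rank_ge M n m \<phi> k (dset M n \<theta>)"
proof (rule ccontr)
  assume "\<not> ?thesis"
  then have large: "\<And>\<theta> k. \<theta> \<in> p \<Longrightarrow> fm_rank_ge M n m \<phi> k (dset M n \<theta>)" by blast
  have struct: "is_struct L M" using M by (simp add: monster_def)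
  have top: "Neg Fls \<in> p" by (rule complete_type_closed[OF p, of "{}"]) (auto simp: dset_Neg dset_def)
  \<comment> \<open>A set of finitely many tuples has finite rank. Infinity is needed for \<open>L\<close> and \<open>X\<close> to be no larger than \<open>M\<close>.\<close>
  have inf: "infinite (univ M)"
  proof
    assume "finite (univ M)"
    then have "finite (tuples M n)" unfolding tuples_def using finite_lists_length_eq[of "univ M" n] by (simp add: conj_commute)
    with dset_tup have "finite (dset M n (Neg Fls))" by (rule finite_subset)
    from rank_ge_finite[OF large[OF top, unfolded fm_rank_ge_def] this, of "card (dset M n (Neg Fls))"]
    show False by simp
  qed
  define hist where "hist b i = concat (map (\<lambda>j. fst (b j) @ snd (b j)) [0..<i])"
    for b :: "nat \<Rightarrow> 'a list \<times> 'a list" and i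
  \<comment> \<open>\<open>(x, b)\<close> is good for \<open>\<theta>\<close>, \<open>\<Delta>\<close>, \<open>k\<close> if it is as wanted as far as \<open>\<theta>\<close>, \<open>\<Delta>\<close> and the first \<open>k\<close> pairs are concerned.\<close>
  define good where "good \<theta> \<Delta> k = {(x, b). x \<in> dset M n \<theta> \<and> (\<forall>i<k. fst (b i) \<in> tuples M m \<and> snd (b i) \<in> tuples M m \<and>
      (\<forall>\<psi>\<in>\<Delta>. sat M ((!) (fst (b i) @ hist b i)) \<psi> \<longleftrightarrow> sat M ((!) (snd (b i) @ hist b i)) \<psi>) \<and>
      x \<in> fibre M n \<phi> (fst (b i)) \<and> x \<notin> fibre M n \<phi> (snd (b i)))}" for \<theta> \<Delta> and k :: nat
  have good_mono: "good \<theta>' \<Delta>' k' \<subseteq> good \<theta> \<Delta> k" if "dset M n \<theta>' \<subseteq> dset M n \<theta>" "\<Delta> \<subseteq> \<Delta>'" "k \<le> k'" for \<theta> \<theta>' \<Delta> \<Delta>' k k'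
  proof
    fix z assume "z \<in> good \<theta>' \<Delta>' k'"
    then show "z \<in> good \<theta> \<Delta> k" using that unfolding good_def by (cases z) (simp add: subset_iff)
  qed
  have good_nonempty: "good \<theta> \<Delta> k \<noteq> {}" if \<theta>: "\<theta> \<in> p" and \<Delta>: "finite \<Delta>" for \<theta> \<Delta> k
  proof -
    have "fm_rank_ge M n m \<phi> (0 + k * Suc (card (Pow \<Delta>))) (dset M n \<theta>)" by (rule large[OF \<theta>])
    from same_type_pairs[OF \<Delta> this] obtain b where b: "\<forall>i<k. fst (b i) \<in> tuples M m \<and> snd (b i) \<in> tuples M m \<and>
       (\<forall>\<psi>\<in>\<Delta>. sat M ((!) (fst (b i) @ hist b i)) \<psi> \<longleftrightarrow> sat M ((!) (snd (b i) @ hist b i)) \<psi>)"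
      "fm_rank_ge M n m \<phi> 0 {x \<in> dset M n \<theta>. \<forall>i<k. x \<in> fibre M n \<phi> (fst (b i)) \<and> x \<notin> fibre M n \<phi> (snd (b i))}"
      unfolding hist_def by (elim exE conjE)
    from b(2) obtain x where "x \<in> dset M n \<theta>" "\<forall>i<k. x \<in> fibre M n \<phi> (fst (b i)) \<and> x \<notin> fibre M n \<phi> (snd (b i))"
      by (auto simp: fm_rank_ge_def)
    with b(1) have "(x, b) \<in> good \<theta> \<Delta> k" by (simp add: good_def)
    then show ?thesis by blast
  qed
  define S where "S = {good \<theta> \<Delta> k | \<theta> \<Delta> k. \<theta> \<in> p \<and> finite \<Delta>}"
  have "\<Inter>F \<noteq> {}" if F: "finite F" "F \<subseteq> S" for F
  proof -
    have "\<exists>\<theta> \<Delta> k. \<theta> \<in> p \<and> finite \<Delta> \<and> good \<theta> \<Delta> k \<subseteq> \<Inter>F"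
      using F
    proof (induction F)
      case empty
      then show ?case using top by (intro exI[of _ "Neg Fls"] exI[of _ "{}"]) simp
    next
      case (insert G F)
      then have "\<exists>\<theta> \<Delta> k. \<theta> \<in> p \<and> finite \<Delta> \<and> good \<theta> \<Delta> k \<subseteq> \<Inter>F" by simp
      then obtain \<theta> \<Delta> k where 1: "\<theta> \<in> p" "finite \<Delta>" "good \<theta> \<Delta> k \<subseteq> \<Inter>F" by (elim exE conjE)
      have "G \<in> S" using insert.prems by simp
      then obtain \<theta>' \<Delta>' k' where 2: "\<theta>' \<in> p" "finite \<Delta>'" "G = good \<theta>' \<Delta>' k'"
        unfolding S_def by (elim CollectE exE conjE)
      let ?g = "good (And \<theta> \<theta>') (\<Delta> \<union> \<Delta>') (max k k')"
      have "?g \<subseteq> good \<theta> \<Delta> k" "?g \<subseteq> good \<theta>' \<Delta>' k'" by (rule good_mono; auto simp: dset_And)+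
      then have "?g \<subseteq> \<Inter>(insert G F)" using 1(3) 2(3) by auto
      moreover have "And \<theta> \<theta>' \<in> p" by (rule complete_type_And[OF p 1(1) 2(1)])
      ultimately show ?case using 1(2) 2(2) by (intro exI[of _ "And \<theta> \<theta>'"] exI[of _ "\<Delta> \<union> \<Delta>'"]) auto
    qed
    then obtain \<theta> \<Delta> k where 1: "\<theta> \<in> p" "finite \<Delta>" "good \<theta> \<Delta> k \<subseteq> \<Inter>F" by (elim exE conjE)
    from good_nonempty[OF 1(1,2), of k] 1(3) show ?thesis by auto
  qed
  then obtain U where U: "ultra U" "S \<subseteq> U" by (rule ultra_exists)
  have goodU: "good \<theta> \<Delta> k \<in> U" if "\<theta> \<in> p" "finite \<Delta>" for \<theta> \<Delta> k
    using U(2) that by (auto simp: S_def)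
  obtain a0 where a0: "a0 \<in> univ M" using struct by (auto simp: is_struct_def)
  \<comment> \<open>The indices are arbitrary lists and sequences, so entries outside the universe get a default value.\<close>
  define cl where "cl a = (if a \<in> univ M then a else a0)" for a
  have cl_tup: "map (\<lambda>l. cl (xs ! l)) [0..<k] = xs" if "xs \<in> tuples M k" for xs k
  proof (rule nth_equalityI)
    fix i assume "i < length (map (\<lambda>l. cl (xs ! l)) [0..<k])"
    then have "i < k" "xs ! i \<in> univ M" using that nth_mem[of i xs] by (auto simp: tuples_def)
    then show "map (\<lambda>l. cl (xs ! l)) [0..<k] ! i = xs ! i" by (simp add: cl_def)
  qed (use that in \<open>simp add: tuples_def\<close>)
  define ax where "ax l = (\<lambda>(x, b :: nat \<Rightarrow> 'a list \<times> 'a list). cl (x ! l))" for l :: nat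
  define bx where "bx i l = (\<lambda>(x :: 'a list, b :: nat \<Rightarrow> 'a list \<times> 'a list). cl (fst (b i) ! l))" for i l :: nat
  define bx' where "bx' i l = (\<lambda>(x :: 'a list, b :: nat \<Rightarrow> 'a list \<times> 'a list). cl (snd (b i) ! l))" for i l :: nat
  define X where "X = range ax \<union> (\<lambda>(i, l). bx i l) ` UNIV \<union> (\<lambda>(i, l). bx' i l) ` UNIV"
  have nat2: "card_le (UNIV :: (nat \<times> nat) set) (univ M)"
    using card_le_Times[OF inf card_le_nat[OF inf] card_le_nat[OF inf], of UNIV UNIV] by simp
  interpret small_ultraproduct L M U X "TYPE('u)"
  proof
    show "is_struct L M" "ultra U" "infinite (univ M)" "card_le (univ M) (UNIV :: 'u set)"
      by (fact struct U(1) inf card)+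
    show "card_le (funs L) (univ M)" "card_le (rels L) (univ M)"
      using small_card_le[OF M inf] M by (auto simp: monster_def)
    show "card_le X (univ M)"
      unfolding X_def by (intro card_le_Un card_le_image card_le_nat nat2 inf)
    fix F i assume "F \<in> X"
    then show "F i \<in> univ M" using a0 by (auto simp: X_def ax_def bx_def bx'_def cl_def split: prod.splits)
  qed
  define aF where "aF = map ax [0..<n]"
  define bF where "bF i = map (bx i) [0..<m]" for i
  define bF' where "bF' i = map (bx' i) [0..<m]" for i
  define hF where "hF i = concat (map (\<lambda>j. bF j @ bF' j) [0..<i])" for i
  have inX: "set aF \<subseteq> H" "set (bF i) \<subseteq> H" "set (bF' i) \<subseteq> H" for i
    using H_X by (auto simp: aF_def bF_def bF'_def X_def)
  have hH: "set (hF i) \<subseteq> H" for i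
    by (auto simp: hF_def dest: subsetD[OF inX(2)] subsetD[OF inX(3)])
  have len: "length aF = n" "length (bF i) = m" "length (bF' i) = m" for i
    by (auto simp: aF_def bF_def bF'_def)
  have aF: "map (\<lambda>F. F (x, b)) aF = x" if "x \<in> tuples M n" for x b
    using cl_tup[OF that] by (simp add: aF_def ax_def o_def)
  have bF: "map (\<lambda>F. F (x, b)) (bF i) = fst (b i)" if "fst (b i) \<in> tuples M m" for x b i
    using cl_tup[OF that] by (simp add: bF_def bx_def o_def)
  have bF': "map (\<lambda>F. F (x, b)) (bF' i) = snd (b i)" if "snd (b i) \<in> tuples M m" for x b i
    using cl_tup[OF that] by (simp add: bF'_def bx'_def o_def)
  have hF: "map (\<lambda>F. F (x, b)) (hF i) = hist b i" if "\<forall>j<i. fst (b j) \<in> tuples M m \<and> snd (b j) \<in> tuples M m" for x b i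
    unfolding hF_def hist_def map_concat map_map using that
    by (intro arg_cong[where f = concat] map_cong refl) (auto simp: bF bF')
  define a where "a = map cls aF"
  define C where "C = emb ` univ M \<union> (\<Union>i. set (map cls (bF i)) \<union> set (map cls (bF' i)))"
  define q where "q = {\<chi> \<in> formulas L C n. sat N ((!) a) \<chi>}"
  have cls_N: "set (map cls Fs) \<subseteq> univ N" if "set Fs \<subseteq> H" for Fs using that by (auto intro: cls_univ)
  have C: "C \<subseteq> univ N"
    unfolding C_def by (intro Un_least UN_least emb_univ cls_N inX)
  have a: "a \<in> tuples N n" using cls_N[OF inX(1)] len(1) by (simp add: a_def tuples_def)
  have q: "q \<in> complete_types L N n C" unfolding q_def by (rule complete_type_realized[OF struct_N a C])
  have pq: "map_params emb ` p \<subseteq> q"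
  proof
    fix \<chi> assume "\<chi> \<in> map_params emb ` p"
    then obtain \<theta> where \<theta>: "\<theta> \<in> p" "\<chi> = map_params emb \<theta>" by blast
    have \<theta>M: "\<theta> \<in> formulas L (univ M) n" using complete_typeD(2)[OF p] \<theta>(1) by blast
    have "good \<theta> {} 0 \<subseteq> {i. sat M ((!) (map (\<lambda>F. F i) aF)) \<theta>}"
      using aF by (auto simp: good_def dset_def)
    then have "{i. sat M ((!) (map (\<lambda>F. F i) aF)) \<theta>} \<in> U" 
      by (rule ultra_mono[OF U(1) goodU[OF \<theta>(1) finite.emptyI]])
    then have "sat N ((!) a) \<chi>" unfolding a_def \<theta>(2) using los_list[of \<theta> aF] \<theta>M inX(1) len by simp
    moreover have "\<chi> \<in> formulas L C n"
      unfolding \<theta>(2) using map_params_formulas[OF \<theta>M, of emb] by (rule subsetD[OF formulas_mono[OF _ order_refl], rotated]) (simp add: C_def)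
    ultimately show "\<chi> \<in> q" by (simp add: q_def)
  qed
  have "emb ` univ M \<subseteq> C" by (simp add: C_def)
  then have "definable_type L N n C q"
    by (intro conjunct2[OF stable[unfolded stable_type_def], rule_format, of N emb C q] conjI
      struct_N elementary_emb C q pq)
  moreover have \<phi>N: "map_params emb \<phi> \<in> formulas L {} (n + m)" using map_params_formulas[OF \<phi>, of emb] by simp
  ultimately obtain \<psi> where \<psi>: "\<psi> \<in> formulas L C m"
    "\<forall>cs. length cs = m \<and> set cs \<subseteq> C \<longrightarrow> (inst n cs (map_params emb \<phi>) \<in> q \<longleftrightarrow> models N (inst 0 cs \<psi>))"
    unfolding definable_type_def by (metis (no_types, lifting))
  have def: "sat N ((!) (a @ cs)) (map_params emb \<phi>) \<longleftrightarrow> sat N ((!) cs) \<psi>" if "length cs = m" "set cs \<subseteq> C" for cs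
  proof -
    have "inst n cs (map_params emb \<phi>) \<in> formulas L C n"
      by (rule inst_formulas[of _ _ "{}"]) (use \<phi>N that in auto)
    moreover have "sat N ((!) a) (inst n cs (map_params emb \<phi>)) \<longleftrightarrow> sat N ((!) (a @ cs)) (map_params emb \<phi>)"
      by (rule sat_inst) (use \<phi>N that a in \<open>auto simp: tuples_def\<close>)
    ultimately show ?thesis
      using \<psi>(2) that models_inst[OF struct_N \<psi>(1), of cs] by (auto simp: q_def)
  qed
  \<comment> \<open>The parameters of \<open>\<psi>\<close> come from \<open>M\<close> and finitely many of the pairs; \<open>k\<close> is beyond them.\<close>
  have "\<exists>k. F \<subseteq> emb ` univ M \<union> set (map cls (hF k))" if "finite F" "F \<subseteq> C" for F
    using that
  proof (induction F)
    case (insert c F)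
    then obtain k where k: "F \<subseteq> emb ` univ M \<union> set (map cls (hF k))" by auto
    obtain j where j: "c \<in> emb ` univ M \<union> set (map cls (hF j))"
    proof (cases "c \<in> emb ` univ M")
      case True
      then show thesis using that[of 0] by simp
    next
      case False
      then obtain i where "c \<in> set (map cls (bF i)) \<union> set (map cls (bF' i))" using insert.prems by (auto simp: C_def)
      then show thesis using that[of "Suc i"] by (auto simp: hF_def)
    qed
    have hF_set: "set (hF k) = (\<Union>j<k. set (bF j) \<union> set (bF' j))" for k
      by (simp add: hF_def atLeast0LessThan)
    have mono: "set (hF k) \<subseteq> set (hF k')" if "k \<le> k'" for k k'
      unfolding hF_set by (rule UN_mono) (use that in auto)
    let ?P = "\<lambda>k. emb ` univ M \<union> set (map cls (hF k))"
    have P: "?P k \<subseteq> ?P k'" if "k \<le> k'" for k k'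
      using image_mono[OF mono[OF that], of cls] by (intro Un_mono) simp_all
    have "F \<subseteq> ?P (max k j)" using k P[of k "max k j"] by (rule order_trans) simp
    moreover have "c \<in> ?P (max k j)" using P[of j "max k j"] j by (rule subsetD[rotated, rotated]) simp
    ultimately have "insert c F \<subseteq> ?P (max k j)" by (simp only: insert_subset)
    then show ?case by (rule exI)
  qed simp
  moreover have "finite (params \<psi>)" "params \<psi> \<subseteq> C" using \<psi>(1) finite_params by (auto simp: formulas_def)
  ultimately have "\<exists>k. params \<psi> \<subseteq> emb ` univ M \<union> set (map cls (hF k))" by this
  then obtain k where k: "params \<psi> \<subseteq> emb ` univ M \<union> set (map cls (hF k))" by (rule exE)
  then have "\<psi> \<in> formulas L (emb ` univ M \<union> set (map cls (hF k))) m" using \<psi>(1) by (simp add: formulas_def)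
  from parameters_to_variables[OF this, where 'd = 'u]
  obtain \<psi>' where \<psi>': "\<psi>' \<in> formulas L (emb ` univ M) (m + length (map cls (hF k)))"
    "\<forall>(N :: ('u, 'f, 'r) struct) h xs. length xs = m \<longrightarrow>
       sat N ((!) (xs @ map h (map cls (hF k)))) (map_params h \<psi>') \<longleftrightarrow> sat N ((!) xs) (map_params h \<psi>)"
    by (rule bexE)
  define \<psi>M where "\<psi>M = map_params (inv_into (univ M) emb) \<psi>'"
  have emb_\<psi>M: "map_params emb \<psi>M = \<psi>'"
    unfolding \<psi>M_def map_params_comp using \<psi>'(1)
    by (intro map_params_idem) (auto simp: formulas_def f_inv_into_f)
  have \<psi>M: "\<psi>M \<in> formulas L (univ M) (m + length (hF k))"
  proof -
    have "inv_into (univ M) emb ` emb ` univ M \<subseteq> univ M" by (auto intro: inv_into_into)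
    from subsetD[OF formulas_mono[OF this order_refl] map_params_formulas[OF \<psi>'(1)]]
    show ?thesis by (simp add: \<psi>M_def)
  qed
  have \<psi>_los: "sat N ((!) (map cls Fs)) \<psi> \<longleftrightarrow> {i. sat M ((!) (map (\<lambda>F. F i) (Fs @ hF k))) \<psi>M} \<in> U"
    if "length Fs = m" "set Fs \<subseteq> H" for Fs
  proof -
    have "sat N ((!) (map cls Fs)) \<psi> \<longleftrightarrow> sat N ((!) (map cls (Fs @ hF k))) (map_params emb \<psi>M)"
      using \<psi>'(2)[rule_format, of "map cls Fs" N "\<lambda>c. c"] that(1) by (simp add: fm.map_ident emb_\<psi>M)
    also have "\<dots> \<longleftrightarrow> {i. sat M ((!) (map (\<lambda>F. F i) (Fs @ hF k))) \<psi>M} \<in> U"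
      by (rule los_list) (use that \<psi>M hH[of k] in simp_all)
    finally show ?thesis .
  qed
  let ?G = "good (Neg Fls) {\<psi>M} (Suc k)"
  have G: "?G \<in> U" using goodU[OF top] by simp
  have in_G: "fst (b k) \<in> tuples M m \<and> snd (b k) \<in> tuples M m \<and> x \<in> tuples M n \<and>
      map (\<lambda>F. F (x, b)) (hF k) = hist b k \<and>
      (sat M ((!) (fst (b k) @ hist b k)) \<psi>M \<longleftrightarrow> sat M ((!) (snd (b k) @ hist b k)) \<psi>M) \<and>
      x \<in> fibre M n \<phi> (fst (b k)) \<and> x \<notin> fibre M n \<phi> (snd (b k))" if "(x, b) \<in> ?G" for x b
    using that hF[of k b x] unfolding good_def by (auto simp: dset_def)
  have \<phi>M: "\<phi> \<in> formulas L (univ M) (n + m)" using \<phi> formulas_mono[of "{}" "univ M"] by blast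
  have bC: "set (map cls (bF k)) \<subseteq> C" "set (map cls (bF' k)) \<subseteq> C" unfolding C_def by blast+
  have "?G \<subseteq> {i. sat M ((!) (map (\<lambda>F. F i) (aF @ bF k))) \<phi>}"
    using in_G aF bF by (fastforce simp: fibre_def)
  then have "{i. sat M ((!) (map (\<lambda>F. F i) (aF @ bF k))) \<phi>} \<in> U" by (rule ultra_mono[OF U(1) G])
  then have "sat N ((!) (a @ map cls (bF k))) (map_params emb \<phi>)"
    using los_list[of \<phi> "aF @ bF k"] \<phi>M inX len by (simp add: a_def)
  then have "sat N ((!) (map cls (bF k))) \<psi>" using def[of "map cls (bF k)"] bC len by simp
  then have "{i. sat M ((!) (map (\<lambda>F. F i) (bF k @ hF k))) \<psi>M} \<in> U" using \<psi>_los[of "bF k"] len inX by simp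
  from ultra_Int[OF U(1) this G] have "{i. sat M ((!) (map (\<lambda>F. F i) (bF' k @ hF k))) \<psi>M} \<in> U"
  proof (rule ultra_mono[OF U(1)], intro subsetI CollectI)
    fix i assume i: "i \<in> {i. sat M ((!) (map (\<lambda>F. F i) (bF k @ hF k))) \<psi>M} \<inter> ?G"
    obtain x b where xb: "i = (x, b)" by (cases i)
    show "sat M ((!) (map (\<lambda>F. F i) (bF' k @ hF k))) \<psi>M"
      using i in_G[of x b] bF[of b k x] bF'[of b k x] unfolding xb by simp
  qed
  then have "sat N ((!) (map cls (bF' k))) \<psi>" using \<psi>_los[of "bF' k"] len inX by simp
  then have "sat N ((!) (a @ map cls (bF' k))) (map_params emb \<phi>)" using def[of "map cls (bF' k)"] bC len by simp
  then have "{i. sat M ((!) (map (\<lambda>F. F i) (aF @ bF' k))) \<phi>} \<in> U"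
    using los_list[of \<phi> "aF @ bF' k"] \<phi>M inX len by (simp add: a_def)
  from ultra_Int[OF U(1) this G] have "{i. sat M ((!) (map (\<lambda>F. F i) (aF @ bF' k))) \<phi>} \<inter> ?G \<noteq> {}"
    using U(1) unfolding ultra_def by metis
  then obtain x b where xb: "(x, b) \<in> ?G" "sat M ((!) (map (\<lambda>F. F (x, b)) (aF @ bF' k))) \<phi>" by auto
  then show False using in_G[OF xb(1)] aF[of x b] bF'[of b k x] by (auto simp: fibre_def)
qed

section \<open>Stability of the restriction\<close>

theorem theorem3p19:
  fixes L :: "('f, 'r) lang"
    and T :: "('f, 'r, 'a) fm set"
    and \<CC> :: "('a, 'f, 'r) struct"
    and \<kappa> :: "'k rel"
    and A :: "'a set"
    and n :: nat
    and p :: "('f, 'r, 'a) fm set"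
  assumes "complete_theory L T"
    and "monster L \<kappa> \<CC>"
    and "\<forall>\<tau>\<in>T. models \<CC> \<tau>"
    and "A \<subseteq> univ \<CC>"
    and "small \<kappa> A"
    and "p \<in> complete_types L \<CC> n (univ \<CC>)"
    and "(card_of (univ \<CC>), card_of (UNIV :: 'u set)) \<in> ordLeq"
    and "stable_type TYPE('u) L \<CC> n (univ \<CC>) p"
    and "invariant_type L \<CC> A p"
  shows "stable_type TYPE('v) L \<CC> n A (restrict_type p A)"
proof -
  interpret finite_rank_type L \<CC> \<kappa> n p
    by unfold_locales (use assms stable_type_finite_rank[OF assms(2,6,7,8)] in auto)
  have A: "inv_base A" using assms by (simp add: inv_base_def base_def)
  have over: "restrict_type p A = over A" by (simp add: restrict_type_def over_def)
  have partial: "partial_type L \<CC> n A (over A)"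
    unfolding partial_type_def
  proof (intro conjI allI impI)
    fix \<Phi> assume "finite \<Phi> \<and> \<Phi> \<subseteq> over A"
    then have "finite \<Phi>" "\<Phi> \<subseteq> p" by (auto simp: over_def)
    moreover have "partial_type L \<CC> n (univ \<CC>) p" using p by (simp add: complete_types_def)
    ultimately show "\<exists>s\<in>valuations \<CC>. \<forall>\<phi>\<in>\<Phi>. sat \<CC> s \<phi>" by (simp add: partial_type_def)
  qed (use assms(4) over_formulas in auto)
  show ?thesis
    unfolding stable_type_def over
  proof (intro conjI allI impI, rule partial, elim conjE)
    fix N :: "('v, 'f, 'r) struct" and h C q
    assume N: "is_struct L N" "elementary_map L \<CC> N (univ \<CC>) h" and C: "h ` A \<subseteq> C" "C \<subseteq> univ N"
      and q: "q \<in> complete_types L N n C" and sub: "map_params h ` over A \<subseteq> q"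
    show "definable_type L N n C q"
    proof (rule definable_type_if_finite_rank[OF N(1) q])
      fix m and \<phi> :: "('f, 'r, 'v) fm" assume \<phi>: "\<phi> \<in> formulas L {} (n + m)"
      \<comment> \<open>\<open>\<phi>\<close> has no parameters, so any map on parameters carries it back to \<open>\<CC>\<close>.\<close>
      define \<phi>' :: "('f, 'r, 'a) fm" where "\<phi>' = map_params (\<lambda>_. undefined) \<phi>"
      have \<phi>': "\<phi>' \<in> formulas L {} (n + m)" using map_params_formulas[OF \<phi>] by (simp add: \<phi>'_def)
      have eq: "map_params h \<phi>' = \<phi>"
        unfolding \<phi>'_def map_params_comp by (rule map_params_idem) (use \<phi> in \<open>simp add: formulas_def\<close>)
      from finite_rank_over[OF A \<phi>'] obtain \<theta> k where
        \<theta>: "\<theta> \<in> over A" "\<not> fm_rank_ge \<CC> n m \<phi>' k (dset \<CC> n \<theta>)" by (elim bexE exE)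
      have "\<theta> \<in> formulas L (univ \<CC>) n" using \<theta>(1) p_formulas by (simp add: over_def)
      from fm_rank_ge_elementary[OF struct N \<phi>' this] have "\<not> fm_rank_ge N n m \<phi> k (dset N n (map_params h \<theta>))"
        using \<theta>(2) unfolding eq by simp
      then show "\<exists>\<theta>\<in>q. \<exists>k. \<not> fm_rank_ge N n m \<phi> k (dset N n \<theta>)" using \<theta>(1) sub by blast
    qed
  qed
qed

end
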